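(* Let $n\ge1$, let $G(z,t)$ be a Herglotz vector field in the class $\mathcal M_n$ with $(\varphi_t):=(\varphi_t^G)$, and assume that $$\sup_{z\in\mathbb B^n\setminus\{0\}}\mathrm{Re}\,\left\langle G(z,T),\frac{z}{\|z\|^2}\right\rangle<0$$ for some $T\in R_G$. Then $e^t\varphi_t\in\mathcal S_n^0$ is not extremal for any $t\in(T,\infty]$ (where for $t=\infty$, $e^t\varphi_t$ means $\lim_{s\to\infty}e^s\varphi_s$).
   Context: $\mathbb B^n=\{z\in\mathbb C^n:\|z\|<1\}$ is the Euclidean unit ball, $\mathrm{Hol}(\mathbb B^n,\mathbb C^n)$ is the Fréchet space of holomorphic maps $\mathbb B^n\to\mathbb C^n$ with the compact-open topology, $\langle\cdot,\cdot\rangle$ is the standard Euclidean (Hermitian) inner product of $\mathbb C^n$, $\mathbb R^+=(0,\infty)$, and $df_z$ is the complex derivative of $f$ at $z$. $\mathcal M_n=\{h\in\mathrm{Hol}(\mathbb B^n,\mathbb C^n): h(0)=0,\ dh_0=-\mathrm{id},\ \mathrm{Re}\,\langle h(z),z\rangle\le 0 \text{ for all } z\in\mathbb B^n\}$. A Herglotz vector field in the class $\mathcal M_n$ is a mapping $G:\mathbb B^n\times\mathbb R^+\to\mathbb C^n$ such that $G(z,\cdot)$ is measurable on $\mathbb R^+$ for every $z\in\mathbb B^n$ and $G(\cdot,t)\in\mathcal M_n$ for a.e. $t\in\mathbb R^+$. For such $G$, $\varphi^G_t$ denotes the unique (locally absolutely continuous in $t$) solution of $\dot\varphi_t(z)=G(\varphi_t(z),t)$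 for a.e. $t\ge 0$, $\varphi_0(z)=z\in\mathbb B^n$. The limit $f^G:=\lim_{t\to\infty}e^t\varphi^G_t$ exists locally uniformly in $\mathbb B^n$, and $\mathcal S_n^0:=\{f^G : G \text{ a Herglotz vector field in the class } \mathcal M_n\}$; it is known that also $e^t\varphi_t^G\in\mathcal S_n^0$ for all finite $t\ge0$. Regular points: a set $E_G\subseteq\mathbb R^+$ of measure zero is fixed such that for all $t\in\mathbb R^+\setminus E_G$ one has $G(z,t)=\lim_{\varepsilon\to0+}\frac1\varepsilon\int_{t-\varepsilon}^tG(z,\sigma)\,d\sigma$ locally uniformly with respect to $z\in\mathbb B^n$ (such a set exists); $R_G:=\mathbb R^+\setminus E_G$. Complex derivative: let $U\subseteq\mathrm{Hol}(\mathbb B^n,\mathbb C^n)$ be open and $\Phi:U\to\mathbb C$ continuous. $\Phi$ is differentiable at $f\in U$ along $h\in\mathrm{Hol}(\mathbb B^n,\mathbb C^n)$ if $\Lambda(f;h):=\lim_{\mathbb C\ni\delta\to0}\frac{\Phi(f+\delta h)-\Phi(f)}{\delta}$ exists. $\Phi$ is complex differentiable at $F\in U$ if there is an open neighborhood $V\subseteq U$ of $F$ such that $\Phi$ is differentiable at every $f\in V$ along every $h\in\mathrm{Hol}(\mathbb B^n,\mathbb C^n)$ and $\Lambda:V\times\mathrm{Hol}(\mathbb B^n,\mathbb C^n)\to\mathbb C$ is continuous; then $L:=\Lambda(F;\cdot)$, a continuous linear functional, is called the complex derivative of $\Phi$ at $F$. Extremal: $F\in\mathcal S_n^0$ is called extremal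 if there exist an open set $U\supseteq\mathcal S_n^0$ in $\mathrm{Hol}(\mathbb B^n,\mathbb C^n)$ and a continuous functional $\Phi:U\to\mathbb C$, complex differentiable at $F$ with complex derivative $L$ at $F$, such that $\mathrm{Re}\,\Phi(f)\le\mathrm{Re}\,\Phi(F)$ for all $f\in\mathcal S_n^0$ and $L$ is not constant on $\mathcal S_n^0$. *)

theory Defs
  imports "HOL-Analysis.Analysis"
begin

abbreviation unit_ball :: "(complex ^ 'n) set" where
  "unit_ball \<equiv> ball 0 1"

definition hinner :: "complex ^ 'n \<Rightarrow> complex ^ 'n \<Rightarrow> complex" where
  "hinner z w = (\<Sum>i\<in>UNIV. z $ i * cnj (w $ i))"

text \<open>
  A map defined on the unit ball only is represented by an element of
  \<^term>\<open>extensional unit_ball\<close>, so that equality of functions is equality on the ball.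
  Operations on such maps are followed by a restriction to the ball.

  Holomorphy in several variables means that the real Frechet derivative exists at every
  point and is complex linear (additivity is part of the library notion of derivative).
\<close>

definition Hol :: "(complex ^ 'n \<Rightarrow> complex ^ 'n) set" where
  "Hol = {f \<in> extensional unit_ball. \<forall>z\<in>unit_ball.
     \<exists>D. (f has_derivative D) (at z) \<and> (\<forall>c v. D (c *s v) = c *s D v)}"

definition Hol_topology :: "(complex ^ 'n \<Rightarrow> complex ^ 'n) topology" where
  "Hol_topology = topology_generated_by
     {{f \<in> Hol. f ` K \<subseteq> V} | K V. compact K \<and> K \<subseteq> unit_ball \<and> open V}"

text \<open>Since the ball is locally compact, locally uniform convergence is uniform convergence on
  compact subsets.\<close>

definition loc_uniform_limit ::
  "('a \<Rightarrow> complex ^ 'n \<Rightarrow> complex ^ 'n) \<Rightarrow> (complex ^ 'n \<Rightarrow> complex ^ 'n) \<Rightarrow> 'a filter \<Rightarrow> bool" where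
  "loc_uniform_limit f l F \<longleftrightarrow>
     (\<forall>K. compact K \<and> K \<subseteq> unit_ball \<longrightarrow> uniform_limit K f l F)"

definition class_M :: "(complex ^ 'n \<Rightarrow> complex ^ 'n) set" where
  "class_M = {h \<in> Hol. h 0 = 0 \<and> (h has_derivative (\<lambda>v. - v)) (at 0) \<and>
     (\<forall>z\<in>unit_ball. Re (hinner (h z) z) \<le> 0)}"

text \<open>Measurability in time is Lebesgue measurability. Only the values of \<^term>\<open>G z t\<close> with
  \<^term>\<open>z \<in> unit_ball\<close> and \<^term>\<open>t > (0::real)\<close> matter.\<close>

definition herglotz_vector_field :: "(complex ^ 'n \<Rightarrow> real \<Rightarrow> complex ^ 'n) \<Rightarrow> bool" where
  "herglotz_vector_field G \<longleftrightarrow>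
     (\<forall>z\<in>unit_ball. G z \<in> borel_measurable (lebesgue_on {0<..})) \<and>
     (AE t in lebesgue_on {0<..}. (\<lambda>z\<in>unit_ball. G z t) \<in> class_M)"

text \<open>Absolute continuity on a compact interval; a finite set of pairs \<^term>\<open>(u, v)\<close> encodes a
  finite family of non-overlapping intervals with end points \<^term>\<open>u\<close> and \<^term>\<open>v\<close>.\<close>

definition abs_continuous_on :: "real \<Rightarrow> real \<Rightarrow> (real \<Rightarrow> 'a::real_normed_vector) \<Rightarrow> bool" where
  "abs_continuous_on a b f \<longleftrightarrow>
     (\<forall>\<epsilon>>0. \<exists>\<delta>>0. \<forall>D :: (real \<times> real) set.
        finite D \<and> (\<forall>(u, v)\<in>D. a \<le> u \<and> u \<le> v \<and> v \<le> b) \<and>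
        pairwise (\<lambda>p q. {fst p<..<snd p} \<inter> {fst q<..<snd q} = {}) D \<and>
        (\<Sum>(u, v)\<in>D. v - u) < \<delta>
        \<longrightarrow> (\<Sum>(u, v)\<in>D. norm (f v - f u)) < \<epsilon>)"

text \<open>\<^term>\<open>\<phi> t z\<close> solves the initial value problem of the vector field \<^term>\<open>G\<close>. The exceptional
  null set of times may depend on the starting point \<^term>\<open>z\<close>.\<close>

definition evolution ::
  "(complex ^ 'n \<Rightarrow> real \<Rightarrow> complex ^ 'n) \<Rightarrow> (real \<Rightarrow> complex ^ 'n \<Rightarrow> complex ^ 'n) \<Rightarrow> bool" where
  "evolution G \<phi> \<longleftrightarrow>
     (\<forall>z\<in>unit_ball.
        \<phi> 0 z = z \<and>
        (\<forall>t\<ge>0. \<phi> t z \<in> unit_ball) \<and>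
        (\<forall>b\<ge>0. abs_continuous_on 0 b (\<lambda>t. \<phi> t z)) \<and>
        (AE t in lebesgue_on {0..}.
           ((\<lambda>s. \<phi> s z) has_vector_derivative G (\<phi> t z) t) (at t)))"

definition scaled_evolution ::
  "(real \<Rightarrow> complex ^ 'n \<Rightarrow> complex ^ 'n) \<Rightarrow> real \<Rightarrow> complex ^ 'n \<Rightarrow> complex ^ 'n" where
  "scaled_evolution \<phi> t = (\<lambda>z\<in>unit_ball. exp t *\<^sub>R \<phi> t z)"

definition evolution_limit ::
  "(real \<Rightarrow> complex ^ 'n \<Rightarrow> complex ^ 'n) \<Rightarrow> (complex ^ 'n \<Rightarrow> complex ^ 'n) \<Rightarrow> bool" where
  "evolution_limit \<phi> F \<longleftrightarrow>
     F \<in> extensional unit_ball \<and> loc_uniform_limit (scaled_evolution \<phi>) F at_top"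

definition class_S0 :: "(complex ^ 'n \<Rightarrow> complex ^ 'n) set" where
  "class_S0 = {F. \<exists>G \<phi>. herglotz_vector_field G \<and> evolution G \<phi> \<and> evolution_limit \<phi> F}"

text \<open>\<^term>\<open>E\<close> is an admissible choice of the exceptional null set, that is, all times in
  \<^term>\<open>{0<..} - E\<close> are regular. For small positive \<^term>\<open>\<epsilon>\<close> the integral is over a
  compact subinterval of the positive half-line.\<close>

definition exceptional_set :: "(complex ^ 'n \<Rightarrow> real \<Rightarrow> complex ^ 'n) \<Rightarrow> real set \<Rightarrow> bool" where
  "exceptional_set G E \<longleftrightarrow>
     E \<subseteq> {0<..} \<and> E \<in> null_sets lebesgue \<and>
     (\<forall>t\<in>{0<..} - E. loc_uniform_limit
        (\<lambda>\<epsilon> z. (1 / \<epsilon>) *\<^sub>R (LINT \<sigma>:{t - \<epsilon>..t}|lebesgue. G z \<sigma>)) (\<lambda>z. G z t) (at_right 0))"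

definition differentiable_along ::
  "((complex ^ 'n \<Rightarrow> complex ^ 'n) \<Rightarrow> complex) \<Rightarrow> (complex ^ 'n \<Rightarrow> complex ^ 'n) \<Rightarrow>
   (complex ^ 'n \<Rightarrow> complex ^ 'n) \<Rightarrow> complex \<Rightarrow> bool" where
  "differentiable_along \<Phi> f h l \<longleftrightarrow>
     ((\<lambda>\<delta>. (\<Phi> (\<lambda>z\<in>unit_ball. f z + \<delta> *s h z) - \<Phi> f) / \<delta>) \<longlongrightarrow> l) (at 0)"

definition has_functional_derivative ::
  "(complex ^ 'n \<Rightarrow> complex ^ 'n) set \<Rightarrow> ((complex ^ 'n \<Rightarrow> complex ^ 'n) \<Rightarrow> complex) \<Rightarrow>
   (complex ^ 'n \<Rightarrow> complex ^ 'n) \<Rightarrow> ((complex ^ 'n \<Rightarrow> complex ^ 'n) \<Rightarrow> complex) \<Rightarrow> bool" where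
  "has_functional_derivative U \<Phi> F L \<longleftrightarrow>
     (\<exists>V \<Lambda>. openin Hol_topology V \<and> F \<in> V \<and> V \<subseteq> U \<and>
        (\<forall>f\<in>V. \<forall>h\<in>Hol. differentiable_along \<Phi> f h (\<Lambda> f h)) \<and>
        continuous_map (prod_topology (subtopology Hol_topology V) Hol_topology) euclidean
          (\<lambda>(f, h). \<Lambda> f h) \<and>
        (\<forall>h\<in>Hol. L h = \<Lambda> F h))"

definition extremal :: "(complex ^ 'n \<Rightarrow> complex ^ 'n) \<Rightarrow> bool" where
  "extremal F \<longleftrightarrow> F \<in> class_S0 \<and>
     (\<exists>U \<Phi> L. openin Hol_topology U \<and> class_S0 \<subseteq> U \<and>
        continuous_map (subtopology Hol_topology U) euclidean \<Phi> \<and>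
        has_functional_derivative U \<Phi> F L \<and>
        (\<forall>f\<in>class_S0. Re (\<Phi> f) \<le> Re (\<Phi> F)) \<and>
        \<not> L constant_on class_S0)"

end

theory Submission
  imports Defs "HOL-Complex_Analysis.Complex_Analysis"
begin

text \<open>Replacing \<open>G\<close> by \<open>h \<in> class_M\<close> on a short interval \<open>[T - \<epsilon>, T]\<close> moves the limit map in the direction
  \<open>exp T *\<^sub>R D F_T (\<phi>_T) ((h - G(\<sqdot>, T)) \<circ> \<phi>_T)\<close>, where \<open>F_T\<close> is the limit map of the evolution started at
  time \<open>T\<close>. At an extremal map the real part of \<open>L\<close> is nonpositive on these directions. Since the
  numerical range of \<open>G(\<sqdot>, T)\<close> is bounded away from \<open>0\<close>, the choice \<open>h = G(\<sqdot>, T) + \<delta> q\<close> is admissible for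
  every \<open>q\<close> with \<open>norm (q z) \<le> C (norm z)\<^sup>2\<close> and small complex \<open>\<delta>\<close>, so \<open>L\<close> vanishes on \<open>D F_T (\<phi>_T) (q \<circ> \<phi>_T)\<close>.
  Solving \<open>D F_T q = p\<close> shows \<open>L (p \<circ> \<phi>_T) = 0\<close> for all \<open>p\<close> of order at least two at \<open>0\<close>. This property is
  carried from \<open>\<phi>_T\<close> back to \<open>\<phi>_0 = id\<close> in finitely many short steps, and then \<open>L\<close> is constant on
  \<open>class_S0\<close>, whose members differ by maps of order at least two.

  Holomorphy of the flow maps never has to be derived from the differential equation: an extremal map
  requires an open set of holomorphic maps that contains \<open>class_S0\<close>, and the scaled flow maps are limit
  maps of stopped evolutions.\<close>

text \<open>Three obstacles shape the proof. A functional derivative is given only along fixed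
  directions, whereas the difference quotients of the varied limit maps are directions that move
  with \<open>\<epsilon>\<close>; the mean value theorem on a segment and the joint continuity of
  \<open>\<Lambda>\<close> close this gap, and they also give additivity of \<open>L\<close>. Next,
  maximality yields only an inequality; it becomes an equation because \<open>\<delta>\<close> runs
  through a full circle, so that \<open>\<delta>\<close> times the value of \<open>L\<close> can be
  rotated onto the positive axis. Order two is what the normalisation of \<open>class_M\<close> at 0
  leaves free, and a bound by \<open>(norm z)\<^sup>2\<close> is what the gap in the numerical range
  can absorb. Finally, \<open>\<phi>_T\<close> maps the ball into itself without filling it, so
  passing from \<open>p \<circ> \<phi>_T\<close> to arbitrary maps of order two is an approximation
  problem on the image; over a short time it reduces to Taylor polynomials on a ball. For finite
  \<open>t > T\<close> the field is stopped at time \<open>t\<close>, which is harmless because the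
  field may be changed freely after \<open>T\<close>.\<close>

hide_const (open) Polynomial.content
no_notation fps_nth (infixl "$" 75)

subsection \<open>Absolutely continuous functions\<close>

lemma null_set_outer_open:
  assumes "N \<in> lmeasurable" "measure lebesgue N = 0" "\<delta> > 0"
  obtains W where "open W" "N \<subseteq> W" "W \<in> lmeasurable" "measure lebesgue W < \<delta>"
proof -
  obtain W where W: "open W" "N \<subseteq> W" "W - N \<in> lmeasurable" "emeasure lebesgue (W - N) < ennreal \<delta>"
    using sets_lebesgue_outer_open[of N \<delta>] assms by (metis fmeasurableD)
  have "W = N \<union> (W - N)" using W by auto
  then have "W \<in> lmeasurable" using W assms by (metis fmeasurable.Un)
  have "measure lebesgue (W - N) < \<delta>" using W(3,4) assms by (simp add: emeasure_eq_measure2 ennreal_less_iff)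
  then have "measure lebesgue W < \<delta>" using measure_Un_le[of N lebesgue "W - N"] W assms \<open>W = _\<close> by (simp add: fmeasurableD)
  with W \<open>W \<in> lmeasurable\<close> that show ?thesis by blast
qed

text \<open>A Henstock argument gives integrability of \<open>g\<close> together with the value of
  its integral. The gauge separates the tags: off \<open>N\<close> it makes the increments of
  \<open>f\<close> follow the derivative, on \<open>N\<close> it confines the intervals to an open
  set \<open>W\<close> of small measure, where absolute continuity bounds the total
  increment.\<close>

lemma abs_continuous_on_has_integral:
  fixes f :: "real \<Rightarrow> 'a::banach"
  assumes "a \<le> b" and ac: "abs_continuous_on a b f" and N: "negligible N"
    and der: "\<And>t. t \<in> {a..b} - N \<Longrightarrow> (f has_vector_derivative g t) (at t within {a..b})"
  shows "(g has_integral (f b - f a)) {a..b}"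
proof -
  define g' where "g' t = (if t \<in> N then 0 else g t)" for t
  have I: "(g' has_integral (f b - f a)) {a..b}"
    unfolding has_integral_real
  proof (intro allI impI)
    fix e :: real assume e: "0 < e"
    \<comment> \<open>Half of \<open>e\<close> is spread over the length of the interval; the added
      1 covers \<open>a = b\<close>.\<close>
    define e1 where "e1 = e / (2 * (b - a + 1))"
    have e1: "e1 > 0" "e1 * (b - a) < e / 2"
    proof -
      show "e1 > 0" using e \<open>a \<le> b\<close> by (simp add: e1_def)
      have "e1 * (2 * (b - a + 1)) = e" using \<open>a \<le> b\<close> by (simp add: e1_def)
      moreover have "e1 * (2 * (b - a + 1)) = 2 * (e1 * (b - a)) + 2 * e1" by (simp add: algebra_simps)
      ultimately show "e1 * (b - a) < e / 2" using \<open>e1 > 0\<close> by linarith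
    qed
    have "\<exists>\<delta>>0. \<forall>D. finite D \<and> (\<forall>(u, v)\<in>D. a \<le> u \<and> u \<le> v \<and> v \<le> b) \<and>
        pairwise (\<lambda>p q. {fst p<..<snd p} \<inter> {fst q<..<snd q} = {}) D \<and> (\<Sum>(u, v)\<in>D. v - u) < \<delta>
        \<longrightarrow> (\<Sum>(u, v)\<in>D. norm (f v - f u)) < e / 2"
      by (rule ac[unfolded abs_continuous_on_def, THEN spec, THEN mp, OF half_gt_zero[OF e]])
    then obtain \<delta> where \<delta>: "\<delta> > 0" and ac': "\<forall>D. finite D \<and> (\<forall>(u, v)\<in>D. a \<le> u \<and> u \<le> v \<and> v \<le> b) \<and>
        pairwise (\<lambda>p q. {fst p<..<snd p} \<inter> {fst q<..<snd q} = {}) D \<and> (\<Sum>(u, v)\<in>D. v - u) < \<delta>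
        \<longrightarrow> (\<Sum>(u, v)\<in>D. norm (f v - f u)) < e / 2"
      by (elim exE conjE)
    have "N \<in> lmeasurable" "measure lebesgue N = 0"
      using N by (auto simp: negligible_iff_measure)
    then obtain W where W: "open W" "N \<subseteq> W" "W \<in> lmeasurable" "measure lebesgue W < \<delta>"
      using null_set_outer_open \<delta> by blast
    have "\<exists>d>0. \<forall>s\<in>{a..b}. \<bar>s - t\<bar> < d \<longrightarrow> norm (f s - f t - (s - t) *\<^sub>R g t) \<le> e1 * \<bar>s - t\<bar>"
      if "t \<in> {a..b} - N" for t
      using der[OF that] e1(1)
      unfolding has_vector_derivative_def has_derivative_within_alt real_norm_def by blast
    then obtain d where d: "\<And>t. t \<in> {a..b} - N \<Longrightarrow> d t > 0"
      and d': "\<And>t s. \<lbrakk>t \<in> {a..b} - N; s \<in> {a..b}; \<bar>s - t\<bar> < d t\<rbrakk>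
          \<Longrightarrow> norm (f s - f t - (s - t) *\<^sub>R g t) \<le> e1 * \<bar>s - t\<bar>"
      by metis
    define \<gamma> where "\<gamma> t = (if t \<in> N then W else if t \<in> {a..b} then ball t (d t) else UNIV)" for t
    have "gauge \<gamma>"
      unfolding gauge_def \<gamma>_def using W d by auto
    have main: "norm ((\<Sum>(x, k)\<in>p. content k *\<^sub>R g' x) - (f b - f a)) < e"
      if p: "p tagged_division_of {a..b}" "\<gamma> fine p" for p
    proof -
      define h where "h = (\<lambda>(x::real, k::real set). norm (content k *\<^sub>R g' x - (f (Sup k) - f (Inf k))))"
      have fin: "finite p" using p(1) by blast
      have K: "\<exists>u v. K = {u..v} \<and> u \<le> v \<and> a \<le> u \<and> v \<le> b \<and> x \<in> {u..v} \<and> K \<subseteq> \<gamma> x" if xK: "(x, K) \<in> p" for x K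
      proof -
        obtain u v where uv: "K = cbox u v" using tagged_division_ofD(4)[OF p(1) xK] by blast
        have "x \<in> K" "K \<subseteq> {a..b}" "K \<subseteq> \<gamma> x"
          using tagged_division_ofD(2,3)[OF p(1) xK] fineD[OF p(2) xK] by auto
        with uv show ?thesis by (intro exI[of _ u] exI[of _ v]) auto
      qed
      have "norm ((\<Sum>(x, k)\<in>p. content k *\<^sub>R g' x) - (f b - f a))
          = norm (\<Sum>xk\<in>p. (case xk of (x, k) \<Rightarrow> content k *\<^sub>R g' x - (f (Sup k) - f (Inf k))))"
        by (subst additive_tagged_division_1[OF \<open>a \<le> b\<close> p(1), symmetric])
          (simp add: sum_subtractf split_def)
      also have "\<dots> \<le> sum h p"
        unfolding h_def by (rule order_trans[OF norm_sum]) (simp add: split_def)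
      also have "sum h p = sum h {xk\<in>p. fst xk \<notin> N} + sum h {xk\<in>p. fst xk \<in> N}"
        using fin by (subst sum.union_disjoint[symmetric]) (auto intro!: sum.cong)
      also have "sum h {xk\<in>p. fst xk \<notin> N} \<le> (\<Sum>(x,k)\<in>{xk\<in>p. fst xk \<notin> N}. e1 * content k)"
      proof (intro sum_mono, clarsimp)
        fix x k assume xk: "(x, k) \<in> p" "x \<notin> N"
        from K[OF xk(1)] obtain u v where uv: "k = {u..v}" "u \<le> v" "a \<le> u" "v \<le> b" "x \<in> {u..v}" "k \<subseteq> \<gamma> x"
          by blast
        then have xab: "x \<in> {a..b} - N" using xk by auto
        have "u \<in> \<gamma> x" "v \<in> \<gamma> x" using uv by auto
        then have uvd: "\<bar>u - x\<bar> < d x" "\<bar>v - x\<bar> < d x"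
          using xab by (auto simp: \<gamma>_def dist_real_def)
        have "norm ((v - u) *\<^sub>R g x - (f v - f u))
           = norm ((f u - f x - (u - x) *\<^sub>R g x) - (f v - f x - (v - x) *\<^sub>R g x))"
          by (simp add: algebra_simps)
        also have "\<dots> \<le> e1 * \<bar>u - x\<bar> + e1 * \<bar>v - x\<bar>"
          by (rule order_trans[OF norm_triangle_ineq4]) (intro add_mono d'; use uv uvd xab in auto)
        also have "\<dots> = e1 * (v - u)" using uv by (auto simp: algebra_simps)
        finally show "h (x, k) \<le> e1 * content k"
          using uv xk by (simp add: h_def g'_def)
      qed
      also have "\<dots> \<le> (\<Sum>(x,k)\<in>p. e1 * content k)"
        by (intro sum_mono2) (use fin e1 in auto)
      also have "\<dots> = e1 * (b - a)"
        using additive_content_tagged_division[of p a b] p(1) \<open>a \<le> b\<close>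
        by (simp add: sum_distrib_left[symmetric] split_def)
      also have "sum h {xk\<in>p. fst xk \<in> N} < e / 2"
      proof -
        \<comment> \<open>Only nondegenerate intervals are kept: their interiors are disjoint, so an
          interval determines its tag, and \<open>\<pi>\<close> turns the family into a set of pairs
          of end points as in the definition of absolute continuity. The degenerate ones contribute
          nothing.\<close>
        define P where "P = {xk\<in>p. fst xk \<in> N \<and> content (snd xk) \<noteq> 0}"
        define \<pi> where "\<pi> xk = (Inf (snd xk), Sup (snd xk))" for xk :: "real \<times> real set"
        have finP: "finite P" using fin by (simp add: P_def)
        have PK: "\<exists>x u v. xk = (x, {u..v}) \<and> u < v \<and> a \<le> u \<and> v \<le> b \<and> {u..v} \<subseteq> W \<and> xk \<in> p \<and> x \<in> N
             \<and> \<pi> xk = (u, v)"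
          if "xk \<in> P" for xk
        proof -
          obtain x k where [simp]: "xk = (x, k)" by force
          have "(x, k) \<in> p" "x \<in> N" "content k \<noteq> 0" using that by (auto simp: P_def)
          then show ?thesis using K[of x k] by (auto simp: \<gamma>_def \<pi>_def less_le)
        qed
        have dis: "{u<..<v} \<inter> {u'<..<v'} = {}"
          if "(x, {u..v}) \<in> p" "(x', {u'..v'}) \<in> p" "(x, {u..v}) \<noteq> (x', {u'..v'})" for x x' u v u' v'
          using tagged_division_ofD(5)[OF p(1) that] by (simp add: interior_atLeastAtMost_real)
        have inj: "inj_on \<pi> P"
        proof (rule inj_onI, rule ccontr)
          fix s t assume st: "s \<in> P" "t \<in> P" "\<pi> s = \<pi> t" "s \<noteq> t"
          obtain x u v x' u' v' where "s = (x, {u..v})" "u < v" "s \<in> p" "\<pi> s = (u, v)"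
             "t = (x', {u'..v'})" "t \<in> p" "\<pi> t = (u', v')"
            using PK[OF st(1)] PK[OF st(2)] by metis
          then show False using st dis[of x u v x' u' v'] by auto
        qed
        have "sum h {xk\<in>p. fst xk \<in> N} = sum h P"
        proof (rule sum.mono_neutral_right)
          show "\<forall>i\<in>{xk \<in> p. fst xk \<in> N} - P. h i = 0"
          proof
            fix i assume "i \<in> {xk \<in> p. fst xk \<in> N} - P"
            then obtain x k where i: "i = (x, k)" "(x, k) \<in> p" "x \<in> N" "content k = 0"
              by (cases i) (auto simp: P_def)
            with K[OF i(2)] show "h i = 0" by (auto simp: h_def g'_def)
          qed
        qed (use fin in \<open>auto simp: P_def\<close>)
        also have "\<dots> = sum ((\<lambda>(u, v). norm (f v - f u)) \<circ> \<pi>) P"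
        proof (intro sum.cong refl)
          fix i assume "i \<in> P"
          from PK[OF this] show "h i = ((\<lambda>(u, v). norm (f v - f u)) \<circ> \<pi>) i"
            by (auto simp: h_def g'_def norm_minus_commute)
        qed
        also have "\<dots> = (\<Sum>(u, v)\<in>\<pi> ` P. norm (f v - f u))"
          by (rule sum.reindex[OF inj, symmetric])
        also have "\<dots> < e / 2"
        proof (rule ac'[THEN spec, THEN mp], intro conjI)
          show "finite (\<pi> ` P)" using finP by simp
          show "\<forall>(u, v)\<in>\<pi> ` P. a \<le> u \<and> u \<le> v \<and> v \<le> b"
          proof clarify
            fix u v x k assume "(u, v) = \<pi> (x, k)" "(x, k) \<in> P"
            with PK[of "(x, k)"] show "a \<le> u \<and> u \<le> v \<and> v \<le> b" by auto
          qed
          show "pairwise (\<lambda>p q. {fst p<..<snd p} \<inter> {fst q<..<snd q} = {}) (\<pi> ` P)"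
          proof (rule pairwiseI, elim imageE)
            fix m n s t assume st: "m \<noteq> n" "m = \<pi> s" "s \<in> P" "n = \<pi> t" "t \<in> P"
            obtain x u v x' u' v' where "s = (x, {u..v})" "u < v" "s \<in> p" "\<pi> s = (u, v)"
               "t = (x', {u'..v'})" "t \<in> p" "\<pi> t = (u', v')"
              using PK[OF st(3)] PK[OF st(5)] by metis
            then show "{fst m<..<snd m} \<inter> {fst n<..<snd n} = {}"
              using st dis[of x u v x' u' v'] by auto
          qed
          have "(\<Sum>(u, v)\<in>\<pi> ` P. v - u) = sum ((\<lambda>(u, v). v - u) \<circ> \<pi>) P"
            by (rule sum.reindex[OF inj])
          also have "\<dots> = (\<Sum>(x, k)\<in>P. content k)"
          proof (intro sum.cong refl)
            fix i assume "i \<in> P"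
            from PK[OF this] show "((\<lambda>(u, v). v - u) \<circ> \<pi>) i = (case i of (x, k) \<Rightarrow> content k)"
              by auto
          qed
          also have "\<dots> = (\<Sum>i\<in>P. measure lebesgue (snd i))"
          proof (intro sum.cong refl)
            fix i assume "i \<in> P"
            from PK[OF this] show "(case i of (x, k) \<Rightarrow> content k) = measure lebesgue (snd i)"
              by auto
          qed
          also have "\<dots> = measure lebesgue (\<Union>(snd ` P))"
          proof (rule measure_negligible_finite_Union_image[symmetric])
            show "snd i \<in> lmeasurable" if "i \<in> P" for i using PK[OF that] by auto
            show "pairwise (\<lambda>x y. negligible (snd x \<inter> snd y)) P"
            proof (rule pairwiseI)
              fix s t assume st: "s \<in> P" "t \<in> P" "s \<noteq> t"
              obtain x u v x' u' v' where *: "s = (x, {u..v})" "u < v" "s \<in> p"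
                 "t = (x', {u'..v'})" "t \<in> p"
                using PK[OF st(1)] PK[OF st(2)] by metis
              then have "{u<..<v} \<inter> {u'<..<v'} = {}" using st dis[of x u v x' u' v'] by auto
              moreover have "{u..v} \<inter> {u'..v'} \<subseteq> ({u<..<v} \<inter> {u'<..<v'}) \<union> {u, v, u', v'}" by auto
              ultimately have "snd s \<inter> snd t \<subseteq> {u, v, u', v'}" using * by simp
              then show "negligible (snd s \<inter> snd t)"
                by (rule negligible_subset[rotated]) (simp add: negligible_finite)
            qed
          qed (rule finP)
          also have "\<dots> \<le> measure lebesgue W"
          proof (rule measure_mono_fmeasurable)
            show "\<Union> (snd ` P) \<subseteq> W" using PK by force
            show "\<Union> (snd ` P) \<in> sets lebesgue"
            proof (rule sets.finite_Union)
              show "snd ` P \<subseteq> sets lebesgue" using PK by force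
            qed (use finP in auto)
          qed (use W in auto)
          finally show "(\<Sum>(u, v)\<in>\<pi> ` P. v - u) < \<delta>" using W by simp
        qed
        finally show ?thesis .
      qed
      finally show ?thesis using e1 by simp
    qed
    show "\<exists>\<gamma>. gauge \<gamma> \<and> (\<forall>\<D>. \<D> tagged_division_of {a..b} \<and> \<gamma> fine \<D> \<longrightarrow>
         norm ((\<Sum>(x, k)\<in>\<D>. content k *\<^sub>R g' x) - (f b - f a)) < e)"
      using \<open>gauge \<gamma>\<close> main by (intro exI[of _ \<gamma>] conjI allI impI) (assumption, elim conjE)
  qed
  show ?thesis
    by (rule has_integral_spike[OF N _ I]) (simp add: g'_def)
qed

text \<open>Let \<open>B e\<close> be the points near which the difference quotient errs by at least
  \<open>e\<close> arbitrarily often. The Vitali theorem covers \<open>B e\<close> up to a null set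
  by disjoint intervals on which this error occurs; by Henstock's lemma the errors sum to less than
  \<open>e * \<eta>\<close>, so the intervals have total length at most
  \<open>\<eta>\<close>.\<close>

lemma negligible_not_derivative_of_integral:
  fixes g :: "real \<Rightarrow> 'a::euclidean_space"
  assumes g: "g integrable_on {a..b}"
  shows "negligible {t \<in> {a<..<b}. \<not> ((\<lambda>x. integral {a..x} g) has_vector_derivative g t) (at t)}"
proof -
  define X where "X x = integral {a..x} g" for x
  define B where "B e = {t \<in> {a<..<b}. \<forall>d>0. \<exists>s\<in>{a..b}. s \<noteq> t \<and> \<bar>s - t\<bar> < d \<and>
      e * \<bar>s - t\<bar> \<le> norm (X s - X t - (s - t) *\<^sub>R g t)}" for e :: real
  have neg: "negligible (B e)" if e: "e > 0" for e
    unfolding negligible_outer_le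
  proof (intro allI impI)
    fix \<eta> :: real assume \<eta>: "\<eta> > 0"
    have gi: "g integrable_on cbox a b" and e\<eta>: "0 < e * \<eta>" using g e \<eta> by simp_all
    have "\<exists>\<gamma>. gauge \<gamma> \<and> (\<forall>p. p tagged_partial_division_of (cbox a b) \<and> \<gamma> fine p \<longrightarrow>
             sum (\<lambda>(x,k). norm (content k *\<^sub>R g x - integral k g)) p < e * \<eta>)"
      by (rule Henstock_lemma[OF gi e\<eta>]) blast
    then obtain \<gamma> where "gauge \<gamma>"
      and \<gamma>: "\<And>p. \<lbrakk>p tagged_partial_division_of (cbox a b); \<gamma> fine p\<rbrakk> \<Longrightarrow>
             sum (\<lambda>(x,k). norm(content k *\<^sub>R g x - integral k g)) p < e * \<eta>"
      by blast
    \<comment> \<open>An interval is coded by its tag \<open>t\<close> and its other end point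
      \<open>s\<close>; centre and radius are needed because the covering theorem speaks of
      balls.\<close>
    define c where "c = (\<lambda>(t::real, s). (t + s) / 2)"
    define r where "r = (\<lambda>(t::real, s). \<bar>s - t\<bar> / 2)"
    define J where "J p = cball (c p) (r p)" for p
    have J: "J (t, s) = {min t s..max t s}" for t s
      by (auto simp: J_def c_def r_def cball_eq_atLeastAtMost min_def max_def field_simps)
    define K where "K = {(t, s). t \<in> B e \<and> s \<in> {a..b} \<and> s \<noteq> t \<and> J (t, s) \<subseteq> \<gamma> t \<and>
        e * \<bar>s - t\<bar> \<le> norm (X s - X t - (s - t) *\<^sub>R g t)}"
    have cov: "\<exists>i. i \<in> K \<and> t \<in> cball (c i) (r i) \<and> r i < d" if t: "t \<in> B e" and "0 < d" for t d
    proof -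
      obtain d' where d': "d' > 0" "cball t d' \<subseteq> \<gamma> t"
        using \<open>gauge \<gamma>\<close> unfolding gauge_def by (meson open_contains_cball)
      have "0 < min d d'" using d' \<open>0 < d\<close> by auto
      then obtain s where s: "s \<in> {a..b}" "s \<noteq> t" "\<bar>s - t\<bar> < min d d'"
          "e * \<bar>s - t\<bar> \<le> norm (X s - X t - (s - t) *\<^sub>R g t)"
        using t unfolding B_def by blast
      have "J (t, s) \<subseteq> cball t d'"
        using s unfolding J by (auto simp: cball_eq_atLeastAtMost)
      then have "(t, s) \<in> K" using s d' t by (auto simp: K_def)
      moreover have "t \<in> J (t, s)" by (simp add: J)
      moreover have "r (t, s) < d" using s \<open>0 < d\<close> by (auto simp: r_def)
      ultimately show ?thesis unfolding J_def by blast
    qed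
    have r0: "0 < r i" if "i \<in> K" for i using that by (auto simp: K_def r_def)
    obtain C where C: "countable C" "C \<subseteq> K"
     "pairwise (\<lambda>i j. disjnt (cball (c i) (r i)) (cball (c j) (r j))) C"
     "negligible(B e - (\<Union>i \<in> C. cball (c i) (r i)))"
      by (rule Vitali_covering_theorem_cballs[of K r "B e" c, OF r0 cov]) (assumption | rule that)+
    \<comment> \<open>Finitely many intervals of the covering form a fine tagged partial division,
      on each piece of which the Henstock error is at least \<open>e\<close> times the
      length.\<close>
    have bound: "measure lebesgue (\<Union>i\<in>F. J i) \<le> \<eta>" if F: "finite F" "F \<subseteq> C" for F
    proof -
      define p where "p = (\<lambda>i. (fst i, J i)) ` F"
      have FK: "F \<subseteq> K" using F C by auto
      have Kab: "J i \<subseteq> {a..b}" "fst i \<in> J i" "J i \<subseteq> \<gamma> (fst i)"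
          "\<exists>u v. J i = {u..v} \<and> u < v" if "i \<in> K" for i
      proof -
        obtain t s where i: "i = (t, s)" by force
        with that have "t \<in> {a<..<b}" "s \<in> {a..b}" "s \<noteq> t" "J (t, s) \<subseteq> \<gamma> t"
          by (auto simp: K_def B_def)
        then show "J i \<subseteq> {a..b}" "fst i \<in> J i" "J i \<subseteq> \<gamma> (fst i)" "\<exists>u v. J i = {u..v} \<and> u < v"
          by (auto simp: i J min_def max_def)
      qed
      have dj: "disjnt (J i) (J j)" if "i \<in> F" "j \<in> F" "i \<noteq> j" for i j
        using C(3) that F unfolding J_def pairwise_def by blast
      have ptag: "p tagged_partial_division_of cbox a b"
        unfolding tagged_partial_division_of_def
      proof (intro conjI allI impI)
        fix x k assume "(x, k) \<in> p"
        then obtain i where i: "i \<in> K" "x = fst i" "k = J i" using FK by (auto simp: p_def)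
        show "x \<in> k" "k \<subseteq> cbox a b" using Kab(1,2)[OF i(1)] i by auto
        show "\<exists>a b. k = cbox a b" using Kab(4)[OF i(1)] i by (metis cbox_interval)
      next
        fix x k x' k' assume "(x, k) \<in> p \<and> (x', k') \<in> p \<and> (x, k) \<noteq> (x', k')"
        then obtain i j where "i \<in> F" "j \<in> F" "k = J i" "k' = J j" "i \<noteq> j"
          by (auto simp: p_def)
        then have "k \<inter> k' = {}" using dj by (auto simp: disjnt_def)
        then show "interior k \<inter> interior k' = {}" using interior_subset by blast
      qed (use F in \<open>auto simp: p_def\<close>)
      have pfine: "\<gamma> fine p"
        unfolding fine_def p_def using Kab(3) FK by auto
      have injJ: "inj_on (\<lambda>i. (fst i, J i)) F"
      proof (rule inj_onI, rule ccontr)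
        fix i j assume ij: "i \<in> F" "j \<in> F" "(fst i, J i) = (fst j, J j)" "i \<noteq> j"
        then have "disjnt (J i) (J i)" using dj[of i j] by simp
        then show False using Kab(2)[of i] ij FK by (auto simp: disjnt_def)
      qed
      have "measure lebesgue (\<Union>i\<in>F. J i) \<le> (\<Sum>i\<in>F. content (J i))"
        by (rule order_trans[OF measure_UNION_le[OF F(1)]]) (auto simp: J_def)
      also have "e * \<dots> = (\<Sum>i\<in>F. e * content (J i))" by (rule sum_distrib_left)
      also have "\<dots> \<le> (\<Sum>i\<in>F. norm (content (J i) *\<^sub>R g (fst i) - integral (J i) g))"
      proof (intro sum_mono)
        fix i assume "i \<in> F"
        then obtain t s where i: "i = (t, s)" "(t, s) \<in> K" using FK by (cases i) auto
        then have ts: "t \<in> {a..b}" "s \<in> {a..b}" "s \<noteq> t"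
             "e * \<bar>s - t\<bar> \<le> norm (X s - X t - (s - t) *\<^sub>R g t)" by (auto simp: K_def B_def)
        have Xd: "integral {u..v} g = X v - X u" if "a \<le> u" "u \<le> v" "v \<le> b" for u v
        proof -
          have "g integrable_on {a..v}" using g that by (auto intro: integrable_subinterval_real)
          from Henstock_Kurzweil_Integration.integral_combine[OF that(1,2) this]
          show ?thesis by (simp add: X_def algebra_simps)
        qed
        show "e * content (J i) \<le> norm (content (J i) *\<^sub>R g (fst i) - integral (J i) g)"
        proof (cases "t < s")
          case True
          then have "J i = {t..s}" "integral {t..s} g = X s - X t" using i ts J Xd by auto
          then show ?thesis using ts True i by (simp add: norm_minus_commute)
        next
          case False
          then have *: "J i = {s..t}" "integral {s..t} g = X t - X s" "fst i = t" "content {s..t} = t - s"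
            using i ts J Xd by auto
          have "(t - s) *\<^sub>R g t - (X t - X s) = X s - X t - (s - t) *\<^sub>R g t"
            by (simp add: algebra_simps)
          then have "norm (content (J i) *\<^sub>R g (fst i) - integral (J i) g) = norm (X s - X t - (s - t) *\<^sub>R g t)"
            by (simp only: *)
          moreover have "content (J i) = \<bar>s - t\<bar>" using * False by simp
          ultimately show ?thesis using ts by simp
        qed
      qed
      also have "\<dots> = (\<Sum>(x,k)\<in>p. norm (content k *\<^sub>R g x - integral k g))"
        unfolding p_def by (subst sum.reindex[OF injJ]) simp
      also have "\<dots> < e * \<eta>" by (rule \<gamma>[OF ptag pfine])
      finally show ?thesis using e by (simp add: mult_left_le_imp_le)
    qed
    have Jm: "J i \<in> lmeasurable" for i by (simp add: J_def)
    define Z where "Z = B e - (\<Union>i \<in> C. J i)"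
    have Z: "Z \<in> lmeasurable" "measure lebesgue Z = 0"
      using C(4) by (auto simp: Z_def J_def negligible_iff_measure)
    have U: "(\<Union>i\<in>C. J i) \<in> lmeasurable" "measure lebesgue (\<Union>i\<in>C. J i) \<le> \<eta>"
      using fmeasurable_UN_bound[of C J lebesgue \<eta>] measure_UN_bound[of C J lebesgue \<eta>] C(1) Jm bound
      by blast+
    show "\<exists>T. B e \<subseteq> T \<and> T \<in> lmeasurable \<and> measure lebesgue T \<le> \<eta>"
    proof (intro exI conjI)
      show "B e \<subseteq> Z \<union> (\<Union>i\<in>C. J i)" by (auto simp: Z_def)
      show "Z \<union> (\<Union>i\<in>C. J i) \<in> lmeasurable" using U Z by blast
      show "measure lebesgue (Z \<union> (\<Union>i\<in>C. J i)) \<le> \<eta>"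
        using measure_Un_le[of Z lebesgue "\<Union>i\<in>C. J i"] U Z by (simp add: fmeasurableD)
    qed
  qed
  have "negligible (\<Union>n. B (1 / Suc n))" using neg by (intro negligible_countable_Union) auto
  moreover have "{t \<in> {a<..<b}. \<not> (X has_vector_derivative g t) (at t)} \<subseteq> (\<Union>n. B (1 / Suc n))"
  proof clarify
    fix t assume t: "t \<in> {a<..<b}" "\<not> (X has_vector_derivative g t) (at t)" 
    show "t \<in> (\<Union>n. B (1 / Suc n))"
    proof (rule ccontr)
      assume *: "t \<notin> (\<Union>n. B (1 / Suc n))"
      have "(X has_vector_derivative g t) (at t within {a..b})"
        unfolding has_vector_derivative_def has_derivative_within_alt
      proof (intro conjI allI impI)
        fix e :: real assume "e > 0"
        then obtain n where n: "1 / Suc n < e" using nat_approx_posE by auto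
        have "t \<notin> B (1 / Suc n)" using * by blast
        then have "\<not> (\<forall>d>0. \<exists>s\<in>{a..b}. s \<noteq> t \<and> \<bar>s - t\<bar> < d \<and>
            1 / Suc n * \<bar>s - t\<bar> \<le> norm (X s - X t - (s - t) *\<^sub>R g t))"
          using t unfolding B_def by blast
        then obtain d where d: "d > 0" "\<And>s. \<lbrakk>s\<in>{a..b}; s \<noteq> t; \<bar>s - t\<bar> < d\<rbrakk> \<Longrightarrow>
            norm (X s - X t - (s - t) *\<^sub>R g t) < 1 / Suc n * \<bar>s - t\<bar>"
          unfolding not_all not_imp not_le[symmetric] by blast
        show "\<exists>d>0. \<forall>y\<in>{a..b}. norm (y - t) < d \<longrightarrow> norm (X y - X t - (y - t) *\<^sub>R g t) \<le> e * norm (y - t)"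
        proof (intro exI[of _ d] conjI ballI impI d(1))
          fix y assume y: "y \<in> {a..b}" "norm (y - t) < d"
          show "norm (X y - X t - (y - t) *\<^sub>R g t) \<le> e * norm (y - t)"
          proof (cases "y = t")
            case False
            then have "norm (X y - X t - (y - t) *\<^sub>R g t) \<le> 1 / Suc n * \<bar>y - t\<bar>"
              using d(2)[of y] y by auto
            also have "\<dots> \<le> e * \<bar>y - t\<bar>" using n by (intro mult_right_mono) auto
            finally show ?thesis by simp
          qed auto
        qed
      qed (rule bounded_linear_scaleR_left)
      then show False using t by (simp add: at_within_Icc_at)
    qed
  qed
  ultimately show ?thesis unfolding X_def by (rule negligible_subset)
qed

section \<open>Lipschitz curves and Gronwall estimates\<close>

lemma lipschitz_imp_abs_continuous_on:
  fixes f :: "real \<Rightarrow> 'a::real_normed_vector"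
  assumes "C-lipschitz_on {a..b} f"
  shows "abs_continuous_on a b f"
  unfolding abs_continuous_on_def
proof (intro allI impI)
  fix e :: real assume e: "e > 0"
  have C: "C \<ge> 0" using assms lipschitz_on_nonneg by blast
  show "\<exists>\<delta>>0. \<forall>D. finite D \<and> (\<forall>(u, v)\<in>D. a \<le> u \<and> u \<le> v \<and> v \<le> b) \<and>
      pairwise (\<lambda>p q. {fst p<..<snd p} \<inter> {fst q<..<snd q} = {}) D \<and> (\<Sum>(u, v)\<in>D. v - u) < \<delta>
      \<longrightarrow> (\<Sum>(u, v)\<in>D. norm (f v - f u)) < e"
  proof (intro exI[of _ "e / (C + 1)"] conjI allI impI)
    fix D :: "(real \<times> real) set"
    assume D: "finite D \<and> (\<forall>(u, v)\<in>D. a \<le> u \<and> u \<le> v \<and> v \<le> b) \<and>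
      pairwise (\<lambda>p q. {fst p<..<snd p} \<inter> {fst q<..<snd q} = {}) D \<and> (\<Sum>(u, v)\<in>D. v - u) < e / (C + 1)"
    have "(\<Sum>(u, v)\<in>D. norm (f v - f u)) \<le> (\<Sum>(u, v)\<in>D. C * (v - u))"
    proof (intro sum_mono, clarify)
      fix u v assume "(u, v) \<in> D"
      then have "a \<le> u" "u \<le> v" "v \<le> b" using D by auto
      then show "norm (f v - f u) \<le> C * (v - u)"
        using lipschitz_onD[OF assms, of v u] by (simp add: dist_norm)
    qed
    also have "\<dots> = C * (\<Sum>(u, v)\<in>D. v - u)" by (simp add: sum_distrib_left split_def)
    also have "\<dots> \<le> C * (e / (C + 1))" using D C by (intro mult_left_mono) auto
    also have "\<dots> < e" using C e by (simp add: field_simps)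
    finally show "(\<Sum>(u, v)\<in>D. norm (f v - f u)) < e" .
  qed (use C e in auto)
qed

lemma lipschitz_on_bounded_bilinear:
  fixes f :: "real \<Rightarrow> 'a::real_normed_vector" and g :: "real \<Rightarrow> 'b::real_normed_vector"
    and h :: "'a \<Rightarrow> 'b \<Rightarrow> 'c::real_normed_vector"
  assumes h: "bounded_bilinear h" and f: "\<exists>C. C-lipschitz_on {a..b} f" and g: "\<exists>C. C-lipschitz_on {a..b} g"
  shows "\<exists>C. C-lipschitz_on {a..b} (\<lambda>t. h (f t) (g t))"
proof -
  interpret bounded_bilinear h by fact
  obtain Cf Cg where C: "Cf-lipschitz_on {a..b} f" "Cg-lipschitz_on {a..b} g" using f g by blast
  have C0: "Cf \<ge> 0" "Cg \<ge> 0" using C lipschitz_on_nonneg by blast+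
  have "bounded (f ` {a..b})" "bounded (g ` {a..b})"
    using C by (meson compact_Icc compact_continuous_image compact_imp_bounded lipschitz_on_continuous_on)+
  then obtain F G where FG: "\<And>t. t \<in> {a..b} \<Longrightarrow> norm (f t) \<le> F" "\<And>t. t \<in> {a..b} \<Longrightarrow> norm (g t) \<le> G" "F > 0" "G > 0"
    unfolding bounded_pos by (metis imageI)
  obtain K where K: "K > 0" "\<And>a b. norm (h a b) \<le> norm a * norm b * K" using pos_bounded by blast
  show ?thesis
  proof (intro exI lipschitz_onI)
    fix s t assume st: "s \<in> {a..b}" "t \<in> {a..b}"
    have "h (f s) (g s) - h (f t) (g t) = h (f s - f t) (g s) + h (f t) (g s - g t)"
      by (simp add: diff_left diff_right)
    then have "norm (h (f s) (g s) - h (f t) (g t)) \<le> norm (f s - f t) * norm (g s) * K + norm (f t) * norm (g s - g t) * K"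
      by (metis K(2) add_mono norm_triangle_le)
    also have "\<dots> \<le> Cf * dist s t * G * K + F * (Cg * dist s t) * K"
    proof (intro add_mono mult_right_mono mult_mono)
      show "norm (f s - f t) \<le> Cf * dist s t" "norm (g s - g t) \<le> Cg * dist s t" 
        using lipschitz_onD[OF C(1) st] lipschitz_onD[OF C(2) st] by (auto simp: dist_norm)
    qed (use FG st K C0 in \<open>auto intro: less_imp_le\<close>)
    finally show "dist (h (f s) (g s)) (h (f t) (g t)) \<le> (Cf * G * K + F * Cg * K) * dist s t"
      by (simp add: dist_norm algebra_simps)
  qed (use FG K C0 in \<open>simp add: less_imp_le\<close>)
qed

lemma lipschitz_on_ae_derivative_has_integral:
  fixes f :: "real \<Rightarrow> 'a::banach"
  assumes "a \<le> b" and f: "\<exists>C. C-lipschitz_on {a..b} f" and N: "negligible N"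
    and der: "\<And>t. t \<in> {a<..<b} - N \<Longrightarrow> (f has_vector_derivative g t) (at t)"
  shows "(g has_integral (f b - f a)) {a..b}"
proof -
  obtain C where "C-lipschitz_on {a..b} f" using f by blast
  then show ?thesis
  proof (intro abs_continuous_on_has_integral[OF \<open>a \<le> b\<close>, where N = "N \<union> {a, b}"])
    show "negligible (N \<union> {a, b})" using N by simp
    show "(f has_vector_derivative g t) (at t within {a..b})" if "t \<in> {a..b} - (N \<union> {a, b})" for t
      using der[of t] that by (auto intro: has_vector_derivative_at_within)
  qed (rule lipschitz_imp_abs_continuous_on)
qed

lemma has_integral_le_negligible:
  fixes f g :: "'a::euclidean_space \<Rightarrow> real"
  assumes "(f has_integral i) S" "(g has_integral j) S" "negligible N"
    and "\<And>x. x \<in> S - N \<Longrightarrow> f x \<le> g x"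
  shows "i \<le> j"
proof (rule has_integral_le)
  show "((\<lambda>x. if x \<in> N then 0 else f x) has_integral i) S"
    by (rule has_integral_spike[OF assms(3) _ assms(1)]) auto
  show "((\<lambda>x. if x \<in> N then 0 else g x) has_integral j) S"
    by (rule has_integral_spike[OF assms(3) _ assms(2)]) auto
qed (use assms(4) in auto)

text \<open>The function \<open>exp (- k t) * (norm (x t))\<^sup>2\<close> is Lipschitz, hence the
  integral of its almost everywhere derivative, whose sign is fixed by the hypothesis. Squares avoid
  differentiating the norm at 0.\<close>

lemma gronwall_lipschitz:
  fixes x :: "real \<Rightarrow> 'a::euclidean_space" and \<kappa> k :: "real \<Rightarrow> real"
  assumes "a \<le> b" and x: "\<exists>C. C-lipschitz_on {a..b} x" and N: "negligible N"
    and der: "\<And>t. t \<in> {a<..<b} - N \<Longrightarrow> (x has_vector_derivative x' t) (at t)"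
    and k: "\<And>t. t \<in> {a..b} \<Longrightarrow> (k has_real_derivative \<kappa> t) (at t)"
    and cont: "continuous_on {a..b} \<kappa>"
  shows gronwall_lipschitz_le: "(\<And>t. t \<in> {a<..<b} - N \<Longrightarrow> 2 * (x t \<bullet> x' t) \<le> \<kappa> t * (norm (x t))\<^sup>2) \<Longrightarrow>
      (norm (x b))\<^sup>2 \<le> exp (k b - k a) * (norm (x a))\<^sup>2" (is "(\<And>t. _ \<Longrightarrow> ?P t) \<Longrightarrow> _")
    and gronwall_lipschitz_ge: "(\<And>t. t \<in> {a<..<b} - N \<Longrightarrow> 2 * (x t \<bullet> x' t) \<ge> \<kappa> t * (norm (x t))\<^sup>2) \<Longrightarrow>
      (norm (x b))\<^sup>2 \<ge> exp (k b - k a) * (norm (x a))\<^sup>2" (is "(\<And>t. _ \<Longrightarrow> ?Q t) \<Longrightarrow> _")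
proof -
  define V where "V t = exp (- k t) * (x t \<bullet> x t)" for t
  define v where "v t = exp (- k t) * (2 * (x t \<bullet> x' t) - \<kappa> t * (norm (x t))\<^sup>2)" for t
  have lipE: "\<exists>C. C-lipschitz_on {a..b} (\<lambda>t. exp (- k t))"
  proof -
    have "continuous_on {a..b} k" using k by (meson DERIV_isCont continuous_at_imp_continuous_on)
    then have "continuous_on {a..b} (\<lambda>t. exp (- k t) * (- \<kappa> t))" using cont by (intro continuous_intros)
    then have "bounded ((\<lambda>t. exp (- k t) * (- \<kappa> t)) ` {a..b})"
      by (meson compact_Icc compact_continuous_image compact_imp_bounded)
    then obtain M where M: "M > 0" "\<And>t. t \<in> {a..b} \<Longrightarrow> norm (exp (- k t) * (- \<kappa> t)) \<le> M"
      unfolding bounded_pos by auto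
    have "M-lipschitz_on {a..b} (\<lambda>t. exp (- k t))"
    proof (rule lipschitz_onI)
      fix s t assume "s \<in> {a..b}" "t \<in> {a..b}"
      then show "dist (exp (- k s)) (exp (- k t)) \<le> M * dist s t"
        unfolding dist_norm
        by (intro field_differentiable_bound[of "{a..b}" _ "\<lambda>t. exp (- k t) * (- \<kappa> t)"])
           (use M in \<open>auto intro!: derivative_eq_intros has_field_derivative_at_within[OF k]\<close>)
    qed (use M in simp)
    then show ?thesis by blast
  qed
  have "\<exists>C. C-lipschitz_on {a..b} V"
    unfolding V_def
    by (intro lipschitz_on_bounded_bilinear[OF bounded_bilinear_mult] lipE
              lipschitz_on_bounded_bilinear[OF bounded_bilinear_inner] x)
  moreover have "(V has_vector_derivative v t) (at t)" if "t \<in> {a<..<b} - N" for t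
  proof -
    have kt: "(k has_real_derivative \<kappa> t) (at t)" using that k[of t] by auto
    have xt: "(x has_derivative (\<lambda>h. h *\<^sub>R x' t)) (at t)" 
      using der[OF that] by (simp add: has_vector_derivative_def)
    have dI: "((\<lambda>t. x t \<bullet> x t) has_real_derivative 2 * (x t \<bullet> x' t)) (at t)"
      unfolding has_field_derivative_def
      by (rule has_derivative_eq_rhs[OF has_derivative_inner[OF xt xt]]) (simp add: fun_eq_iff inner_commute)
    have dE: "((\<lambda>t. exp (- k t)) has_real_derivative exp (- k t) * - \<kappa> t) (at t)"
      using DERIV_fun_exp[OF DERIV_minus[OF kt]] by simp
    have "(V has_real_derivative v t) (at t)"
      unfolding V_def v_def
      using DERIV_mult[OF dE dI] by (simp add: power2_norm_eq_inner algebra_simps)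
    then show ?thesis by (simp add: has_real_derivative_iff_has_vector_derivative)
  qed
  ultimately have I: "(v has_integral (V b - V a)) {a..b}"
    by (intro lipschitz_on_ae_derivative_has_integral[OF \<open>a \<le> b\<close> _ N])
  have neg: "negligible (N \<union> {a, b})" using N by simp
  have ex: "exp (k b - k a) = exp (k b) * exp (- k a)" "exp (k b) * exp (- k b) = 1"
    by (simp_all add: exp_diff exp_minus field_simps)
  {
    assume P: "\<And>t. t \<in> {a<..<b} - N \<Longrightarrow> ?P t"
    have "V b - V a \<le> 0"
    proof (rule has_integral_le_negligible[OF I has_integral_0[of "{a..b}"] neg])
    qed (use P in \<open>auto simp: v_def mult_le_0_iff\<close>)
    then have "exp (k b) * V b \<le> exp (k b) * V a" by simp
    then show "(norm (x b))\<^sup>2 \<le> exp (k b - k a) * (norm (x a))\<^sup>2"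
      by (simp add: V_def power2_norm_eq_inner ex mult.assoc[symmetric])
  next
    assume Q: "\<And>t. t \<in> {a<..<b} - N \<Longrightarrow> ?Q t"
    have "V b - V a \<ge> 0"
    proof (rule has_integral_le_negligible[OF has_integral_0[of "{a..b}"] I neg])
    qed (use Q in \<open>auto simp: v_def\<close>)
    then have "exp (k b) * V a \<le> exp (k b) * V b" by simp
    then show "(norm (x b))\<^sup>2 \<ge> exp (k b - k a) * (norm (x a))\<^sup>2"
      by (simp add: V_def power2_norm_eq_inner ex mult.assoc[symmetric])
  }
qed

subsection \<open>The Hermitian inner product\<close>

lemma norm_vector_smult: "norm (c *s (v :: complex ^ 'n)) = cmod c * norm v"
proof -
  have "norm (c *s v) = L2_set (\<lambda>i. cmod c * norm (v $ i)) UNIV"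
    by (simp add: norm_vec_def norm_mult)
  then show ?thesis by (simp add: norm_vec_def L2_set_right_distrib)
qed

lemma vector_smult_of_real: "complex_of_real r *s v = r *\<^sub>R v"
  by (simp add: vec_eq_iff scaleR_conv_of_real[where 'a = complex])

lemma hinner_add_left: "hinner (x + y) u = hinner x u + hinner y u"
  and hinner_diff_left: "hinner (x - y) u = hinner x u - hinner y u"
  and hinner_smult_left: "hinner (c *s x) u = c * hinner x u"
  and hinner_scaleR_left: "hinner (r *\<^sub>R x) u = of_real r * hinner x u"
  and hinner_add_right: "hinner u (x + y) = hinner u x + hinner u y"
  and hinner_smult_right: "hinner u (c *s x) = cnj c * hinner u x"
  and hinner_scaleR_right: "hinner u (r *\<^sub>R x) = of_real r * hinner u x"
  and hinner_zero_left [simp]: "hinner 0 u = 0"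
  and hinner_zero_right [simp]: "hinner u 0 = 0"
  and hinner_minus_left: "hinner (- x) u = - hinner x u"
  by (simp_all add: hinner_def sum.distrib sum_subtractf sum_distrib_left sum_negf algebra_simps
       scaleR_conv_of_real[where 'a = complex])

lemma Re_hinner: "Re (hinner x y) = x \<bullet> y"
  by (simp add: hinner_def inner_vec_def inner_complex_def)

lemma hinner_same: "hinner x x = of_real ((norm x)\<^sup>2)"
proof (rule complex_eqI)
  show "Re (hinner x x) = Re (of_real ((norm x)\<^sup>2))"
    by (simp add: Re_hinner power2_norm_eq_inner)
  show "Im (hinner x x) = Im (of_real ((norm x)\<^sup>2))"
    by (simp add: hinner_def)
qed

lemma norm_hinner_le: "cmod (hinner x y) \<le> norm x * norm y"
proof -
  have "cmod (hinner x y) \<le> (\<Sum>i\<in>UNIV. \<bar>norm (x $ i)\<bar> * \<bar>norm (y $ i)\<bar>)"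
    unfolding hinner_def by (rule order_trans[OF norm_sum]) (simp add: norm_mult)
  also have "\<dots> \<le> L2_set (\<lambda>i. norm (x $ i)) UNIV * L2_set (\<lambda>i. norm (y $ i)) UNIV"
    by (rule L2_set_mult_ineq)
  finally show ?thesis by (simp add: norm_vec_def)
qed

lemma bounded_linear_hinner_left: "bounded_linear (\<lambda>z. hinner z u)"
  by (rule bounded_linear_intro[where K = "norm u"])
     (auto simp: hinner_add_left hinner_scaleR_left scaleR_conv_of_real[where 'a = complex] norm_hinner_le)

lemma hinner_axis: "hinner x (axis i 1) = x $ i"
proof -
  have "hinner x (axis i 1) = (\<Sum>j\<in>UNIV. if j = i then x $ j else 0)"
    unfolding hinner_def by (intro sum.cong) (auto simp: axis_def)
  then show ?thesis by simp
qed

lemma bounded_linear_vector_smult_left: "bounded_linear (\<lambda>c. c *s (v :: complex ^ 'n))"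
  by (rule bounded_linear_intro[where K = "norm v"])
     (auto simp: vector_sadd_rdistrib norm_vector_smult vec_eq_iff)

subsection \<open>Holomorphic maps of several variables\<close>

text \<open>The scalar version serves the determinants in Cramer's rule, whose values are plain
  complex numbers rather than vectors.\<close>

definition scalar_hol_on :: "(complex ^ 'n \<Rightarrow> complex) \<Rightarrow> (complex ^ 'n) set \<Rightarrow> bool" where
  "scalar_hol_on f S \<longleftrightarrow> (\<forall>z\<in>S. \<exists>D. (f has_derivative D) (at z) \<and> (\<forall>c v. D (c *s v) = c * D v))"

definition hol_on :: "(complex ^ 'n \<Rightarrow> complex ^ 'm) \<Rightarrow> (complex ^ 'n) set \<Rightarrow> bool" where
  "hol_on f S \<longleftrightarrow> (\<forall>z\<in>S. \<exists>D. (f has_derivative D) (at z) \<and> (\<forall>c v. D (c *s v) = c *s D v))"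

lemma Hol_iff: "f \<in> Hol \<longleftrightarrow> f \<in> extensional unit_ball \<and> hol_on f unit_ball"
  by (auto simp: Hol_def hol_on_def)

lemma hol_onE:
  assumes "hol_on f S" "z \<in> S"
  obtains D where "(f has_derivative D) (at z)" "\<And>c v. D (c *s v) = c *s D v"
  using assms unfolding hol_on_def by blast

lemma hol_on_subset: "hol_on f S \<Longrightarrow> T \<subseteq> S \<Longrightarrow> hol_on f T"
  unfolding hol_on_def by blast

lemma hol_on_cong:
  assumes "open S" "hol_on f S" "\<And>z. z \<in> S \<Longrightarrow> f z = g z"
  shows "hol_on g S"
  unfolding hol_on_def
proof
  fix z assume z: "z \<in> S"
  with assms obtain D where "(f has_derivative D) (at z)" "\<forall>c v. D (c *s v) = c *s D v"
    unfolding hol_on_def by blast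
  then show "\<exists>D. (g has_derivative D) (at z) \<and> (\<forall>c v. D (c *s v) = c *s D v)"
    using has_derivative_transform_within_open[of f D z UNIV S g] assms z by blast
qed

lemma hol_on_continuous_on: "hol_on f S \<Longrightarrow> continuous_on S f"
  unfolding hol_on_def
  by (meson continuous_at_imp_continuous_on has_derivative_continuous)

lemma restrict_in_Hol: "hol_on f unit_ball \<Longrightarrow> restrict f unit_ball \<in> Hol"
  unfolding Hol_iff using hol_on_cong[of unit_ball f "restrict f unit_ball"] by auto

lemma hol_on_const: "hol_on (\<lambda>_. c) S"
  unfolding hol_on_def by (auto intro!: exI[of _ "\<lambda>_. 0"])

lemma hol_on_ident: "hol_on (\<lambda>z. z) S"
  unfolding hol_on_def by (auto intro!: exI[of _ "\<lambda>z. z"])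

lemma hol_on_add: "hol_on f S \<Longrightarrow> hol_on g S \<Longrightarrow> hol_on (\<lambda>z. f z + g z) S"
  unfolding hol_on_def
proof
  fix z assume "\<forall>z\<in>S. \<exists>D. (f has_derivative D) (at z) \<and> (\<forall>c v. D (c *s v) = c *s D v)"
    "\<forall>z\<in>S. \<exists>D. (g has_derivative D) (at z) \<and> (\<forall>c v. D (c *s v) = c *s D v)" "z \<in> S"
  then obtain D E where "(f has_derivative D) (at z)" "\<forall>c v. D (c *s v) = c *s D v"
     "(g has_derivative E) (at z)" "\<forall>c v. E (c *s v) = c *s E v" by blast
  then show "\<exists>D. ((\<lambda>z. f z + g z) has_derivative D) (at z) \<and> (\<forall>c v. D (c *s v) = c *s D v)"
    by (intro exI[of _ "\<lambda>v. D v + E v"]) (auto intro: has_derivative_add simp: vector_add_ldistrib)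
qed

lemma hol_on_smult: "hol_on f S \<Longrightarrow> hol_on (\<lambda>z. c *s f z) S"
  unfolding hol_on_def
proof
  fix z assume "\<forall>z\<in>S. \<exists>D. (f has_derivative D) (at z) \<and> (\<forall>c v. D (c *s v) = c *s D v)" "z \<in> S"
  then obtain D where D: "(f has_derivative D) (at z)" "\<forall>c v. D (c *s v) = c *s D v" by blast
  have "bounded_linear (\<lambda>v. c *s (v :: complex ^ 'm))"
    by (rule bounded_linear_intro[where K = "cmod c"])
       (auto simp: vector_add_ldistrib norm_vector_smult vec_eq_iff)
  from bounded_linear.has_derivative[OF this D(1)] D(2)
  show "\<exists>D. ((\<lambda>z. c *s f z) has_derivative D) (at z) \<and> (\<forall>c v. D (c *s v) = c *s D v)"
    by (intro exI[of _ "\<lambda>v. c *s D v"]) (auto simp: vector_smult_assoc mult.commute)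
qed

lemma hol_on_scaleR: "hol_on f S \<Longrightarrow> hol_on (\<lambda>z. r *\<^sub>R f z) S"
  using hol_on_smult[of f S "of_real r"] by (simp add: vector_smult_of_real)

lemma hol_on_diff: "hol_on f S \<Longrightarrow> hol_on g S \<Longrightarrow> hol_on (\<lambda>z. f z - g z) S"
  using hol_on_add[of f S "\<lambda>z. (-1) *\<^sub>R g z"] hol_on_scaleR[of g S "-1"] by simp

lemma hol_on_sum: "(\<And>i. i \<in> I \<Longrightarrow> hol_on (f i) S) \<Longrightarrow> hol_on (\<lambda>z. \<Sum>i\<in>I. f i z) S"
  by (induction I rule: infinite_finite_induct) (auto intro: hol_on_const hol_on_add)

lemma hol_on_compose:
  assumes "hol_on f S" "hol_on g T" "f ` S \<subseteq> T"
  shows "hol_on (\<lambda>z. g (f z)) S"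
  unfolding hol_on_def
proof
  fix z assume z: "z \<in> S"
  obtain D where D: "(f has_derivative D) (at z)" "\<And>c v. D (c *s v) = c *s D v"
    using hol_onE[OF assms(1) z] by blast
  have "f z \<in> T" using assms z by blast
  then obtain E where E: "(g has_derivative E) (at (f z))" "\<And>c v. E (c *s v) = c *s E v"
    using hol_onE[OF assms(2)] by blast
  have "((\<lambda>z. g (f z)) has_derivative (\<lambda>v. E (D v))) (at z)"
    using diff_chain_at[OF D(1) E(1)] by (simp add: o_def)
  then show "\<exists>D. ((\<lambda>z. g (f z)) has_derivative D) (at z) \<and> (\<forall>c v. D (c *s v) = c *s D v)"
    using D(2) E(2) by (intro exI[of _ "\<lambda>v. E (D v)"]) auto
qed

lemma hol_on_mult_left: "hol_on (\<lambda>z. c *s z) S"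
  by (intro hol_on_smult hol_on_ident)

lemma scalar_hol_on_component: "hol_on f S \<Longrightarrow> scalar_hol_on (\<lambda>z. f z $ i) S"
  unfolding hol_on_def scalar_hol_on_def
proof
  fix z assume "\<forall>z\<in>S. \<exists>D. (f has_derivative D) (at z) \<and> (\<forall>c v. D (c *s v) = c *s D v)" "z \<in> S"
  then obtain D where "(f has_derivative D) (at z)" "\<forall>c v. D (c *s v) = c *s D v" by blast
  then show "\<exists>D. ((\<lambda>z. f z $ i) has_derivative D) (at z) \<and> (\<forall>c v. D (c *s v) = c * D v)"
    by (intro exI[of _ "\<lambda>v. D v $ i"]) (auto intro: bounded_linear.has_derivative[OF bounded_linear_vec_nth])
qed

lemma hol_on_components:
  fixes f :: "complex ^ 'n \<Rightarrow> complex ^ 'm"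
  assumes "\<And>i. scalar_hol_on (\<lambda>z. f z $ i) S"
  shows "hol_on f S"
  unfolding hol_on_def
proof
  fix z assume z: "z \<in> S"
  have "\<forall>i. \<exists>D. ((\<lambda>z. f z $ i) has_derivative D) (at z) \<and> (\<forall>c v. D (c *s v) = c * D v)"
    using assms z unfolding scalar_hol_on_def by blast
  then obtain D where D: "\<And>i. ((\<lambda>z. f z $ i) has_derivative D i) (at z)" "\<And>i c v. D i (c *s v) = c * D i v"
    by metis
  have bl: "bounded_linear (\<lambda>c. c *s (axis i 1 :: complex ^ 'm))" for i
    by (rule bounded_linear_vector_smult_left)
  have "((\<lambda>z. \<Sum>i\<in>UNIV. f z $ i *s axis i 1) has_derivative (\<lambda>v. \<Sum>i\<in>UNIV. D i v *s axis i 1)) (at z)"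
    by (intro has_derivative_sum bounded_linear.has_derivative[OF bl] D)
  then have "(f has_derivative (\<lambda>v. \<Sum>i\<in>UNIV. D i v *s axis i 1)) (at z)"
    by (simp add: basis_expansion)
  then show "\<exists>D. (f has_derivative D) (at z) \<and> (\<forall>c v. D (c *s v) = c *s D v)"
    by (intro exI[of _ "\<lambda>v. \<Sum>i\<in>UNIV. D i v *s axis i 1"])
       (auto simp: D(2) vector_smult_assoc vec_eq_iff sum_distrib_left mult.assoc)
qed

lemma scalar_hol_on_const: "scalar_hol_on (\<lambda>_. c) S"
  unfolding scalar_hol_on_def by (auto intro!: exI[of _ "\<lambda>_. 0"])

lemma scalar_hol_on_add: "scalar_hol_on f S \<Longrightarrow> scalar_hol_on g S \<Longrightarrow> scalar_hol_on (\<lambda>z. f z + g z) S"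
  unfolding scalar_hol_on_def
proof
  fix z assume "\<forall>z\<in>S. \<exists>D. (f has_derivative D) (at z) \<and> (\<forall>c v. D (c *s v) = c * D v)"
    "\<forall>z\<in>S. \<exists>D. (g has_derivative D) (at z) \<and> (\<forall>c v. D (c *s v) = c * D v)" "z \<in> S"
  then obtain D E where "(f has_derivative D) (at z)" "\<forall>c v. D (c *s v) = c * D v"
     "(g has_derivative E) (at z)" "\<forall>c v. E (c *s v) = c * E v" by blast
  then show "\<exists>D. ((\<lambda>z. f z + g z) has_derivative D) (at z) \<and> (\<forall>c v. D (c *s v) = c * D v)"
    by (intro exI[of _ "\<lambda>v. D v + E v"]) (auto intro: has_derivative_add simp: distrib_left)
qed

lemma scalar_hol_on_mult: "scalar_hol_on f S \<Longrightarrow> scalar_hol_on g S \<Longrightarrow> scalar_hol_on (\<lambda>z. f z * g z) S"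
  unfolding scalar_hol_on_def
proof
  fix z assume "\<forall>z\<in>S. \<exists>D. (f has_derivative D) (at z) \<and> (\<forall>c v. D (c *s v) = c * D v)"
    "\<forall>z\<in>S. \<exists>D. (g has_derivative D) (at z) \<and> (\<forall>c v. D (c *s v) = c * D v)" "z \<in> S"
  then obtain D E where "(f has_derivative D) (at z)" "\<forall>c v. D (c *s v) = c * D v"
     "(g has_derivative E) (at z)" "\<forall>c v. E (c *s v) = c * E v" by blast
  then show "\<exists>D. ((\<lambda>z. f z * g z) has_derivative D) (at z) \<and> (\<forall>c v. D (c *s v) = c * D v)"
    by (intro exI[of _ "\<lambda>v. f z * E v + D v * g z"] conjI has_derivative_mult)
       (simp_all add: algebra_simps)
qed

lemma scalar_hol_on_inverse:
  assumes "scalar_hol_on f S" "\<And>z. z \<in> S \<Longrightarrow> f z \<noteq> 0"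
  shows "scalar_hol_on (\<lambda>z. inverse (f z)) S"
  unfolding scalar_hol_on_def
proof
  fix z assume z: "z \<in> S"
  then obtain D where D: "(f has_derivative D) (at z)" "\<forall>c v. D (c *s v) = c * D v"
    using assms unfolding scalar_hol_on_def by blast
  show "\<exists>D. ((\<lambda>z. inverse (f z)) has_derivative D) (at z) \<and> (\<forall>c v. D (c *s v) = c * D v)"
    using has_derivative_compose[OF D(1) has_derivative_inverse'[OF assms(2)[OF z]]] D(2)
    by (intro exI[of _ "\<lambda>v. - (inverse (f z) * D v * inverse (f z))"]) (auto simp: algebra_simps)
qed

lemma scalar_hol_on_sum: "(\<And>i. i \<in> I \<Longrightarrow> scalar_hol_on (f i) S) \<Longrightarrow> scalar_hol_on (\<lambda>z. \<Sum>i\<in>I. f i z) S"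
  by (induction I rule: infinite_finite_induct) (auto intro: scalar_hol_on_const scalar_hol_on_add)

lemma scalar_hol_on_prod: "(\<And>i. i \<in> I \<Longrightarrow> scalar_hol_on (f i) S) \<Longrightarrow> scalar_hol_on (\<lambda>z. \<Prod>i\<in>I. f i z) S"
  by (induction I rule: infinite_finite_induct) (auto intro: scalar_hol_on_const scalar_hol_on_mult)

lemma scalar_hol_on_det:
  fixes A :: "complex ^ 'n \<Rightarrow> complex ^ 'k ^ 'k"
  assumes "\<And>i j. scalar_hol_on (\<lambda>z. A z $ i $ j) S"
  shows "scalar_hol_on (\<lambda>z. det (A z)) S"
  unfolding det_def
  by (intro scalar_hol_on_sum scalar_hol_on_mult scalar_hol_on_const scalar_hol_on_prod assms)

subsection \<open>Cauchy estimates on complex lines\<close>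

text \<open>Pairing with a fixed vector \<open>u\<close> turns the restriction of \<open>f\<close>
  to a complex line into a function of one complex variable. When \<open>u\<close> is the very
  vector to be estimated, the pairing recovers its norm, so one-variable estimates carry over
  without a dimensional factor.\<close>

lemma hinner_slice_derivative:
  assumes "(f has_derivative D) (at (z + l *s v))" "\<And>c v. D (c *s v) = c *s D v"
  shows "((\<lambda>l. hinner (f (z + l *s v)) u) has_field_derivative hinner (D v) u) (at l)"
proof -
  have "((\<lambda>l. z + l *s v) has_derivative (\<lambda>c. c *s v)) (at l)"
    using has_derivative_add[OF has_derivative_const bounded_linear_imp_has_derivative[OF bounded_linear_vector_smult_left]]
    by simp
  from has_derivative_compose[OF this assms(1)]
  have "((\<lambda>l. f (z + l *s v)) has_derivative (\<lambda>c. D (c *s v))) (at l)" .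
  from bounded_linear.has_derivative[OF bounded_linear_hinner_left this]
  have "((\<lambda>l. hinner (f (z + l *s v)) u) has_derivative (\<lambda>c. hinner (D (c *s v)) u)) (at l)" .
  then show ?thesis unfolding has_field_derivative_def
    by (rule has_derivative_eq_rhs) (simp add: fun_eq_iff assms(2) hinner_smult_left)
qed

lemma hinner_slice_holomorphic:
  assumes "hol_on f S" "\<And>l. l \<in> T \<Longrightarrow> z + l *s v \<in> S"
  shows "(\<lambda>l. hinner (f (z + l *s v)) u) holomorphic_on T"
  unfolding holomorphic_on_def
proof
  fix l assume "l \<in> T"
  then obtain D where "(f has_derivative D) (at (z + l *s v))" "\<And>c v. D (c *s v) = c *s D v"
    using hol_onE[OF assms(1) assms(2)] by blast
  from hinner_slice_derivative[OF this]
  show "(\<lambda>l. hinner (f (z + l *s v)) u) field_differentiable (at l within T)"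
    using field_differentiable_at_within field_differentiable_def by blast
qed

text \<open>Cauchy's inequality bounds the coefficients by \<open>M / r ^ k\<close>, so a geometric
  series with ratio \<open>norm w / r\<close> dominates the tail.\<close>

lemma holomorphic_taylor_tail:
  assumes hol: "g holomorphic_on cball 0 r" and M: "\<And>w. norm w \<le> r \<Longrightarrow> norm (g w) \<le> M" and w: "norm w < r"
  shows "norm (g w - (\<Sum>k<N. (deriv ^^ k) g 0 / fact k * w ^ k)) \<le> M * (norm w / r) ^ N / (1 - norm w / r)"
proof -
  define a where "a k = (deriv ^^ k) g 0 / fact k" for k
  define q where "q = norm w / r"
  have r: "r > 0" using w norm_ge_zero[of w] by linarith
  have q: "0 \<le> q" "q < 1" using w r by (auto simp: q_def)
  have a: "norm (a k) \<le> M / r ^ k" for k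
  proof -
    have "norm ((deriv ^^ k) g 0) \<le> fact k * M / r ^ k"
    proof (rule Cauchy_inequality)
      show "g holomorphic_on ball 0 r" using hol by (rule holomorphic_on_subset) auto
    qed (use hol M r in \<open>auto intro: holomorphic_on_imp_continuous_on\<close>)
    then show ?thesis by (simp add: a_def norm_divide field_simps)
  qed
  have tm: "norm (a k * w ^ k) \<le> M * q ^ k" for k
  proof -
    have "norm (a k * w ^ k) \<le> M / r ^ k * norm w ^ k"
      unfolding norm_mult norm_power by (intro mult_right_mono a) auto
    then show ?thesis by (simp add: q_def power_divide)
  qed
  have "(\<lambda>n. a n * (w - 0) ^ n) sums g w"
    unfolding a_def by (rule holomorphic_power_series[of g 0 r])
      (use hol w in \<open>auto intro: holomorphic_on_subset simp: dist_norm\<close>)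
  then have "(\<lambda>n. a (n + N) * w ^ (n + N)) sums (g w - (\<Sum>k<N. a k * w ^ k))"
    using sums_split_initial_segment[of "\<lambda>n. a n * w ^ n" "g w" N] by simp
  then have eq: "g w - (\<Sum>k<N. a k * w ^ k) = (\<Sum>n. a (n + N) * w ^ (n + N))"
    by (simp add: sums_iff)
  have sm: "(\<lambda>n. M * q ^ (n + N)) sums (M * q ^ N / (1 - q))"
  proof -
    have "(\<lambda>n. M * q ^ N * q ^ n) sums (M * q ^ N * (1 / (1 - q)))"
      using q by (intro sums_mult geometric_sums) auto
    then show ?thesis by (simp add: power_add mult_ac)
  qed
  have "norm (g w - (\<Sum>k<N. a k * w ^ k)) \<le> (\<Sum>n. M * q ^ (n + N))"
    unfolding eq by (rule norm_suminf_le) (use tm sm in \<open>auto simp: sums_iff\<close>)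
  also have "\<dots> = M * q ^ N / (1 - q)" using sm by (simp add: sums_iff)
  finally show ?thesis by (simp add: a_def q_def)
qed

lemma cauchy_estimate_derivative:
  assumes hol: "hol_on f S" and cb: "cball z s \<subseteq> S" and s: "s > 0"
    and M: "\<And>w. w \<in> cball z s \<Longrightarrow> norm (f w) \<le> M"
    and D: "(f has_derivative D) (at z)" "\<And>c v. D (c *s v) = c *s D v"
  shows "norm (D v) \<le> M / s * norm v"
proof (cases "v = 0 \<or> D v = 0")
  case True
  have "M \<ge> 0" using M[of z] s norm_ge_zero[of "f z"] by (smt (verit) centre_in_cball)
  then have "M / s * norm v \<ge> 0" using s by simp
  moreover have "D 0 = 0" using D(2)[of 0 0] by simp
  ultimately show ?thesis using True by auto
next
  case False
  \<comment> \<open>This is the largest radius for which the slice in direction \<open>v\<close>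
    stays in \<open>cball z s\<close>; pairing with \<open>D v\<close> makes the derivative of the
    slice at 0 equal to \<open>(norm (D v))\<^sup>2\<close>.\<close>
  define r where "r = s / norm v"
  define g where "g l = hinner (f (z + l *s v)) (D v)" for l
  have r: "r > 0" using s False by (simp add: r_def)
  have in_cb: "z + l *s v \<in> cball z s" if "norm l \<le> r" for l
  proof -
    have "norm l * norm v \<le> r * norm v" using that by (intro mult_right_mono) auto
    then show ?thesis using False by (simp add: dist_norm norm_vector_smult r_def)
  qed
  have "g holomorphic_on cball 0 r"
    unfolding g_def by (rule hinner_slice_holomorphic[OF hol]) (use in_cb cb in auto)
  then have "norm ((deriv ^^ 1) g 0) \<le> fact 1 * (M * norm (D v)) / r ^ 1"
  proof (intro Cauchy_inequality)
    show "norm (g x) \<le> M * norm (D v)" if "norm (0 - x) = r" for x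
      using order_trans[OF norm_hinner_le mult_right_mono[OF M[OF in_cb], of x "norm (D v)"]] that
      by (simp add: g_def)
  qed (use r in \<open>auto intro: holomorphic_on_subset holomorphic_on_imp_continuous_on\<close>)
  moreover have "deriv g 0 = hinner (D v) (D v)"
    unfolding g_def by (rule DERIV_imp_deriv, rule hinner_slice_derivative) (use D in auto)
  ultimately have "(norm (D v))\<^sup>2 \<le> M * norm (D v) / r"
    by (simp add: hinner_same norm_power)
  then have "norm (D v) * norm (D v) \<le> norm (D v) * (M / r)" by (simp add: power2_eq_square mult.commute)
  then have "norm (D v) \<le> M / r" using False by (simp only: mult_le_cancel_left) simp
  then show ?thesis by (simp add: r_def)
qed

text \<open>Pairing with the remainder itself leads to a Taylor tail of order two at
  \<open>l = 1\<close> on the disc of radius \<open>r = s / norm v\<close>. Since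
  \<open>r \<ge> 2\<close>, the geometric factor is at most 2.\<close>

lemma hol_on_quadratic_bound:
  assumes hol: "hol_on f S" and cb: "cball z s \<subseteq> S" and s: "s > 0"
    and M: "\<And>w. w \<in> cball z s \<Longrightarrow> norm (f w) \<le> M"
    and D: "(f has_derivative D) (at z)" "\<And>c v. D (c *s v) = c *s D v"
    and v: "norm v \<le> s / 2"
  shows "norm (f (z + v) - f z - D v) \<le> 2 * M / s\<^sup>2 * (norm v)\<^sup>2"
proof (cases "v = 0 \<or> f (z + v) - f z - D v = 0")
  case True
  have "M \<ge> 0" using M[of z] s norm_ge_zero[of "f z"] by (smt (verit) centre_in_cball)
  then have "2 * M / s\<^sup>2 * (norm v)\<^sup>2 \<ge> 0" using s by simp
  moreover have "D 0 = 0" using D(2)[of 0 0] by simp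
  ultimately show ?thesis using True by auto
next
  case False
  define r where "r = s / norm v"
  define u where "u = f (z + v) - f z - D v"
  define g where "g l = hinner (f (z + l *s v)) u" for l
  have r: "r \<ge> 2" using s v False by (simp add: r_def field_simps)
  have in_cb: "z + l *s v \<in> cball z s" if "norm l \<le> r" for l
  proof -
    have "norm l * norm v \<le> r * norm v" using that by (intro mult_right_mono) auto
    then show ?thesis using False by (simp add: dist_norm norm_vector_smult r_def)
  qed
  have "g holomorphic_on cball 0 r"
    unfolding g_def by (rule hinner_slice_holomorphic[OF hol]) (use in_cb cb in auto)
  then have "norm (g 1 - (\<Sum>k<2. (deriv ^^ k) g 0 / fact k * 1 ^ k)) \<le>
      M * norm u * (norm (1::complex) / r) ^ 2 / (1 - norm (1::complex) / r)"
  proof (rule holomorphic_taylor_tail)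
    show "norm (g x) \<le> M * norm u" if "norm x \<le> r" for x
      using order_trans[OF norm_hinner_le mult_right_mono[OF M[OF in_cb], of x "norm u"]] that
      by (simp add: g_def)
  qed (use r in auto)
  moreover have "deriv g 0 = hinner (D v) u"
    unfolding g_def by (rule DERIV_imp_deriv, rule hinner_slice_derivative) (use D in auto)
  ultimately have "norm (g 1 - g 0 - hinner (D v) u) \<le> M * norm u * (1 / r)\<^sup>2 / (1 - 1 / r)"
    by (simp add: numeral_2_eq_2 lessThan_Suc algebra_simps)
  moreover have "g 1 - g 0 - hinner (D v) u = of_real ((norm u)\<^sup>2)"
    by (simp add: g_def hinner_diff_left[symmetric] u_def[symmetric] hinner_same)
  ultimately have le: "(norm u)\<^sup>2 \<le> norm u * (M * (1 / r)\<^sup>2 / (1 - 1 / r))"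
    by (simp add: norm_power mult_ac)
  have "norm u > 0" using False by (simp add: u_def)
  then have "norm u \<le> M * (1 / r)\<^sup>2 / (1 - 1 / r)"
    using le unfolding power2_eq_square[of "norm u"] by (simp only: mult_le_cancel_left)
  also have "\<dots> \<le> M * (1 / r)\<^sup>2 / (1 / 2)"
  proof (rule divide_left_mono)
    have "M \<ge> 0" using M[of z] s norm_ge_zero[of "f z"] by (smt (verit) centre_in_cball)
    then show "0 \<le> M * (1 / r)\<^sup>2" by simp
  qed (use r in \<open>auto simp: field_simps\<close>)
  also have "\<dots> = 2 * M / s\<^sup>2 * (norm v)\<^sup>2" by (simp add: r_def power_divide)
  finally show ?thesis by (simp add: u_def)
qed

text \<open>The Cauchy estimates make the derivatives a uniform Cauchy sequence on a smaller ball,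
  so the limit is differentiable there with the limit of the derivatives as its derivative; complex
  linearity survives the limit.\<close>

lemma hol_on_uniform_limit:
  fixes f :: "nat \<Rightarrow> complex ^ 'n \<Rightarrow> complex ^ 'm"
  assumes S: "open S" and hol: "\<And>k. hol_on (f k) S"
    and lim: "\<And>K. compact K \<Longrightarrow> K \<subseteq> S \<Longrightarrow> uniform_limit K f l sequentially"
  shows "hol_on l S"
  unfolding hol_on_def
proof
  fix z assume z: "z \<in> S"
  obtain s' where s': "s' > 0" "cball z s' \<subseteq> S" using S z open_contains_cball by blast
  \<comment> \<open>Halving the radius leaves room for a Cauchy estimate of radius \<open>s\<close>
    around every point of \<open>ball z s\<close>.\<close>
  define s where "s = s' / 2"
  have s: "s > 0" "cball z (2 * s) \<subseteq> S" using s' by (auto simp: s_def)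
  have "\<forall>k x. \<exists>D. x \<in> S \<longrightarrow> (f k has_derivative D) (at x) \<and> (\<forall>c v. D (c *s v) = c *s D v)"
    using hol unfolding hol_on_def by blast
  then obtain D where D: "\<And>k x. x \<in> S \<Longrightarrow> (f k has_derivative D k x) (at x)"
     "\<And>k x c v. x \<in> S \<Longrightarrow> D k x (c *s v) = c *s D k x v" by metis
  have est: "norm (D j x h - D k x h) \<le> e / s * norm h"
    if x: "x \<in> ball z s" and e: "\<And>w. w \<in> cball z (2 * s) \<Longrightarrow> norm (f j w - f k w) \<le> e" for j k x h e
  proof -
    have sub: "cball x s \<subseteq> cball z (2 * s)"
    proof
      fix w assume "w \<in> cball x s"
      then show "w \<in> cball z (2 * s)" using x dist_triangle[of z w x] by auto
    qed
    have xS: "x \<in> S" using sub s by (meson centre_in_cball less_imp_le subsetD)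
    show ?thesis
    proof (rule cauchy_estimate_derivative[where f = "\<lambda>w. f j w - f k w" and S = S and z = x and s = s and D = "\<lambda>v. D j x v - D k x v"])
      show "hol_on (\<lambda>w. f j w - f k w) S" by (intro hol_on_diff hol)
      show "((\<lambda>w. f j w - f k w) has_derivative (\<lambda>v. D j x v - D k x v)) (at x)"
        by (intro has_derivative_diff D xS)
      show "D j x (c *s v) - D k x (c *s v) = c *s (D j x v - D k x v)" for c v
        by (simp add: D(2)[OF xS] vector_ssub_ldistrib)
      show "norm (f j w - f k w) \<le> e" if "w \<in> cball x s" for w using sub e that by blast
    qed (use sub s in auto)
  qed
  have unif: "\<exists>N. \<forall>j\<ge>N. \<forall>k\<ge>N. \<forall>w\<in>cball z (2 * s). norm (f j w - f k w) \<le> e" if e: "e > 0" for e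
  proof -
    have "\<forall>\<^sub>F k in sequentially. \<forall>w\<in>cball z (2 * s). dist (f k w) (l w) < e / 2"
      using uniform_limitD[OF lim[OF compact_cball s(2)], of "e / 2"] e by simp
    then obtain N where N: "\<And>k w. k \<ge> N \<Longrightarrow> w \<in> cball z (2 * s) \<Longrightarrow> dist (f k w) (l w) < e / 2"
      unfolding eventually_sequentially by blast
    have "norm (f j w - f k w) \<le> e" if "j \<ge> N" "k \<ge> N" "w \<in> cball z (2 * s)" for j k w
    proof -
      have "dist (f j w) (l w) < e / 2" "dist (f k w) (l w) < e / 2" using N that by blast+
      then have "dist (f j w) (f k w) < e" by (rule dist_triangle_half_l)
      then show ?thesis by (simp add: dist_norm)
    qed
    then show ?thesis by blast
  qed
  have "\<exists>g'. (\<lambda>k. D k x h) \<longlonglongrightarrow> g'" if x: "x \<in> ball z s" for x h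
  proof -
    have "Cauchy (\<lambda>k. D k x h)"
    proof (rule metric_CauchyI)
      fix e :: real assume e: "e > 0"
      define e' where "e' = e * s / (norm h + 1)"
      have "norm h + 1 > 0" using norm_ge_zero[of h] by linarith
      then have e': "e' > 0" using e s by (simp add: e'_def)
      have "e' / s * norm h = e * (norm h / (norm h + 1))" using s by (simp add: e'_def)
      also have "\<dots> < e" using e \<open>norm h + 1 > 0\<close> by (simp add: divide_simps)
      finally have lt: "e' / s * norm h < e" .
      obtain N where N: "\<forall>j\<ge>N. \<forall>k\<ge>N. \<forall>w\<in>cball z (2 * s). norm (f j w - f k w) \<le> e'"
        using unif[OF e'] by blast
      have "dist (D j x h) (D k x h) < e" if "j \<ge> N" "k \<ge> N" for j k
        using est[OF x, of j k e' h] N that lt by (auto simp: dist_norm)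
      then show "\<exists>M. \<forall>m\<ge>M. \<forall>n\<ge>M. dist (D m x h) (D n x h) < e" by blast
    qed
    then show ?thesis by (simp add: Cauchy_convergent_iff convergent_def)
  qed
  then obtain g' where g': "\<And>x h. x \<in> ball z s \<Longrightarrow> (\<lambda>k. D k x h) \<longlonglongrightarrow> g' x h" by metis
  have ballS: "ball z s \<subseteq> S"
  proof
    fix w assume "w \<in> ball z s"
    then have "w \<in> cball z (2 * s)" using s by auto
    then show "w \<in> S" using s by blast
  qed
  have "\<exists>g. \<forall>x\<in>ball z s. (\<lambda>n. f n x) \<longlonglongrightarrow> g x \<and> (g has_derivative g' x) (at x within ball z s)"
  proof (rule has_derivative_sequence[where f = f and f' = D])
    show "convex (ball z s)" by simp
    show "(f n has_derivative D n x) (at x within ball z s)" if "x \<in> ball z s" for n x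
      by (rule has_derivative_at_withinI, rule D(1)) (use that ballS in blast)
    show "\<forall>\<^sub>F n in sequentially. \<forall>x\<in>ball z s. \<forall>h. norm (D n x h - g' x h) \<le> e * norm h" if e: "e > 0" for e
    proof -
      have es: "e * s > 0" using e s by simp
      obtain N where N: "\<forall>j\<ge>N. \<forall>k\<ge>N. \<forall>w\<in>cball z (2 * s). norm (f j w - f k w) \<le> e * s"
        using unif[OF es] by blast
      have "norm (D n x h - g' x h) \<le> e * norm h" if "n \<ge> N" "x \<in> ball z s" for n x h
      proof (rule LIMSEQ_le_const2)
        show "(\<lambda>k. norm (D n x h - D k x h)) \<longlonglongrightarrow> norm (D n x h - g' x h)"
          by (intro tendsto_intros g' that)
        show "\<exists>N'. \<forall>k\<ge>N'. norm (D n x h - D k x h) \<le> e * norm h"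
        proof (intro exI[of _ N] allI impI)
          fix k assume "k \<ge> N"
          then have "norm (D n x h - D k x h) \<le> e * s / s * norm h"
            by (intro est[OF that(2)]) (use N that(1) in blast)
          then show "norm (D n x h - D k x h) \<le> e * norm h" using s by simp
        qed
      qed
      then show ?thesis unfolding eventually_sequentially by blast
    qed
    show "z \<in> ball z s" using s by simp
    show "(\<lambda>n. f n z) \<longlonglongrightarrow> l z"
      using tendsto_uniform_limitI[OF lim[of "{z}"]] z by auto
  qed
  then obtain g where g: "\<And>x. x \<in> ball z s \<Longrightarrow> (\<lambda>n. f n x) \<longlonglongrightarrow> g x"
     "\<And>x. x \<in> ball z s \<Longrightarrow> (g has_derivative g' x) (at x within ball z s)" by blast
  have gl: "g x = l x" if "x \<in> ball z s" for x
  proof -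
    have "(\<lambda>n. f n x) \<longlonglongrightarrow> l x"
      using tendsto_uniform_limitI[OF lim[of "{x}"]] that ballS by auto
    then show ?thesis using g(1)[OF that] LIMSEQ_unique by blast
  qed
  have zb: "z \<in> ball z s" using s by simp
  have "(g has_derivative g' z) (at z)"
    using g(2)[OF zb] zb by (simp add: at_within_open[OF zb open_ball])
  then have "(l has_derivative g' z) (at z)"
    using has_derivative_transform_within_open[of g "g' z" z UNIV "ball z s" l] zb gl by auto
  moreover have "g' z (c *s v) = c *s g' z v" for c v
  proof (rule LIMSEQ_unique[OF g'[OF zb]])
    have "bounded_linear (\<lambda>v. c *s (v :: complex ^ 'm))"
      by (rule bounded_linear_intro[where K = "cmod c"])
         (auto simp: vector_add_ldistrib norm_vector_smult vec_eq_iff)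
    from bounded_linear.tendsto[OF this g'[OF zb, of v]]
    show "(\<lambda>k. D k z (c *s v)) \<longlonglongrightarrow> c *s g' z v" by (simp add: D(2)[OF z])
  qed
  ultimately show "\<exists>D. (l has_derivative D) (at z) \<and> (\<forall>c v. D (c *s v) = c *s D v)" by blast
qed

section \<open>Uniform limits and compact subsets of the ball\<close>

lemma uniform_limitI_bound:
  fixes f :: "'b \<Rightarrow> 'a \<Rightarrow> 'c::real_normed_vector"
  assumes "\<forall>\<^sub>F m in F. \<forall>z\<in>K. norm (f m z - l z) \<le> b m" "(b \<longlongrightarrow> (0::real)) F"
  shows "uniform_limit K f l F"
proof (rule uniform_limitI)
  fix e :: real assume "e > 0"
  then have "\<forall>\<^sub>F m in F. b m < e" using assms(2) by (auto dest: order_tendstoD)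
  with assms(1) show "\<forall>\<^sub>F m in F. \<forall>z\<in>K. dist (f m z) (l z) < e"
    by eventually_elim (auto simp: dist_norm intro: le_less_trans)
qed

lemma compact_subset_ball_cball:
  fixes K :: "'a::real_normed_vector set"
  assumes "compact K" "K \<subseteq> ball 0 R" "0 < R"
  obtains r where "0 < r" "r < R" "K \<subseteq> cball 0 r"
proof (cases "K = {}")
  case True
  then show ?thesis using that[of "R / 2"] assms by auto
next
  case False
  obtain x where x: "x \<in> K" "\<And>y. y \<in> K \<Longrightarrow> norm y \<le> norm x"
    using continuous_attains_sup[OF assms(1) False, of norm] continuous_on_norm_id by auto
  have "norm x < R" using x assms by auto
  then show ?thesis using x that[of "max (norm x) (R / 2)"] assms by force
qed

lemma hol_on_bounded_cball:
  assumes "hol_on f S" "cball z r \<subseteq> S"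
  shows "\<exists>M>0. \<forall>w\<in>cball z r. norm (f w) \<le> M"
proof -
  have "compact (f ` cball z r)"
    using hol_on_continuous_on[OF assms(1)] assms(2) by (intro compact_continuous_image) (auto intro: continuous_on_subset)
  then have "bounded (f ` cball z r)" by (rule compact_imp_bounded)
  then show ?thesis unfolding bounded_pos by blast
qed

lemma norm_le_sum_norm_components: "norm (x :: complex ^ 'n) \<le> (\<Sum>i\<in>UNIV. norm (x $ i))"
  unfolding norm_vec_def by (rule L2_set_le_sum) auto

subsection \<open>Homogeneous expansions\<close>

text \<open>This is the homogeneous Taylor part of degree \<open>k\<close> at 0, read off from the
  slice \<open>l \<mapsto> f (l *s z)\<close>. The encoding avoids multi-indices; holomorphy in
  \<open>z\<close> then needs the separate argument of \<open>hom_part_hol_on\<close>.\<close>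

definition hom_part :: "(complex ^ 'n \<Rightarrow> complex ^ 'm) \<Rightarrow> nat \<Rightarrow> complex ^ 'n \<Rightarrow> complex ^ 'm" where
  "hom_part f k z = (\<chi> i. (deriv ^^ k) (\<lambda>l. f (l *s z) $ i) 0 / fact k)"

lemma component_slice_holomorphic:
  fixes f :: "complex ^ 'n \<Rightarrow> complex ^ 'm"
  assumes "hol_on f (ball 0 R)" "\<And>l. l \<in> T \<Longrightarrow> norm l * norm z < R"
  shows "(\<lambda>l. f (l *s z) $ i) holomorphic_on T"
  using hinner_slice_holomorphic[of f "ball 0 R" T 0 z "axis i 1"] assms
  by (simp add: hinner_axis norm_vector_smult)

context
  fixes f :: "complex ^ 'n \<Rightarrow> complex ^ 'm" and R r M :: real
  assumes hol: "hol_on f (ball 0 R)" and r: "0 < r" "r < R"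
    and M: "\<forall>w\<in>cball 0 r. norm (f w) \<le> M"
begin

lemma slice_closed_disc:
  assumes "norm z \<le> r"
  shows "(\<lambda>l. f (l *s z) $ i) holomorphic_on cball 0 1"
    and "norm l \<le> 1 \<Longrightarrow> norm (f (l *s z) $ i) \<le> M"
proof -
  have le: "norm l * norm z \<le> r" if "norm l \<le> 1" for l :: complex
    using mult_mono[OF that assms] by simp
  show "(\<lambda>l. f (l *s z) $ i) holomorphic_on cball 0 1"
    by (rule component_slice_holomorphic[OF hol]) (use le r in force)
  show "norm (f (l *s z) $ i) \<le> M" if "norm l \<le> 1"
    using order_trans[OF Finite_Cartesian_Product.norm_nth_le M[rule_format, of "l *s z"]] le[OF that]
    by (simp add: norm_vector_smult)
qed

lemma hom_part_tail:
  assumes "norm z \<le> r" "norm l < 1"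
  shows "norm (f (l *s z) - (\<Sum>k<N. l ^ k *s hom_part f k z)) \<le> CARD('m) * (M * norm l ^ N / (1 - norm l))"
proof -
  have "norm (f (l *s z) - (\<Sum>k<N. l ^ k *s hom_part f k z))
      \<le> (\<Sum>i\<in>UNIV. norm ((f (l *s z) - (\<Sum>k<N. l ^ k *s hom_part f k z)) $ i))"
    by (rule norm_le_sum_norm_components)
  also have "\<dots> \<le> (\<Sum>i\<in>(UNIV::'m set). M * norm l ^ N / (1 - norm l))"
  proof (intro sum_mono)
    fix i :: 'm
    have "norm (f (l *s z) $ i - (\<Sum>k<N. (deriv ^^ k) (\<lambda>l. f (l *s z) $ i) 0 / fact k * l ^ k))
       \<le> M * (norm l / 1) ^ N / (1 - norm l / 1)"
      by (rule holomorphic_taylor_tail[where r = 1]) (use slice_closed_disc[OF assms(1)] assms(2) in auto)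
    then show "norm ((f (l *s z) - (\<Sum>k<N. l ^ k *s hom_part f k z)) $ i) \<le> M * norm l ^ N / (1 - norm l)"
      by (simp add: hom_part_def mult.commute)
  qed
  finally show ?thesis by simp
qed

lemma norm_hom_part_le:
  assumes "norm z \<le> r"
  shows "norm (hom_part f k z) \<le> CARD('m) * M"
proof -
  have "norm (hom_part f k z) \<le> (\<Sum>i\<in>UNIV. norm (hom_part f k z $ i))"
    by (rule norm_le_sum_norm_components)
  also have "\<dots> \<le> (\<Sum>i\<in>(UNIV::'m set). M)"
  proof (intro sum_mono)
    fix i :: 'm
    have "norm ((deriv ^^ k) (\<lambda>l. f (l *s z) $ i) 0) \<le> fact k * M / 1 ^ k"
    proof (rule Cauchy_inequality)
      show "(\<lambda>l. f (l *s z) $ i) holomorphic_on ball 0 1"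
        by (rule holomorphic_on_subset[OF slice_closed_disc(1)[OF assms]]) auto
    qed (use slice_closed_disc[OF assms] in \<open>auto intro: holomorphic_on_imp_continuous_on\<close>)
    then show "norm (hom_part f k z $ i) \<le> M"
      by (simp add: hom_part_def norm_divide divide_simps mult.commute)
  qed
  finally show ?thesis by simp
qed

text \<open>Only the germ of the slice at \<open>l = 0\<close> enters, so homogeneity holds for
  every \<open>z\<close>, also outside the ball. It later extends the homogeneous parts to larger
  balls.\<close>

lemma hom_part_smult: "hom_part f k (c *s z) = c ^ k *s hom_part f k z"
proof -
  define \<rho> where "\<rho> = R / (norm z + 1)"
  define \<sigma> where "\<sigma> = \<rho> / (norm c + 1)"
  have z: "norm z + 1 > 0" "norm c + 1 > 0" by (smt (verit) norm_ge_zero)+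
  have pos: "\<rho> > 0" "\<sigma> > 0" using r z by (auto simp: \<rho>_def \<sigma>_def)
  have lR: "norm l * norm z < R" if "norm l < \<rho>" for l :: complex
  proof -
    have "norm l * norm z \<le> norm l * (norm z + 1)" by (intro mult_left_mono) auto
    also have "\<dots> < \<rho> * (norm z + 1)" using that z by (intro mult_strict_right_mono) auto
    finally show ?thesis using z by (simp add: \<rho>_def)
  qed
  have lc: "norm (c * l) < \<rho>" if "norm l < \<sigma>" for l :: complex
  proof -
    have "norm (c * l) \<le> (norm c + 1) * norm l" by (simp add: norm_mult mult_right_mono)
    also have "\<dots> < (norm c + 1) * \<sigma>" using that z by (intro mult_strict_left_mono) auto
    finally show ?thesis using z by (simp add: \<sigma>_def)
  qed
  have "(deriv ^^ k) (\<lambda>l. f ((c * l) *s z) $ i) 0 = c ^ k * (deriv ^^ k) (\<lambda>l. f (l *s z) $ i) (c * 0)" for i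
    by (rule higher_deriv_compose_linear[where f = "\<lambda>l. f (l *s z) $ i" and T = "ball 0 \<rho>" and S = "ball 0 \<sigma>"])
       (use lR lc pos in \<open>auto intro!: component_slice_holomorphic[OF hol]\<close>)
  then show ?thesis by (simp add: hom_part_def vec_eq_iff vector_smult_assoc mult.commute)
qed

end

text \<open>Subtracting the parts of degree below \<open>k\<close>, which are holomorphic by
  induction, and dividing by \<open>l ^ k\<close> gives holomorphic maps that converge to the part
  of degree \<open>k\<close> as \<open>l\<close> tends to 0, uniformly on compact sets by the tail
  estimate.\<close>

lemma hom_part_hol_on:
  fixes f :: "complex ^ 'a \<Rightarrow> complex ^ 'b"
  assumes hol: "hol_on f (ball 0 R)" and R: "0 < R"
  shows "hol_on (hom_part f k) (ball 0 R)"
proof (induction k rule: less_induct)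
  case (less k)
  \<comment> \<open>The shift by 2 keeps \<open>norm (l m)\<close> at most 1/2, so the factor
    \<open>1 / (1 - norm (l m))\<close> in the tail is at most 2.\<close>
  define l where "l m = complex_of_real (1 / (real m + 2))" for m :: nat
  have l: "l m \<noteq> 0" "norm (l m) = 1 / (real m + 2)" for m
  proof -
    show "norm (l m) = 1 / (real m + 2)" unfolding l_def norm_of_real by simp
    then show "l m \<noteq> 0" by auto
  qed
  have l1: "norm (l m) \<le> 1/2" for m unfolding l(2) by (simp add: divide_simps)
  define q where "q m z = inverse (l m ^ k) *s (f (l m *s z) - (\<Sum>j<k. l m ^ j *s hom_part f j z))" for m z
  have hq: "hol_on (q m) (ball 0 R)" for m
    unfolding q_def
  proof (intro hol_on_smult hol_on_diff hol_on_sum)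
    show "hol_on (\<lambda>z. f (l m *s z)) (ball 0 R)"
    proof (rule hol_on_compose[OF hol_on_mult_left hol])
      show "(*s) (l m) ` ball 0 R \<subseteq> (ball 0 R :: (complex ^ 'a) set)"
      proof (rule image_subsetI)
        fix x :: "complex ^ 'a" assume "x \<in> ball 0 R"
        moreover have "norm (l m) * norm x \<le> 1 * norm x" using l1[of m] by (intro mult_right_mono) auto
        ultimately show "l m *s x \<in> ball 0 R" by (simp add: norm_vector_smult)
      qed
    qed
  qed (use less.IH in auto)
  have uq: "uniform_limit K q (hom_part f k) sequentially" if K: "compact K" "K \<subseteq> ball 0 R" for K
  proof -
    obtain r where r: "0 < r" "r < R" "K \<subseteq> cball 0 r" using compact_subset_ball_cball[OF K R] by blast
    have "cball 0 r \<subseteq> ball 0 R" using r by auto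
    from hol_on_bounded_cball[OF hol this]
    obtain M where M: "M > 0" "\<forall>w\<in>cball 0 r. norm (f w) \<le> M" by blast
    show ?thesis
    proof (rule uniform_limitI_bound[where b = "\<lambda>m. CARD('b) * (M * 2) * (1 / (real m + 2))"])
      have "norm (q m z - hom_part f k z) \<le> CARD('b) * (M * 2) * (1 / (real m + 2))" if z: "z \<in> K" for m z
      proof -
        have "q m z - hom_part f k z = inverse (l m ^ k) *s (f (l m *s z) - (\<Sum>j<Suc k. l m ^ j *s hom_part f j z))"
          using l(1)[of m] by (simp add: q_def vector_ssub_ldistrib vector_add_ldistrib vector_smult_assoc algebra_simps)
        then have "norm (q m z - hom_part f k z)
            = inverse (norm (l m) ^ k) * norm (f (l m *s z) - (\<Sum>j<Suc k. l m ^ j *s hom_part f j z))"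
          by (simp only: norm_vector_smult norm_inverse norm_power)
        also have "\<dots> \<le> inverse (norm (l m) ^ k) * (CARD('b) * (M * norm (l m) ^ Suc k / (1 - norm (l m))))"
          by (intro mult_left_mono hom_part_tail[OF hol r(1,2) M(2)]) (use z r l1[of m] in auto)
        also have "\<dots> = CARD('b) * M * (norm (l m) / (1 - norm (l m)))"
          using l(1)[of m] by simp
        also have "\<dots> \<le> CARD('b) * M * (norm (l m) / (1/2))"
          using l1[of m] M by (intro mult_left_mono divide_left_mono) auto
        finally show ?thesis by (simp add: l(2) mult_ac)
      qed
      then show "\<forall>\<^sub>F m in sequentially. \<forall>z\<in>K. norm (q m z - hom_part f k z) \<le> CARD('b) * (M * 2) * (1 / (real m + 2))"
        by (intro always_eventually) blast
      have "(\<lambda>m. 1 / (real m + 2)) \<longlonglongrightarrow> 0"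
        using LIMSEQ_ignore_initial_segment[OF lim_inverse_n', of 2] by (simp only: of_nat_add of_nat_numeral)
      from tendsto_mult_right_zero[OF this]
      show "(\<lambda>m. CARD('b) * (M * 2) * (1 / (real m + 2))) \<longlonglongrightarrow> 0" .
    qed
  qed
  show ?case by (rule hol_on_uniform_limit[OF open_ball hq uq])
qed

text \<open>The map \<open>q\<close> is a Taylor polynomial. The quadratic bound near 0 kills its
  parts of degree 0 and 1, and a polynomial lives on the whole unit ball even when \<open>f\<close>
  does not. This converts a local condition of order two into a bound valid on the unit ball, which
  the perturbation of a vector field requires.\<close>

lemma quadratic_approximation:
  fixes f :: "complex ^ 'n \<Rightarrow> complex ^ 'm"
  assumes hol: "hol_on f (ball 0 R)" and R: "0 < r" "r < R"
    and quad: "\<rho> > 0" "\<And>z. norm z < \<rho> \<Longrightarrow> norm (f z) \<le> C * (norm z)\<^sup>2" and e: "e > 0"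
  obtains q C' where "hol_on q unit_ball" "\<And>z. z \<in> unit_ball \<Longrightarrow> norm (q z) \<le> C' * (norm z)\<^sup>2"
    "\<And>z. z \<in> cball 0 r \<Longrightarrow> norm (f z - q z) \<le> e"
proof -
  \<comment> \<open>A radius strictly between \<open>r\<close> and \<open>R\<close>: the bound
    \<open>M\<close> holds on \<open>cball 0 r1\<close>, and points of \<open>cball 0 r\<close> are
    scaled by the ratio \<open>r / r1 < 1\<close>, which makes the Taylor tail small.\<close>
  define r1 where "r1 = (r + R) / 2"
  have r1: "0 < r1" "r < r1" "r1 < R" using R by (auto simp: r1_def)
  have "cball 0 r1 \<subseteq> ball 0 R" using r1 by auto
  from hol_on_bounded_cball[OF hol this]
  obtain M where M: "M > 0" "\<forall>w\<in>cball 0 r1. norm (f w) \<le> M" by blast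
  note tail = hom_part_tail[OF hol r1(1,3) M(2)]
  note bound = norm_hom_part_le[OF hol r1(1,3) M(2)]
  note scale = hom_part_smult[OF hol r1(1,3) M(2)]
  have small: "hom_part f k z = 0" if k: "k < 2" for k z
  proof -
    have slice_quad: "norm (f (l *s z) $ i) \<le> C * (norm z)\<^sup>2 * (norm l)\<^sup>2" if "norm l * norm z < \<rho>" for l z i
      using order_trans[OF Finite_Cartesian_Product.norm_nth_le quad(2)[of "l *s z"]] that
      by (simp add: norm_vector_smult power_mult_distrib mult_ac)
    have f0: "f 0 = 0" using quad(2)[of 0] quad(1) by simp
    consider "k = 0" | "k = 1" using k by linarith
    then show ?thesis
    proof cases
      case 1
      then show ?thesis using f0 by (simp add: hom_part_def vec_eq_iff)
    next
      case 2
      have "deriv (\<lambda>l. f (l *s z) $ i) 0 = 0" for i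
      proof (rule DERIV_imp_deriv)
        define d where "d = \<rho> / (norm z + 1)"
        have z1: "norm z + 1 > 0" by (smt (verit) norm_ge_zero)
        have d: "d > 0" using quad(1) z1 by (simp add: d_def)
        have "((\<lambda>l. (f (l *s z) $ i) / l) \<longlongrightarrow> 0) (at 0)"
        proof (rule Lim_null_comparison)
          show "((\<lambda>l. C * (norm z)\<^sup>2 * norm l) \<longlongrightarrow> 0) (at (0::complex))"
            by (rule tendsto_eq_intros refl | simp)+
          show "\<forall>\<^sub>F l in at 0. norm (f (l *s z) $ i / l) \<le> C * (norm z)\<^sup>2 * norm l"
            unfolding eventually_at
          proof (intro exI[of _ d] conjI ballI impI d)
            fix l :: complex assume l: "l \<noteq> 0 \<and> dist l 0 < d"
            have "norm l * norm z \<le> norm l * (norm z + 1)" by (intro mult_left_mono) auto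
            also have "\<dots> < d * (norm z + 1)" using l z1 by (intro mult_strict_right_mono) auto
            finally have "norm l * norm z < \<rho>" using z1 by (simp add: d_def)
            from slice_quad[OF this, of i] l
            show "norm (f (l *s z) $ i / l) \<le> C * (norm z)\<^sup>2 * norm l"
              by (simp add: norm_divide divide_simps power2_eq_square mult_ac)
          qed
        qed
        then show "((\<lambda>l. f (l *s z) $ i) has_field_derivative 0) (at 0)"
          by (simp add: has_field_derivative_iff f0)
      qed
      then show ?thesis by (simp add: 2 hom_part_def vec_eq_iff)
    qed
  qed
  define lam where "lam = r / r1"
  have lam: "0 < lam" "lam < 1" using R r1 by (auto simp: lam_def)
  have "(\<lambda>N. CARD('m) * (M * lam ^ N / (1 - lam))) \<longlonglongrightarrow> CARD('m) * (M * 0 / (1 - lam))"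
    using lam by (intro tendsto_intros LIMSEQ_realpow_zero) auto
  then have "\<forall>\<^sub>F N in sequentially. CARD('m) * (M * lam ^ N / (1 - lam)) < e"
    using e by (intro order_tendstoD) auto
  then obtain N where N: "CARD('m) * (M * lam ^ N / (1 - lam)) < e"
    by (auto simp: eventually_sequentially)
  define q where "q z = (\<Sum>k<N. hom_part f k z)" for z
  show ?thesis
  proof (rule that)
    have "hol_on (hom_part f k) unit_ball" for k
    proof -
      \<comment> \<open>Homogeneity moves the unit ball into the ball of radius \<open>R\<close>,
        where holomorphy of the homogeneous part is known.\<close>
      have c: "hom_part f k z = inverse (complex_of_real r1 ^ k) *s hom_part f k (complex_of_real r1 *s z)" for z
        using r1 by (simp add: scale vector_smult_assoc)
      have "hol_on (\<lambda>z. inverse (complex_of_real r1 ^ k) *s hom_part f k (complex_of_real r1 *s z)) unit_ball"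
      proof (intro hol_on_smult hol_on_compose[OF hol_on_mult_left hom_part_hol_on[OF hol]])
        show "(*s) (complex_of_real r1) ` unit_ball \<subseteq> (ball 0 R :: (complex ^ 'n) set)"
        proof clarsimp
          fix x :: "complex ^ 'n" assume "norm x < 1"
          then have "r1 * norm x < r1 * 1" using r1 by (intro mult_strict_left_mono) auto
          then have "r1 * norm x < R" using r1 by linarith
          then show "norm (complex_of_real r1 *s x) < R" using r1 by (simp add: norm_vector_smult)
        qed
      qed (use R in auto)
      then show ?thesis by (simp only: c[symmetric])
    qed
    then show "hol_on q unit_ball" unfolding q_def by (intro hol_on_sum)
  next
    fix z :: "complex ^ 'n" assume "z \<in> unit_ball"
    then have z: "norm z < 1" by simp
    show "norm (q z) \<le> (\<Sum>k<N. CARD('m) * M / r1 ^ k) * (norm z)\<^sup>2"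
      unfolding q_def sum_distrib_right
    proof (rule order_trans[OF norm_sum], intro sum_mono)
      fix k
      show "norm (hom_part f k z) \<le> CARD('m) * M / r1 ^ k * (norm z)\<^sup>2"
      proof (cases "k < 2 \<or> z = 0")
        case True
        have "hom_part f k z = 0"
        proof (cases "k < 2")
          case False
          with True have "z = 0" "k > 0" by auto
          then show ?thesis using scale[of k 0 0] by (simp add: zero_power)
        qed (rule small)
        then show ?thesis using M(1) r1 by simp
      next
        case False
        \<comment> \<open>Scaled to norm \<open>r1\<close>, the point falls under the uniform bound
          for homogeneous parts; since \<open>k \<ge> 2\<close> and \<open>norm z < 1\<close>, the
          resulting power of \<open>norm z\<close> is at most the square.\<close>
        define w where "w = (complex_of_real (r1 / norm z)) *s z"
        have w: "norm w \<le> r1" using False r1 by (simp add: w_def norm_vector_smult norm_divide)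
        have "z = complex_of_real (norm z / r1) *s w" using False r1 by (simp add: w_def vector_smult_assoc)
        then have "hom_part f k z = complex_of_real (norm z / r1) ^ k *s hom_part f k w"
          by (metis scale)
        then have "norm (hom_part f k z) = (norm z / r1) ^ k * norm (hom_part f k w)"
          using r1 by (simp add: norm_vector_smult norm_power norm_divide)
        also have "\<dots> \<le> (norm z / r1) ^ k * (CARD('m) * M)"
          using r1 by (intro mult_left_mono bound w) auto
        also have "\<dots> = CARD('m) * M / r1 ^ k * norm z ^ k" by (simp add: power_divide)
        also have "\<dots> \<le> CARD('m) * M / r1 ^ k * (norm z)\<^sup>2"
          using False z M(1) r1 by (intro mult_left_mono power_decreasing) auto
        finally show ?thesis .
      qed
    qed
  next
    fix z :: "complex ^ 'n" assume z: "z \<in> cball 0 r"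
    define w where "w = (complex_of_real (1 / lam)) *s z"
    have w: "norm w \<le> r1" "z = complex_of_real lam *s w"
      using z lam R r1 by (auto simp: w_def norm_vector_smult norm_divide vector_smult_assoc lam_def divide_simps mult_ac)
    have "q z = (\<Sum>k<N. complex_of_real lam ^ k *s hom_part f k w)"
      unfolding q_def w(2) scale ..
    then have "norm (f z - q z) \<le> CARD('m) * (M * norm (complex_of_real lam) ^ N / (1 - norm (complex_of_real lam)))"
      using tail[OF w(1), of "complex_of_real lam" N] lam by (simp add: w(2)[symmetric])
    then show "norm (f z - q z) \<le> e" using N lam by simp
  qed
qed

subsection \<open>Derivatives and inverses\<close>

text \<open>By the quadratic bound the difference quotients in direction \<open>v\<close> converge
  uniformly on smaller balls, and each of them is holomorphic in \<open>z\<close>.\<close>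

lemma hol_on_derivative:
  fixes F :: "complex ^ 'n \<Rightarrow> complex ^ 'm"
  assumes hol: "hol_on F unit_ball"
    and D: "\<And>z. z \<in> unit_ball \<Longrightarrow> (F has_derivative D z) (at z)"
      "\<And>z c v. z \<in> unit_ball \<Longrightarrow> D z (c *s v) = c *s D z v"
  shows "hol_on (\<lambda>z. D z v) unit_ball"
proof -
  have main: "hol_on (\<lambda>z. D z v) (ball 0 R)" if R: "0 < R" "R < 1" for R
  proof -
    define s where "s = (1 - R) / 2"
    have s: "s > 0" "R + s < 1" using R by (auto simp: s_def field_simps)
    have "cball 0 (R + s) \<subseteq> unit_ball" using s by auto
    from hol_on_bounded_cball[OF hol this]
    obtain M where M: "M > 0" "\<And>w. w \<in> cball 0 (R + s) \<Longrightarrow> norm (F w) \<le> M" by blast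
    define nv where "nv = norm v + 1"
    have nv: "nv > 0" "norm v \<le> nv" unfolding nv_def by (auto simp: add_nonneg_pos)
    \<comment> \<open>The step is scaled by \<open>nv > norm v\<close> so that every displacement
      has norm at most \<open>s / 2\<close>, as the quadratic bound demands; \<open>nv\<close> is
      positive even for \<open>v = 0\<close>.\<close>
    define c where "c m = s / (2 * nv) / (real m + 1)" for m :: nat
    have c: "c m > 0" for m using s nv by (simp add: c_def)
    have cv: "norm (c m *\<^sub>R v) \<le> s / 2" for m
    proof -
      have "norm (c m *\<^sub>R v) \<le> c m * nv" using c[of m] nv by (simp add: mult_left_mono)
      also have "\<dots> = s / 2 / (real m + 1)" using nv by (simp add: c_def)
      also have "\<dots> \<le> s / 2" using s by (simp add: divide_simps)
      finally show ?thesis .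
    qed
    define q where "q m z = (1 / c m) *\<^sub>R (F (z + c m *\<^sub>R v) - F z)" for m z
    have hq: "hol_on (q m) (ball 0 R)" for m
      unfolding q_def
    proof (intro hol_on_scaleR hol_on_diff)
      show "hol_on (\<lambda>z. F (z + c m *\<^sub>R v)) (ball 0 R)"
      proof (rule hol_on_compose[OF hol_on_add[OF hol_on_ident hol_on_const] hol])
        show "(\<lambda>z. z + c m *\<^sub>R v) ` ball 0 R \<subseteq> unit_ball"
        proof clarsimp
          fix x :: "complex ^ 'n" assume "norm x < R"
          then show "norm (x + c m *\<^sub>R v) < 1" using norm_triangle_ineq[of x "c m *\<^sub>R v"] cv[of m] s by simp
        qed
      qed
      show "hol_on F (ball 0 R)" by (rule hol_on_subset[OF hol]) (use R in auto)
    qed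
    have uq: "uniform_limit K q (\<lambda>z. D z v) sequentially" if K: "K \<subseteq> ball 0 R" for K
    proof (rule uniform_limitI_bound[where b = "\<lambda>m. c m * (2 * M / s\<^sup>2 * (norm v)\<^sup>2)"])
      have "norm (q m z - D z v) \<le> c m * (2 * M / s\<^sup>2 * (norm v)\<^sup>2)" if z: "z \<in> K" for m z
      proof -
        have zR: "norm z < R" using z K by auto
        then have zb: "z \<in> unit_ball" using R by simp
        have cb: "cball z s \<subseteq> cball 0 (R + s)"
        proof
          fix w assume "w \<in> cball z s"
          then show "w \<in> cball 0 (R + s)" using zR norm_triangle_ineq[of z "w - z"] by (simp add: dist_norm norm_minus_commute)
        qed
        have Dc: "D z (c m *\<^sub>R v) = c m *\<^sub>R D z v"
          using D(2)[OF zb, of "of_real (c m)" v] by (simp add: vector_smult_of_real)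
        have "norm (F (z + c m *\<^sub>R v) - F z - D z (c m *\<^sub>R v)) \<le> 2 * M / s\<^sup>2 * (norm (c m *\<^sub>R v))\<^sup>2"
          by (rule hol_on_quadratic_bound[OF hol _ s(1) _ D(1)[OF zb] D(2)[OF zb] cv])
             (use cb s M(2) in \<open>auto simp: subset_iff\<close>)
        also have "\<dots> = c m * (c m * (2 * M / s\<^sup>2 * (norm v)\<^sup>2))"
          by (simp add: power_mult_distrib power2_eq_square[of "c m"])
        finally have le: "norm (F (z + c m *\<^sub>R v) - F z - D z (c m *\<^sub>R v)) \<le> c m * (c m * (2 * M / s\<^sup>2 * (norm v)\<^sup>2))" .
        have "q m z - D z v = (1 / c m) *\<^sub>R (F (z + c m *\<^sub>R v) - F z - D z (c m *\<^sub>R v))"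
          unfolding q_def Dc using c[of m] by (simp add: scaleR_right_diff_distrib)
        then have "norm (q m z - D z v) = (1 / c m) * norm (F (z + c m *\<^sub>R v) - F z - D z (c m *\<^sub>R v))"
          using c[of m] by simp
        also have "\<dots> \<le> (1 / c m) * (c m * (c m * (2 * M / s\<^sup>2 * (norm v)\<^sup>2)))"
          using c[of m] by (intro mult_left_mono le) auto
        finally show ?thesis using c[of m] by simp
      qed
      then show "\<forall>\<^sub>F m in sequentially. \<forall>z\<in>K. norm (q m z - D z v) \<le> c m * (2 * M / s\<^sup>2 * (norm v)\<^sup>2)"
        by (intro always_eventually) blast
      have "c \<longlonglongrightarrow> 0" unfolding c_def
        using tendsto_mult_right_zero[OF LIMSEQ_ignore_initial_segment[OF lim_inverse_n', of 1],
            of "s / (2 * nv)"] by (simp only: of_nat_add of_nat_1 times_divide_eq_right mult_1_right)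
      from tendsto_mult_left_zero[OF this] show "(\<lambda>m. c m * (2 * M / s\<^sup>2 * (norm v)\<^sup>2)) \<longlonglongrightarrow> 0" .
    qed
    show ?thesis by (rule hol_on_uniform_limit[OF open_ball hq uq])
  qed
  show ?thesis
    unfolding hol_on_def
  proof
    fix z :: "complex ^ 'n" assume "z \<in> unit_ball"
    then have "norm z < 1" by simp
    then have "0 < (1 + norm z) / 2" "(1 + norm z) / 2 < 1" "z \<in> ball 0 ((1 + norm z) / 2)"
      by (auto simp: add_pos_nonneg)
    then show "\<exists>E. ((\<lambda>z. D z v) has_derivative E) (at z) \<and> (\<forall>c w. E (c *s w) = c *s E w)"
      using main unfolding hol_on_def by blast
  qed
qed

text \<open>Cramer's rule writes the solution as a quotient of determinants whose entries are
  holomorphic, with a denominator that vanishes nowhere because the derivatives are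
  injective.\<close>

lemma hol_on_solve_derivative:
  fixes F p :: "complex ^ 'n \<Rightarrow> complex ^ 'n"
  assumes hol: "hol_on F unit_ball"
    and D: "\<And>z. z \<in> unit_ball \<Longrightarrow> (F has_derivative D z) (at z)"
      "\<And>z c v. z \<in> unit_ball \<Longrightarrow> D z (c *s v) = c *s D z v"
    and inj: "\<And>z v. z \<in> unit_ball \<Longrightarrow> D z v = 0 \<Longrightarrow> v = 0"
    and p: "hol_on p unit_ball"
  obtains q where "hol_on q unit_ball" "\<And>z. z \<in> unit_ball \<Longrightarrow> D z (q z) = p z"
proof -
  define A where "A z = (\<chi> i j. D z (axis j 1) $ i)" for z
  have lin: "linear (D z)" if "z \<in> unit_ball" for z
    using D(1)[OF that] has_derivative_linear by blast
  have A: "A z *v w = D z w" if z: "z \<in> unit_ball" for z w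
  proof -
    have "D z w = D z (\<Sum>j\<in>UNIV. w $ j *s axis j 1)" by (simp add: basis_expansion)
    also have "\<dots> = (\<Sum>j\<in>UNIV. w $ j *s D z (axis j 1))"
      unfolding linear_sum[OF lin[OF z]] D(2)[OF z] ..
    finally show ?thesis by (simp add: A_def vec_eq_iff matrix_vector_mult_def mult.commute)
  qed
  have det: "det (A z) \<noteq> 0" if z: "z \<in> unit_ball" for z
  proof -
    have "inj ((*v) (A z))"
    proof (rule injI)
      fix x y assume "A z *v x = A z *v y"
      then have "D z (x - y) = 0" using A[OF z] linear_diff[OF lin[OF z]] by simp
      from inj[OF z this] show "x = y" by simp
    qed
    then show ?thesis
      using matrix_left_invertible_injective[of "A z"] invertible_left_inverse[of "A z"] invertible_det_nz[of "A z"] by blast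
  qed
  define q where "q z = (\<chi> k. det (\<chi> i j. if j = k then p z $ i else A z $ i $ j) * inverse (det (A z)))" for z
  have sA: "scalar_hol_on (\<lambda>z. A z $ i $ j) unit_ball" for i j
    unfolding A_def using scalar_hol_on_component[OF hol_on_derivative[OF hol D, of "axis j 1"], of i] by simp
  show ?thesis
  proof (rule that)
    show "hol_on q unit_ball"
    proof (rule hol_on_components)
      fix k
      have "scalar_hol_on (\<lambda>z. if j = k then p z $ i else A z $ i $ j) unit_ball" for i j
        using sA[of i j] scalar_hol_on_component[OF p, of i] by (cases "j = k") auto
      then have "scalar_hol_on (\<lambda>z. det (\<chi> i j. if j = k then p z $ i else A z $ i $ j)) unit_ball"
        by (intro scalar_hol_on_det) simp
      moreover have "scalar_hol_on (\<lambda>z. inverse (det (A z))) unit_ball"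
        by (intro scalar_hol_on_inverse scalar_hol_on_det sA det)
      ultimately show "scalar_hol_on (\<lambda>z. q z $ k) unit_ball"
        unfolding q_def by (simp add: scalar_hol_on_mult)
    qed
    show "D z (q z) = p z" if z: "z \<in> unit_ball" for z
    proof -
      have "A z *v q z = p z"
        unfolding cramer[OF det[OF z]] q_def by (simp add: divide_inverse)
      then show ?thesis using A[OF z] by simp
    qed
  qed
qed

text \<open>In equal finite dimensions injectivity of the derivative makes it invertible, and the
  inverse of a complex linear bijection is complex linear.\<close>

lemma hol_on_inverse:
  fixes f g :: "complex ^ 'n \<Rightarrow> complex ^ 'n"
  assumes S: "open S" and hol: "hol_on f S" and g: "\<And>z. z \<in> S \<Longrightarrow> g (f z) = z"
    and inj: "\<And>z D v. z \<in> S \<Longrightarrow> (f has_derivative D) (at z) \<Longrightarrow> D v = 0 \<Longrightarrow> v = 0"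
  shows "hol_on g (f ` S)"
  unfolding hol_on_def
proof clarify
  fix z assume z: "z \<in> S"
  obtain D where D: "(f has_derivative D) (at z)" "\<And>c v. D (c *s v) = c *s D v"
    using hol_onE[OF hol z] by blast
  have lin: "linear D" using D(1) has_derivative_linear by blast
  have inj_D: "inj D" using inj[OF z D(1)] linear_injective_0[OF lin] by blast
  then have "surj D" using linear_injective_imp_surjective[OF lin inj_D] by blast
  then have *: "D (inv D v) = v" for v by (rule surj_f_inv_f)
  have "(g has_derivative inv D) (at (f z))"
  proof (rule has_derivative_inverse_strong[OF S z hol_on_continuous_on[OF hol] g D(1)])
    show "D \<circ> inv D = id" using * by (auto simp: fun_eq_iff)
  qed
  moreover have "inv D (c *s v) = c *s inv D v" for c v
    by (rule injD[OF inj_D]) (simp add: D(2) *)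
  ultimately show "\<exists>E. (g has_derivative E) (at (f z)) \<and> (\<forall>c v. E (c *s v) = c *s E v)" by blast
qed

subsection \<open>Growth and distortion in the class M\<close>

text \<open>The Cayley transform \<open>\<omega> = (p - 1) / (p + 1)\<close> maps the right
  half-plane to the disc and fixes 0, so the Schwarz lemma gives
  \<open>norm (\<omega> z) \<le> norm z\<close>; solving for \<open>p\<close> yields both
  bounds.\<close>

lemma caratheodory_bounds:
  assumes hol: "p holomorphic_on ball 0 1" and p0: "p 0 = 1"
    and Re: "\<And>w. norm w < 1 \<Longrightarrow> Re (p w) \<ge> 0" and z: "norm z < 1"
  shows caratheodory_Re_ge: "Re (p z) \<ge> (1 - norm z) / (1 + norm z)"
    and caratheodory_norm_le: "norm (p z) \<le> (1 + norm z) / (1 - norm z)"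
proof -
  define \<omega> where "\<omega> w = (p w - 1) / (p w + 1)" for w
  have nz: "p w + 1 \<noteq> 0" if "norm w < 1" for w
  proof
    assume "p w + 1 = 0"
    then have "Re (p w) = -1" by (metis add_eq_0_iff2 uminus_complex.simps(1) one_complex.simps(1))
    then show False using Re[OF that] by simp
  qed
  have sq: "(cmod (p w + 1))\<^sup>2 - (cmod (p w - 1))\<^sup>2 = 4 * Re (p w)" for w
    unfolding cmod_power2 by (simp add: power2_eq_square algebra_simps)
  have \<omega>1: "norm (\<omega> w) \<le> 1" if "norm w < 1" for w
  proof -
    have "(cmod (p w - 1))\<^sup>2 \<le> (cmod (p w + 1))\<^sup>2" using sq[of w] Re[OF that] by linarith
    then have "cmod (p w - 1) \<le> cmod (p w + 1)" by (rule power2_le_imp_le) simp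
    then show ?thesis using nz[OF that] by (simp add: \<omega>_def norm_divide)
  qed
  \<comment> \<open>The Schwarz lemma wants values strictly inside the disc, while only
    \<open>norm (\<omega> w) \<le> 1\<close> is known; hence the factor
    \<open>s < 1\<close>.\<close>
  have \<omega>z: "norm (\<omega> z) \<le> norm z"
  proof (rule field_le_mult_one_interval)
    fix s :: real assume s: "0 < s" "s < 1"
    have "norm ((\<lambda>w. of_real s * \<omega> w) z) \<le> norm z"
    proof (rule Schwarz_Lemma(1)[OF _ _ _ z])
      show "(\<lambda>w. of_real s * \<omega> w) holomorphic_on ball 0 1"
        unfolding \<omega>_def using nz by (intro holomorphic_intros hol) auto
      show "norm (of_real s * \<omega> w) < 1" if "norm w < 1" for w
      proof -
        have "s * norm (\<omega> w) \<le> s * 1" using s \<omega>1[OF that] by (intro mult_left_mono) auto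
        then have "s * norm (\<omega> w) < 1" using s by linarith
        then show ?thesis using s by (simp add: norm_mult)
      qed
    qed (simp add: \<omega>_def p0)
    then show "s * norm (\<omega> z) \<le> norm z" using s by (simp add: norm_mult)
  qed
  define r where "r = norm z"
  have r: "0 \<le> r" "r < 1" using z by (auto simp: r_def)
  define a where "a = Re (p z)"
  have a: "a \<ge> 0" using Re[OF z] by (simp add: a_def)
  have "norm (p z - 1) = norm (\<omega> z) * norm (p z + 1)"
    using nz[OF z] by (simp add: \<omega>_def norm_divide)
  also have "\<dots> \<le> r * norm (p z + 1)" using \<omega>z by (intro mult_right_mono) (auto simp: r_def)
  finally have le: "norm (p z - 1) \<le> r * norm (p z + 1)" .
  have "norm (p z) \<le> 1 + norm (p z - 1)" using norm_triangle_ineq[of 1 "p z - 1"] by simp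
  also have "\<dots> \<le> 1 + r * (norm (p z) + 1)"
    using le norm_triangle_ineq[of "p z" 1] mult_left_mono[OF norm_triangle_ineq[of "p z" 1] r(1)] by simp
  finally have "norm (p z) * (1 - r) \<le> 1 + r" by (simp add: algebra_simps)
  then show "norm (p z) \<le> (1 + norm z) / (1 - norm z)" using r by (simp add: r_def pos_le_divide_eq)
  have "(cmod (p z - 1))\<^sup>2 \<le> (r * cmod (p z + 1))\<^sup>2" using le by (intro power_mono) auto
  then have "(a - 1)\<^sup>2 + (Im (p z))\<^sup>2 \<le> r\<^sup>2 * ((a + 1)\<^sup>2 + (Im (p z))\<^sup>2)"
    by (simp add: cmod_power2 power_mult_distrib a_def)
  moreover have "r\<^sup>2 * (Im (p z))\<^sup>2 \<le> 1 * (Im (p z))\<^sup>2"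
    using r by (intro mult_right_mono) (auto simp: power_le_one)
  ultimately have "(1 - a)\<^sup>2 \<le> (r * (a + 1))\<^sup>2"
    using distrib_left[of "r\<^sup>2" "(a + 1)\<^sup>2" "(Im (p z))\<^sup>2"]
    unfolding power_mult_distrib power2_commute[of 1 a] by linarith
  then have "1 - a \<le> r * (a + 1)" by (rule power2_le_imp_le) (use r a in auto)
  then have "1 - r \<le> a * (1 + r)" by (simp add: algebra_simps)
  then show "Re (p z) \<ge> (1 - norm z) / (1 + norm z)"
    using r by (simp add: r_def a_def pos_divide_le_eq add_pos_nonneg)
qed

lemma class_M_hol_on: "h \<in> class_M \<Longrightarrow> hol_on h unit_ball"
  by (auto simp: class_M_def Hol_iff)

lemma class_M_zero: "h \<in> class_M \<Longrightarrow> h 0 = 0"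
  by (simp add: class_M_def)

text \<open>On the complex line through \<open>z\<close>, with unit vector \<open>u\<close>, the
  function \<open>l \<mapsto> - hinner (h (l *s u)) u\<close> vanishes at 0 and equals
  \<open>l * p l\<close>. The normalisation of the derivative gives \<open>p 0 = 1\<close>, and
  \<open>hinner (h (l *s u)) (l *s u)\<close> is \<open>- (norm l)\<^sup>2 * p l\<close>, so
  \<open>p\<close> has nonnegative real part and the bounds above apply.\<close>

lemma class_M_hinner:
  fixes h :: "complex ^ 'n \<Rightarrow> complex ^ 'n"
  assumes h: "h \<in> class_M" and z: "norm z < 1"
  shows class_M_Re_hinner_le: "Re (hinner (h z) z) \<le> - (norm z)\<^sup>2 * ((1 - norm z) / (1 + norm z))"
    and class_M_norm_hinner_le: "norm (hinner (h z) z) \<le> (norm z)\<^sup>2 * ((1 + norm z) / (1 - norm z))"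
proof -
  have "Re (hinner (h z) z) \<le> - (norm z)\<^sup>2 * ((1 - norm z) / (1 + norm z)) \<and>
     norm (hinner (h z) z) \<le> (norm z)\<^sup>2 * ((1 + norm z) / (1 - norm z))"
  proof (cases "z = 0")
    case True
    then show ?thesis by (simp add: class_M_zero[OF h])
  next
    case False
    define u where "u = (1 / norm z) *\<^sub>R z"
    have u: "norm u = 1" "z = complex_of_real (norm z) *s u"
      using False by (simp_all add: u_def vector_smult_of_real)
    define g where "g l = - hinner (h (0 + l *s u)) u" for l
    have D: "(h has_derivative (\<lambda>v. - v)) (at 0)" using h by (simp add: class_M_def)
    have "g holomorphic_on ball 0 1"
      unfolding g_def
      by (intro holomorphic_intros hinner_slice_holomorphic[OF class_M_hol_on[OF h]])
         (use u in \<open>auto simp: norm_vector_smult\<close>)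
    moreover have g0: "g 0 = 0" by (simp add: g_def class_M_zero[OF h])
    ultimately obtain p where p: "p holomorphic_on ball 0 1" "\<And>l. norm l < 1 \<Longrightarrow> g l = l * p l"
      "deriv g 0 = p 0" using Schwarz3 by blast
    have "((\<lambda>l. hinner (h (0 + l *s u)) u) has_field_derivative hinner (- u) u) (at 0)"
      by (rule hinner_slice_derivative[where D = "\<lambda>v. - v"]) (use D in \<open>auto simp: vec_eq_iff\<close>)
    then have "(g has_field_derivative - hinner (- u) u) (at 0)"
      unfolding g_def by (rule DERIV_minus)
    then have "deriv g 0 = - hinner (- u) u" by (rule DERIV_imp_deriv)
    then have p0: "p 0 = 1"
      using p(3) u by (simp add: hinner_minus_left hinner_same)
    have key: "hinner (h (l *s u)) (l *s u) = - of_real ((norm l)\<^sup>2) * p l" if "norm l < 1" for l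
    proof -
      have "hinner (h (l *s u)) (l *s u) = - cnj l * g l" by (simp add: g_def hinner_smult_right)
      also have "\<dots> = - (l * cnj l) * p l" using p(2)[OF that] by simp
      finally show ?thesis by (simp only: complex_norm_square)
    qed
    have Re: "Re (p l) \<ge> 0" if l: "norm l < 1" for l
    proof (cases "l = 0")
      case False
      have "Re (hinner (h (l *s u)) (l *s u)) \<le> 0"
        using h l u by (simp add: class_M_def norm_vector_smult)
      then have "(norm l)\<^sup>2 * Re (p l) \<ge> 0" unfolding key[OF l] by simp
      then show ?thesis using False by (simp add: zero_le_mult_iff)
    qed (simp add: p0)
    have nz: "norm (complex_of_real (norm z)) = norm z" by simp
    have kz: "hinner (h z) z = - of_real ((norm z)\<^sup>2) * p (of_real (norm z))"
      using key[of "of_real (norm z)"] z u(2) by simp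
    have pz: "Re (p (of_real (norm z))) \<ge> (1 - norm z) / (1 + norm z)"
      "norm (p (of_real (norm z))) \<le> (1 + norm z) / (1 - norm z)"
      using caratheodory_bounds[OF p(1) p0 Re, of "of_real (norm z)"] z by simp_all
    have "Re (hinner (h z) z) = - (norm z)\<^sup>2 * Re (p (of_real (norm z)))"
      unfolding kz by simp
    moreover have "norm (hinner (h z) z) = (norm z)\<^sup>2 * norm (p (of_real (norm z)))"
      unfolding kz by (simp add: norm_mult norm_power)
    moreover have "(norm z)\<^sup>2 * ((1 - norm z) / (1 + norm z)) \<le> (norm z)\<^sup>2 * Re (p (of_real (norm z)))"
      "(norm z)\<^sup>2 * norm (p (of_real (norm z))) \<le> (norm z)\<^sup>2 * ((1 + norm z) / (1 - norm z))"
      by (intro mult_left_mono pz; simp)+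
    ultimately show ?thesis by linarith
  qed
  then show "Re (hinner (h z) z) \<le> - (norm z)\<^sup>2 * ((1 - norm z) / (1 + norm z))"
    "norm (hinner (h z) z) \<le> (norm z)\<^sup>2 * ((1 + norm z) / (1 - norm z))" by blast+
qed

text \<open>The numerical range bound controls the norm: on the circle of radius \<open>s\<close> the holomorphic
  function \<open>l \<mapsto> l \<langle>h (z + l e), z\<rangle> + s\<^sup>2 \<langle>h (z + l e), e\<rangle>\<close> equals \<open>l \<langle>h (z + l e), z + l e\<rangle>\<close>.\<close>

lemma class_M_norm_le:
  fixes h :: "complex ^ 'n \<Rightarrow> complex ^ 'n"
  assumes r: "0 \<le> r" "r < 1" and h: "h \<in> class_M" and z: "norm z \<le> r"
  shows "norm (h z) \<le> 8 / (1 - r)\<^sup>2"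
proof (cases "h z = 0")
  case False
  define s where "s = (1 - r) / 2"
  have s: "s > 0" "r + s < 1" "1 - (r + s) = s" using r by (auto simp: s_def field_simps)
  define e where "e = (1 / norm (h z)) *\<^sub>R h z"
  have e: "norm e = 1" using False by (simp add: e_def)
  define F where "F l = l * hinner (h (z + l *s e)) z + of_real (s\<^sup>2) * hinner (h (z + l *s e)) e" for l
  have inb: "norm (z + l *s e) \<le> r + s" if "norm l \<le> s" for l
    using norm_triangle_ineq[of z "l *s e"] z that e by (simp add: norm_vector_smult)
  have hF: "F holomorphic_on cball 0 s"
    unfolding F_def
    by (intro holomorphic_intros hinner_slice_holomorphic[OF class_M_hol_on[OF h]])
       (use inb s in force)+
  \<comment> \<open>For order 0 the Cauchy inequality is the maximum principle. The unit vector
    \<open>e\<close> points along \<open>h z\<close>, which makes \<open>F 0\<close> equal to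
    \<open>s\<^sup>2 * norm (h z)\<close>.\<close>
  have "norm ((deriv ^^ 0) F 0) \<le> fact 0 * (s * (2 / s)) / s ^ 0"
  proof (rule Cauchy_inequality)
    show "F holomorphic_on ball 0 s" using hF by (rule holomorphic_on_subset) auto
    fix l :: complex assume "norm (0 - l) = s"
    then have l: "norm l = s" by simp
    define w where "w = z + l *s e"
    have "of_real (s\<^sup>2) = l * cnj l" using l complex_norm_square[of l] by simp
    then have "F l = l * hinner (h w) w"
      by (simp add: F_def w_def hinner_add_right hinner_smult_right algebra_simps)
    moreover have "norm (hinner (h w) w) \<le> 2 / s"
    proof -
      have nw: "norm w \<le> r + s" using inb[of l] l by (simp add: w_def)
      then have "norm (hinner (h w) w) \<le> (norm w)\<^sup>2 * ((1 + norm w) / (1 - norm w))"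
        using class_M_norm_hinner_le[OF h, of w] s by linarith
      also have "\<dots> \<le> 1 * (2 / s)"
        using nw s by (intro mult_mono frac_le) (auto simp: power_le_one)
      finally show ?thesis by simp
    qed
    ultimately show "norm (F l) \<le> s * (2 / s)"
      using l s by (simp only: norm_mult mult_left_mono)
  qed (use hF s in \<open>auto intro: holomorphic_on_imp_continuous_on\<close>)
  then have "norm (F 0) \<le> 2" using s by simp
  moreover have "F 0 = of_real (s\<^sup>2 * norm (h z))"
    using False by (simp add: F_def e_def hinner_scaleR_right hinner_same power2_eq_square)
  then have "norm (F 0) = s\<^sup>2 * norm (h z)" by (simp only: norm_of_real) simp
  ultimately have "s\<^sup>2 * norm (h z) \<le> 2" by simp
  then have "norm (h z) \<le> 2 / s\<^sup>2" using s by (simp add: pos_le_divide_eq mult.commute)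
  also have "2 / s\<^sup>2 = 8 / (1 - r)\<^sup>2" by (simp add: s_def power_divide)
  finally show ?thesis .
qed (use r in simp)

text \<open>The map \<open>h + id\<close> vanishes to order two at 0 with a bound uniform over the
  class, so its derivative is of the size of the argument. The resulting factor
  \<open>max (norm x) (norm y)\<close> decays along solutions, which makes the nonlinear part of the
  evolution integrable over the half-line.\<close>

lemma class_M_distortion:
  assumes r: "0 < r" "r < 1"
  shows "\<exists>C\<ge>0. \<forall>h\<in>(class_M :: (complex ^ 'n \<Rightarrow> complex ^ 'n) set). \<forall>x\<in>cball 0 r. \<forall>y\<in>cball 0 r.
      norm (h x + x - (h y + y)) \<le> C * max (norm x) (norm y) * norm (x - y)"
proof -
  define r2 where "r2 = (1 + r) / 2"
  have r2: "0 < r2" "r2 < 1" "r < r2" using r by (auto simp: r2_def)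
  define B where "B = 8 / (1 - r2)\<^sup>2 + 1"
  \<comment> \<open>With this constant one quadratic bound covers the whole ball of radius
    \<open>r2\<close>: below \<open>r2 / 2\<close> it follows from the Taylor remainder, above it
    from the plain bound \<open>B\<close>.\<close>
  define C1 where "C1 = 4 * B / r2\<^sup>2"
  define C where "C = 8 * C1 / (1 - r)"
  have B: "B > 0" unfolding B_def by (intro add_nonneg_pos) auto
  have C1: "C1 > 0" using B r2 by (simp add: C1_def)
  have C: "C > 0" using C1 r by (simp add: C_def)
  have "norm (h x + x - (h y + y)) \<le> C * max (norm x) (norm y) * norm (x - y)"
    if h: "h \<in> class_M" and x: "x \<in> cball 0 r" and y: "y \<in> cball 0 r" for h :: "complex ^ 'n \<Rightarrow> complex ^ 'n" and x y
  proof -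
    define g where "g w = h w + w" for w
    have hg: "hol_on g unit_ball" unfolding g_def by (intro hol_on_add class_M_hol_on[OF h] hol_on_ident)
    have gB: "norm (g w) \<le> B" if "norm w \<le> r2" for w
      using norm_triangle_ineq[of "h w" w] class_M_norm_le[OF _ r2(2) h that] r2 that
      by (simp add: g_def B_def)
    have D0: "(g has_derivative (\<lambda>v. 0)) (at 0)"
    proof -
      have "(h has_derivative (\<lambda>v. - v)) (at 0)" using h by (simp add: class_M_def)
      from has_derivative_add[OF this has_derivative_ident] show ?thesis by (simp add: g_def[abs_def])
    qed
    have g0: "g 0 = 0" by (simp add: g_def class_M_zero[OF h])
    have quad: "norm (g v) \<le> C1 * (norm v)\<^sup>2" if v: "norm v \<le> r2" for v
    proof (cases "norm v \<le> r2 / 2")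
      case True
      have "norm (g (0 + v) - g 0 - 0) \<le> 2 * B / r2\<^sup>2 * (norm v)\<^sup>2"
        by (rule hol_on_quadratic_bound[OF hg _ r2(1) _ D0 _ True]) (use r2 gB in auto)
      also have "\<dots> \<le> C1 * (norm v)\<^sup>2" unfolding C1_def using B r2
        by (intro mult_right_mono divide_right_mono) auto
      finally show ?thesis by (simp add: g0)
    next
      case False
      then have "(r2 / 2)\<^sup>2 \<le> (norm v)\<^sup>2" using r2 by (intro power_mono) auto
      then have "C1 * (r2 / 2)\<^sup>2 \<le> C1 * (norm v)\<^sup>2" using C1 by (intro mult_left_mono) auto
      moreover have "C1 * (r2 / 2)\<^sup>2 = B" using r2 by (simp add: C1_def power_divide)
      ultimately show ?thesis using gB[OF v] by linarith
    qed
    define m where "m = max (norm x) (norm y)"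
    have m: "m \<le> r" "0 \<le> m" using x y by (auto simp: m_def le_max_iff_disj)
    have "\<exists>D. (g has_derivative D) (at z) \<and> onorm D \<le> C * m" if z: "z \<in> cball 0 m" for z
    proof -
      have zm: "norm z \<le> m" using z by simp
      have zb: "z \<in> unit_ball" using zm m r by simp
      obtain D where D: "(g has_derivative D) (at z)" "\<And>c v. D (c *s v) = c *s D v"
        using hol_onE[OF hg zb] by blast
      have "norm (D v) \<le> C * m * norm v" for v
      proof (cases "z = 0")
        case True
        then have "D = (\<lambda>v. 0)" using D(1) D0 has_derivative_unique by blast
        then show ?thesis using C m by simp
      next
        case False
        \<comment> \<open>A radius proportional to \<open>norm z\<close>: on
          \<open>cball z s\<close> the map is of size \<open>(norm z)\<^sup>2\<close>, so the Cauchy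
          estimate leaves a derivative linear in \<open>norm z\<close>. The factor
          \<open>(1 - r) / 2\<close> keeps the ball within radius \<open>r2\<close>.\<close>
        define s where "s = norm z * (1 - r) / 2"
        have s: "s > 0" using False r by (simp add: s_def)
        have "s \<le> 1 * (1 - r) / 2" unfolding s_def using zb r by (intro divide_right_mono mult_right_mono) auto
        then have s1: "norm z + s \<le> r2" using zm m by (simp add: r2_def)
        have "s \<le> norm z * 2 / 2" unfolding s_def using r by (intro divide_right_mono mult_left_mono) auto
        then have s2: "norm z + s \<le> 2 * norm z" by simp
        have cb: "norm w \<le> norm z + s" if "w \<in> cball z s" for w
          using that norm_triangle_ineq[of z "w - z"] by (simp add: dist_norm norm_minus_commute)
        have "norm (D v) \<le> (C1 * (2 * norm z)\<^sup>2) / s * norm v"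
        proof (rule cauchy_estimate_derivative[OF hg _ s _ D])
          show "cball z s \<subseteq> unit_ball" using cb s1 r2 by fastforce
          show "norm (g w) \<le> C1 * (2 * norm z)\<^sup>2" if "w \<in> cball z s" for w
          proof -
            have "norm (g w) \<le> C1 * (norm w)\<^sup>2" using quad cb[OF that] s1 by simp
            also have "\<dots> \<le> C1 * (2 * norm z)\<^sup>2"
              using cb[OF that] s2 C1 by (intro mult_left_mono power_mono) auto
            finally show ?thesis .
          qed
        qed
        also have "(C1 * (2 * norm z)\<^sup>2) / s = C * norm z"
          using False r by (simp add: s_def C_def power2_eq_square divide_simps)
        also have "C * norm z * norm v \<le> C * m * norm v"
          using C zm by (intro mult_right_mono mult_left_mono) auto
        finally show ?thesis .
      qed
      then show ?thesis using D(1) onorm_bound[of "C * m" D] C m by auto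
    qed
    then obtain D where "\<And>z. z \<in> cball 0 m \<Longrightarrow> (g has_derivative D z) (at z)"
      "\<And>z. z \<in> cball 0 m \<Longrightarrow> onorm (D z) \<le> C * m" by metis
    then have "norm (g x - g y) \<le> C * m * norm (x - y)"
      by (intro differentiable_bound[of "cball 0 m" g D])
         (auto simp: m_def intro: has_derivative_at_withinI)
    then show ?thesis by (simp add: g_def m_def)
  qed
  then show ?thesis using C by (intro exI[of _ C]) auto
qed

subsection \<open>Solutions of the evolution equation\<close>

text \<open>Every Herglotz vector field can be changed on a null set of times, by \<open>- z\<close>, so that it
  belongs to the class at all times; the evolution remains the same.\<close>

definition nice_field :: "(complex ^ 'n \<Rightarrow> real \<Rightarrow> complex ^ 'n) \<Rightarrow> bool" where
  "nice_field G \<longleftrightarrow> (\<forall>t. (\<lambda>z\<in>unit_ball. G z t) \<in> class_M) \<and>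
     (\<forall>z\<in>unit_ball. G z \<in> borel_measurable lebesgue)"

text \<open>Lipschitz continuity replaces absolute continuity: solutions stay in a compact ball on
  which the field is bounded, and Lipschitz curves are easy to multiply. Absolutely continuous
  solutions are brought to this form in \<open>evolution_eq_ev\<close>.\<close>

definition solves :: "(complex ^ 'n \<Rightarrow> real \<Rightarrow> complex ^ 'n) \<Rightarrow> real \<Rightarrow> (real \<Rightarrow> complex ^ 'n) \<Rightarrow> bool" where
  "solves G b x \<longleftrightarrow> (\<exists>C. C-lipschitz_on {0..b} x) \<and> (\<forall>t\<in>{0..b}. x t \<in> unit_ball) \<and>
     (\<exists>N. negligible N \<and> (\<forall>t\<in>{0<..<b} - N. (x has_vector_derivative G (x t) t) (at t)))"

text \<open>The distortion constant is uniform over the class, hence over all times and all nice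
  fields. Naming it lets a field, its time shifts and its variations share one value; the type
  argument carries the dimension.\<close>

definition field_const :: "(complex ^ 'n) itself \<Rightarrow> real \<Rightarrow> real" where
  "field_const _ r = (SOME C. C \<ge> 0 \<and> (\<forall>h\<in>(class_M :: (complex ^ 'n \<Rightarrow> complex ^ 'n) set).
      \<forall>x\<in>cball 0 r. \<forall>y\<in>cball 0 r. norm (h x + x - (h y + y)) \<le> C * max (norm x) (norm y) * norm (x - y)))"

lemma field_const:
  assumes "0 < r" "r < 1"
  shows "field_const TYPE(complex ^ 'n) r \<ge> 0"
    and "\<And>h x y. \<lbrakk>h \<in> class_M; norm x \<le> r; norm y \<le> r\<rbrakk> \<Longrightarrow>
      norm (h x + x - (h y + y)) \<le> field_const TYPE(complex ^ 'n) r * max (norm x) (norm y) * norm (x - (y :: complex ^ 'n))"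
proof -
  have *: "field_const TYPE(complex ^ 'n) r \<ge> 0 \<and> (\<forall>h\<in>(class_M :: (complex ^ 'n \<Rightarrow> complex ^ 'n) set).
      \<forall>x\<in>cball 0 r. \<forall>y\<in>cball 0 r.
      norm (h x + x - (h y + y)) \<le> field_const TYPE(complex ^ 'n) r * max (norm x) (norm y) * norm (x - y))"
    unfolding field_const_def by (rule someI_ex[OF class_M_distortion[OF assms]])
  from * show "field_const TYPE(complex ^ 'n) r \<ge> 0" by blast
  show "norm (h x + x - (h y + y)) \<le> field_const TYPE(complex ^ 'n) r * max (norm x) (norm y) * norm (x - y)"
    if "h \<in> class_M" "norm x \<le> r" "norm y \<le> r" for h :: "complex ^ 'n \<Rightarrow> complex ^ 'n" and x y
    using * that by simp
qed

lemma class_M_Re_inner_le: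
  assumes "h \<in> class_M" "norm z < 1"
  shows "z \<bullet> h z \<le> - (norm z)\<^sup>2 * ((1 - norm z) / (1 + norm z))"
  using class_M_Re_hinner_le[OF assms] by (simp add: Re_hinner inner_commute)

context
  fixes G :: "complex ^ 'n \<Rightarrow> real \<Rightarrow> complex ^ 'n"
  assumes nice: "nice_field G"
begin

lemma nice_field_inner:
  assumes "norm z < 1"
  shows "z \<bullet> G z t \<le> - (norm z)\<^sup>2 * ((1 - norm z) / (1 + norm z))"
proof -
  have "(\<lambda>z\<in>unit_ball. G z t) \<in> class_M" using nice by (simp add: nice_field_def)
  from class_M_Re_inner_le[OF this assms] show ?thesis using assms by simp
qed

lemma nice_field_inner_nonpos:
  assumes "norm z < 1"
  shows "z \<bullet> G z t \<le> 0"
proof -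
  have "(norm z)\<^sup>2 * ((1 - norm z) / (1 + norm z)) \<ge> 0" using assms by (simp add: add_nonneg_nonneg)
  then show ?thesis using nice_field_inner[OF assms, of t] by linarith
qed

context
  fixes r C :: real
  assumes r: "0 < r" "r < 1" and C_def: "C = field_const TYPE(complex ^ 'n) r"
begin

lemma field_const_nonneg: "C \<ge> 0" using field_const(1)[OF r, where 'n = 'n] by (simp add: C_def)

lemma nice_field_distortion:
  assumes "norm x \<le> r" "norm y \<le> r"
  shows "norm (G x t + x - (G y t + y)) \<le> C * max (norm x) (norm y) * norm (x - y)"
proof -
  have "(\<lambda>z\<in>unit_ball. G z t) \<in> class_M" using nice by (simp add: nice_field_def)
  from field_const(2)[OF r this assms] show ?thesis using assms r by (simp add: C_def)
qed

lemma nice_field_quadratic: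
  assumes "norm x \<le> r"
  shows "norm (G x t + x) \<le> C * (norm x)\<^sup>2"
proof -
  have "(\<lambda>z\<in>unit_ball. G z t) \<in> class_M" using nice by (simp add: nice_field_def)
  from class_M_zero[OF this] have "G 0 t = 0" by simp
  then show ?thesis
    using nice_field_distortion[OF assms, of 0 t] r by (simp add: power2_eq_square mult.assoc)
qed

lemma nice_field_lipschitz:
  assumes "norm x \<le> r" "norm y \<le> r"
  shows "norm (G x t - G y t) \<le> (C + 1) * norm (x - y)"
proof -
  have "norm (G x t - G y t) = norm ((G x t + x - (G y t + y)) - (x - y))" by simp
  also have "\<dots> \<le> norm (G x t + x - (G y t + y)) + norm (x - y)" by (rule norm_triangle_ineq4)
  also have "\<dots> \<le> C * 1 * norm (x - y) + norm (x - y)"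
  proof (intro add_right_mono order_trans[OF nice_field_distortion[OF assms]] mult_right_mono mult_left_mono)
    show "max (norm x) (norm y) \<le> 1" using assms r by simp
  qed (use field_const_nonneg in auto)
  finally show ?thesis by (simp add: algebra_simps)
qed

lemma nice_field_bound:
  assumes "norm x \<le> r"
  shows "norm (G x t) \<le> C + 1"
proof -
  have "(\<lambda>z\<in>unit_ball. G z t) \<in> class_M" using nice by (simp add: nice_field_def)
  from class_M_zero[OF this] have "G 0 t = 0" by simp
  then have "norm (G x t) \<le> (C + 1) * norm x"
    using nice_field_lipschitz[OF assms, of 0 t] r by simp
  also have "\<dots> \<le> (C + 1) * 1" using field_const_nonneg assms r by (intro mult_left_mono) auto
  finally show ?thesis by simp
qed

text \<open>Replacing \<open>u\<close> by its values at the grid points below \<open>s\<close>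
  leaves countably many measurable pieces, and the Lipschitz bound in the space variable makes these
  approximations converge pointwise.\<close>

lemma nice_field_measurable_compose:
  assumes u: "continuous_on UNIV u" "\<And>s. norm (u s) \<le> r"
  shows "(\<lambda>s. G (u s) s) \<in> borel_measurable lebesgue"
proof (rule borel_measurable_LIMSEQ_metric)
  define v where "v k s = of_int \<lfloor>s * real (Suc k)\<rfloor> / real (Suc k)" for k and s :: real
  show "(\<lambda>s. G (u (v k s)) s) \<in> borel_measurable lebesgue" for k
    unfolding v_def
  proof (rule measurable_compose_countable'[where f = "\<lambda>j s. G (u (of_int j / real (Suc k))) s" and I = UNIV])
    show "(\<lambda>s. G (u (of_int j / real (Suc k))) s) \<in> borel_measurable lebesgue" for j
    proof -
      have "u (of_int j / real (Suc k)) \<in> unit_ball" using u(2)[of "of_int j / real (Suc k)"] r by simp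
      then show ?thesis using nice by (simp add: nice_field_def)
    qed
    have "(\<lambda>s. \<lfloor>s * real (Suc k)\<rfloor>) \<in> measurable borel (count_space UNIV)" by measurable
    then show "(\<lambda>s. \<lfloor>s * real (Suc k)\<rfloor>) \<in> measurable lebesgue (count_space UNIV)"
      by (intro measurable_completion) simp
  qed simp
  fix s :: real
  have "(\<lambda>k. v k s) \<longlonglongrightarrow> s"
  proof (rule LIMSEQ_I)
    fix e :: real assume "e > 0"
    then obtain n where n: "inverse (real (Suc n)) < e" using reals_Archimedean by blast
    have "norm (v k s - s) < e" if "k \<ge> n" for k
    proof -
      have "\<bar>v k s - s\<bar> = \<bar>of_int \<lfloor>s * real (Suc k)\<rfloor> - s * real (Suc k)\<bar> / real (Suc k)"
      proof -
        have "v k s - s = (of_int \<lfloor>s * real (Suc k)\<rfloor> - s * real (Suc k)) / real (Suc k)"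
          by (simp add: v_def diff_divide_distrib del: of_nat_Suc)
        then show ?thesis by (simp add: abs_divide del: of_nat_Suc)
      qed
      also have "\<dots> \<le> 1 / real (Suc k)"
        by (intro divide_right_mono) linarith+
      also have "\<dots> \<le> 1 / real (Suc n)" using that by (intro divide_left_mono) auto
      finally show ?thesis using n by (simp add: inverse_eq_divide)
    qed
    then show "\<exists>n. \<forall>k\<ge>n. norm (v k s - s) < e" by blast
  qed
  then have lim: "(\<lambda>k. u (v k s)) \<longlonglongrightarrow> u s"
    using u(1) by (metis UNIV_I continuous_on_tendsto_compose eventually_sequentiallyI)
  have "(\<lambda>k. G (u (v k s)) s - G (u s) s) \<longlonglongrightarrow> 0"
  proof (rule Lim_null_comparison)
    show "\<forall>\<^sub>F k in sequentially. norm (G (u (v k s)) s - G (u s) s) \<le> (C + 1) * norm (u (v k s) - u s)"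
      by (intro always_eventually allI nice_field_lipschitz u)
    show "(\<lambda>k. (C + 1) * norm (u (v k s) - u s)) \<longlonglongrightarrow> 0"
      using lim by (intro tendsto_mult_right_zero tendsto_norm_zero) (simp add: LIM_zero)
  qed
  then show "(\<lambda>k. G (u (v k s)) s) \<longlonglongrightarrow> G (u s) s" by (simp add: LIM_zero_cancel)
qed

end
end

lemma solves_norm_antimono:
  assumes G: "nice_field G" and x: "solves G b x" and st: "0 \<le> s" "s \<le> t" "t \<le> b"
  shows "norm (x t) \<le> norm (x s)"
proof -
  obtain L N where L: "L-lipschitz_on {0..b} x" "\<forall>t\<in>{0..b}. x t \<in> unit_ball" "negligible N"
   "\<forall>t\<in>{0<..<b} - N. (x has_vector_derivative G (x t) t) (at t)"
    using x unfolding solves_def by blast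
  have "(norm (x t))\<^sup>2 \<le> exp (0 - 0) * (norm (x s))\<^sup>2"
  proof (rule gronwall_lipschitz_le[where \<kappa> = "\<lambda>_. 0" and x' = "\<lambda>t. G (x t) t" and N = N])
    show "\<exists>C. C-lipschitz_on {s..t} x" using lipschitz_on_subset[OF L(1), of "{s..t}"] st by auto
    show "(x has_vector_derivative G (x u) u) (at u)" if "u \<in> {s<..<t} - N" for u using L(4) that st by auto
    show "2 * (x u \<bullet> G (x u) u) \<le> 0 * (norm (x u))\<^sup>2" if "u \<in> {s<..<t} - N" for u
    proof -
      have "x u \<in> unit_ball" using L(2) that st by simp
      then show ?thesis using nice_field_inner_nonpos[OF G, of "x u" u] by simp
    qed
  qed (use L st in \<open>auto intro!: derivative_eq_intros\<close>)
  then show ?thesis by (simp add: power2_le_iff_abs_le)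
qed

text \<open>Norms do not increase along solutions, so both curves stay in the ball of radius
  \<open>r\<close> and one Lipschitz constant serves for all times. Used with the opposite sign it
  gives the lower bound, the source of injectivity of the flow maps and of their
  derivatives.\<close>

lemma solves_bilipschitz:
  fixes G :: "complex ^ 'n \<Rightarrow> real \<Rightarrow> complex ^ 'n"
  assumes G: "nice_field G" and x: "solves G b x" and y: "solves G b y" and t: "0 \<le> t" "t \<le> b"
    and r: "0 < r" "r < 1" "norm (x 0) \<le> r" "norm (y 0) \<le> r"
    and L_def: "L = field_const TYPE(complex ^ 'n) r + 1"
  shows solves_lipschitz: "norm (x t - y t) \<le> exp (L * t) * norm (x 0 - y 0)"
    and solves_lipschitz_lower: "norm (x t - y t) \<ge> exp (- L * t) * norm (x 0 - y 0)"
proof -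
  obtain Lx N where X: "Lx-lipschitz_on {0..b} x" "\<forall>t\<in>{0..b}. x t \<in> unit_ball" "negligible N"
   "\<forall>t\<in>{0<..<b} - N. (x has_vector_derivative G (x t) t) (at t)"
    using x unfolding solves_def by blast
  obtain Ly N' where Y: "Ly-lipschitz_on {0..b} y" "\<forall>t\<in>{0..b}. y t \<in> unit_ball" "negligible N'"
   "\<forall>t\<in>{0<..<b} - N'. (y has_vector_derivative G (y t) t) (at t)"
    using y unfolding solves_def by blast
  define d where "d t = x t - y t" for t
  have lip: "\<exists>C. C-lipschitz_on {0..t} d"
    unfolding d_def using lipschitz_on_subset[OF lipschitz_on_diff[OF X(1) Y(1)], of "{0..t}"] t by auto
  have der: "(d has_vector_derivative G (x u) u - G (y u) u) (at u)" if "u \<in> {0<..<t} - (N \<union> N')" for u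
    unfolding d_def using X(4) Y(4) that t by (intro has_vector_derivative_diff) auto
  have bd: "\<bar>d u \<bullet> (G (x u) u - G (y u) u)\<bar> \<le> L * (norm (d u))\<^sup>2" if "u \<in> {0<..<t} - (N \<union> N')" for u
  proof -
    have "norm (x u) \<le> r" "norm (y u) \<le> r"
      using solves_norm_antimono[OF G x, of 0 u] solves_norm_antimono[OF G y, of 0 u] that t r by auto
    then have "norm (G (x u) u - G (y u) u) \<le> L * norm (d u)"
      using nice_field_lipschitz[OF G r(1,2) refl] by (simp add: L_def d_def)
    then have "norm (d u) * norm (G (x u) u - G (y u) u) \<le> norm (d u) * (L * norm (d u))"
      by (intro mult_left_mono) auto
    then show ?thesis using Cauchy_Schwarz_ineq2[of "d u" "G (x u) u - G (y u) u"]
      by (simp add: power2_eq_square mult_ac)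
  qed
  have neg: "negligible (N \<union> N')" using X Y by simp
  have "(norm (d t))\<^sup>2 \<le> exp (2 * L * t - 2 * L * 0) * (norm (d 0))\<^sup>2"
    by (rule gronwall_lipschitz_le[OF t(1) lip neg der, where \<kappa> = "\<lambda>_. 2 * L"])
       (use bd in \<open>force intro!: derivative_eq_intros\<close>)+
  also have "\<dots> = (exp (L * t) * norm (d 0))\<^sup>2"
    by (simp add: power_mult_distrib exp_double[symmetric] mult.assoc)
  finally show "norm (x t - y t) \<le> exp (L * t) * norm (x 0 - y 0)"
    unfolding d_def by (rule power2_le_imp_le) simp
  have "exp (- 2 * L * t - (- 2 * L * 0)) * (norm (d 0))\<^sup>2 \<le> (norm (d t))\<^sup>2"
    by (rule gronwall_lipschitz_ge[OF t(1) lip neg der, where \<kappa> = "\<lambda>_. - 2 * L"])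
       (use bd in \<open>force intro!: derivative_eq_intros\<close>)+
  moreover have "exp (- 2 * L * t - (- 2 * L * 0)) * (norm (d 0))\<^sup>2 = (exp (- L * t) * norm (d 0))\<^sup>2"
    using exp_double[of "- L * t"] by (simp add: power_mult_distrib mult.assoc)
  ultimately have "(exp (- L * t) * norm (d 0))\<^sup>2 \<le> (norm (d t))\<^sup>2" by simp
  then show "norm (x t - y t) \<ge> exp (- L * t) * norm (x 0 - y 0)"
    unfolding d_def by (rule power2_le_imp_le) simp
qed

lemma solves_unique:
  fixes G :: "complex ^ 'n \<Rightarrow> real \<Rightarrow> complex ^ 'n"
  assumes G: "nice_field G" and x: "solves G b x" and y: "solves G b y" and t: "0 \<le> t" "t \<le> b" and eq: "x 0 = y 0"
  shows "x t = y t"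
proof -
  have "x 0 \<in> unit_ball" using x t by (auto simp: solves_def)
  then have n: "norm (x 0) < 1" by simp
  define r where "r = (norm (x 0) + 1) / 2"
  have r: "0 < r" "r < 1" "norm (x 0) \<le> r" "norm (y 0) \<le> r"
    using n eq by (auto simp: r_def add_nonneg_pos)
  from solves_lipschitz[OF G x y t r refl] show ?thesis by (simp add: eq)
qed

lemma radial_projection:
  fixes x :: "'a::euclidean_space"
  assumes r: "0 < r"
  shows "norm x > r \<Longrightarrow> closest_point (cball 0 r) x = (r / norm x) *\<^sub>R x"
    and "norm (closest_point (cball 0 r) x) \<le> r"
proof -
  show "norm (closest_point (cball 0 r) x) \<le> r"
    using closest_point_in_set[of "cball (0::'a) r" x] r by auto
  assume x: "norm x > r"
  have n: "norm x > 0" using x r by linarith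
  show "closest_point (cball 0 r) x = (r / norm x) *\<^sub>R x"
  proof (rule closest_point_unique[symmetric])
    show "\<forall>z\<in>cball 0 r. dist x ((r / norm x) *\<^sub>R x) \<le> dist x z"
    proof
      fix z :: 'a assume z: "z \<in> cball 0 r"
      have "dist x ((r / norm x) *\<^sub>R x) = norm ((1 - r / norm x) *\<^sub>R x)"
        by (simp add: dist_norm scaleR_left_diff_distrib)
      also have "\<dots> = (1 - r / norm x) * norm x" using x n r by simp
      also have "\<dots> = norm x - r" using n by (simp add: left_diff_distrib)
      also have "\<dots> \<le> norm x - norm z" using z by simp
      also have "\<dots> \<le> dist x z" unfolding dist_norm by (rule norm_triangle_ineq2)
      finally show "dist x ((r / norm x) *\<^sub>R x) \<le> dist x z" .
    qed
  qed (use r n in auto)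
qed

lemma closest_point_cball_lipschitz:
  fixes x y :: "'a::euclidean_space"
  assumes "0 < r"
  shows "norm (closest_point (cball 0 r) x - closest_point (cball 0 r) y) \<le> norm (x - y)"
  using closest_point_lipschitz[of "cball (0::'a) r" x y] assms by (simp add: dist_norm)

text \<open>Picard iteration for the field composed with the projection onto a closed ball, where it is
  Lipschitz; the weight \<open>exp (2 L s)\<close> makes the iteration a contraction on the whole half-line, and since
  \<open>norm (x s)\<close> decreases the solution never meets the projection.\<close>

lemma solution_exists:
  fixes G :: "complex ^ 'n \<Rightarrow> real \<Rightarrow> complex ^ 'n"
  assumes G: "nice_field G" and z: "norm z < 1"
  shows "\<exists>x. x 0 = z \<and> (\<forall>b\<ge>0. solves G b x)"
proof -
  define r where "r = (norm z + 1) / 2"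
  have r: "0 < r" "r < 1" "norm z < r" using z by (auto simp: r_def add_nonneg_pos)
  define L where "L = field_const TYPE(complex ^ 'n) r + 1"
  have L: "L > 0" using field_const_nonneg[OF G r(1,2) refl] by (simp add: L_def)
  define P where "P = closest_point (cball (0 :: complex ^ 'n) r)"
  have P: "norm (P v) \<le> r" "norm (P v - P w) \<le> norm (v - w)" for v w
    unfolding P_def using radial_projection(2)[OF r(1)] closest_point_cball_lipschitz[OF r(1)] by auto
  define E where "E s = exp (2 * L * s)" for s :: real
  define g where "g y s = G (P (E s *\<^sub>R apply_bcontfun y s)) s" for y s
  have g_meas: "g y \<in> borel_measurable lebesgue" for y
    unfolding g_def
  proof (rule nice_field_measurable_compose[OF G r(1,2) refl _ P(1)])
    have "continuous_on UNIV P"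
      unfolding P_def by (rule continuous_on_closest_point) (use r in auto)
    moreover have "continuous_on UNIV (\<lambda>s. E s *\<^sub>R apply_bcontfun y s)"
      unfolding E_def by (intro continuous_intros continuous_on_apply_bcontfun)
    ultimately show "continuous_on UNIV (\<lambda>s. P (E s *\<^sub>R apply_bcontfun y s))"
      by (rule continuous_on_compose2) auto
  qed
  have g_bd: "norm (g y s) \<le> L" for y s
    unfolding g_def L_def by (rule nice_field_bound[OF G r(1,2) refl P(1)])
  have g_int: "g y integrable_on {a..b}" for y a b
    using measurable_bounded_lemma[OF g_meas, of "\<lambda>_. L" a b y] g_bd by auto
  have g_diff: "norm (g y s - g y' s) \<le> L * E s * dist y y'" for y y' s
  proof -
    have "norm (g y s - g y' s) \<le> L * norm (P (E s *\<^sub>R apply_bcontfun y s) - P (E s *\<^sub>R apply_bcontfun y' s))"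
      unfolding g_def L_def by (rule nice_field_lipschitz[OF G r(1,2) refl P(1) P(1)])
    also have "\<dots> \<le> L * norm (E s *\<^sub>R apply_bcontfun y s - E s *\<^sub>R apply_bcontfun y' s)"
      using L by (intro mult_left_mono P) auto
    also have "\<dots> = L * (E s * dist (apply_bcontfun y s) (apply_bcontfun y' s))"
      by (simp add: scaleR_right_diff_distrib[symmetric] dist_norm E_def)
    also have "\<dots> \<le> L * (E s * dist y y')"
      using L by (intro mult_left_mono dist_bounded) (auto simp: E_def)
    finally show ?thesis by simp
  qed
  define I where "I y t = integral {0..t} (g y)" for y t
  have I_diff: "norm (I y t - I y s) \<le> L * \<bar>t - s\<bar>" if "0 \<le> s" "0 \<le> t" for y s t
  proof -
    have *: "norm (I y t - I y s) \<le> L * (t - s)" if "0 \<le> s" "s \<le> t" for s t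
    proof -
      have "I y t - I y s = integral {s..t} (g y)"
        using Henstock_Kurzweil_Integration.integral_combine[OF that g_int] by (simp add: I_def algebra_simps)
      also have "norm \<dots> \<le> integral {s..t} (\<lambda>_. L)"
        by (rule Henstock_Kurzweil_Integration.integral_norm_bound_integral[OF g_int]) (use g_bd in auto)
      finally show ?thesis using that by (simp add: mult.commute)
    qed
    show ?thesis
    proof (cases "s \<le> t")
      case True
      then show ?thesis using *[of s t] that by simp
    next
      case False
      then show ?thesis using *[of t s] that by (simp add: norm_minus_commute)
    qed
  qed
  have I0: "I y 0 = 0" for y by (simp add: I_def)
  \<comment> \<open>The curve is frozen at negative times because the bounded continuous functions
    of the fixed point argument live on all of \<open>real\<close>.\<close>
  define x' where "x' y t = z + I y (max 0 t)" for y t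
  have x'_lip: "L-lipschitz_on UNIV (x' y)" for y
  proof (rule lipschitz_onI)
    fix s t :: real
    have "dist (x' y s) (x' y t) \<le> L * \<bar>max 0 s - max 0 t\<bar>"
      using I_diff[of "max 0 t" "max 0 s" y] by (simp add: x'_def dist_norm)
    also have "\<dots> \<le> L * \<bar>s - t\<bar>" using L by (intro mult_left_mono) auto
    finally show "dist (x' y s) (x' y t) \<le> L * dist s t" by (simp add: dist_norm)
  qed (use L in simp)
  define Q where "Q y t = inverse (E (max 0 t)) *\<^sub>R x' y t" for y t
  have Q_bc: "Q y \<in> bcontfun" for y
  proof (rule bcontfun_normI)
    have "continuous_on UNIV (x' y)" by (rule lipschitz_on_continuous_on[OF x'_lip])
    moreover have "continuous_on UNIV (\<lambda>t. inverse (E (max 0 t)))"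
      unfolding E_def by (intro continuous_intros) auto
    ultimately show "continuous_on UNIV (Q y)" unfolding Q_def by (intro continuous_on_scaleR)
    fix t :: real
    define u where "u = max 0 t"
    have u: "u \<ge> 0" by (simp add: u_def)
    have E1: "E u \<ge> 1" "E u \<ge> L * u"
    proof -
      show "E u \<ge> 1" using u L by (simp add: E_def)
      have "0 \<le> L * u" using L u by simp
      then show "E u \<ge> L * u" using exp_ge_add_one_self[of "2 * L * u"] unfolding E_def by linarith
    qed
    have "norm (I y u) \<le> L * u" using I_diff[of 0 u y] I0 u by simp
    then have "norm (x' y t) \<le> norm z + L * u"
      unfolding x'_def u_def[symmetric] using norm_triangle_ineq[of z "I y u"] by linarith
    also have "\<dots> \<le> norm z * E u + E u"
      using E1 mult_left_mono[OF E1(1), of "norm z"] by simp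
    finally have "inverse (E u) * norm (x' y t) \<le> inverse (E u) * (norm z * E u + E u)"
      using E1 by (intro mult_left_mono) auto
    also have "\<dots> = norm z + 1" using E1 by (simp add: field_simps)
    finally show "norm (Q y t) \<le> norm z + 1"
      using E1 by (simp add: Q_def u_def[symmetric] E_def)
  qed
  define T where "T y = Bcontfun (Q y)" for y
  have T: "apply_bcontfun (T y) = Q y" for y
    unfolding T_def using Q_bc by (rule Bcontfun_inverse)
  have "\<exists>!y. T y = y"
  proof (rule banach_fix_type[where c = "1/2"])
    show "\<forall>y y'. dist (T y) (T y') \<le> 1 / 2 * dist y y'"
    proof (intro allI dist_bound)
      fix y y' :: "real \<Rightarrow>\<^sub>C (complex ^ 'n)" and t :: real
      define u where "u = max 0 t"
      have u: "u \<ge> 0" by (simp add: u_def)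
      \<comment> \<open>The exponent \<open>2 * L\<close> of the weight is twice the Lipschitz
        constant, so integration gains the contraction factor 1/2.\<close>
      have "((\<lambda>s. L * E s * dist y y') has_integral (E u * dist y y' / 2 - E 0 * dist y y' / 2)) {0..u}"
      proof (rule fundamental_theorem_of_calculus[OF u])
        fix s assume "s \<in> {0..u}"
        have "((\<lambda>s. E s * dist y y' / 2) has_real_derivative L * E s * dist y y') (at s within {0..u})"
          unfolding E_def by (auto intro!: derivative_eq_intros)
        then show "((\<lambda>s. E s * dist y y' / 2) has_vector_derivative L * E s * dist y y') (at s within {0..u})"
          by (simp add: has_real_derivative_iff_has_vector_derivative)
      qed
      then have h: "((\<lambda>s. L * E s * dist y y') has_integral (E u * dist y y' / 2 - dist y y' / 2)) {0..u}"
        by (simp add: E_def)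
      then have hi: "(\<lambda>s. L * E s * dist y y') integrable_on {0..u}" by blast
      note hi' = integral_unique[OF h]
      have "norm (I y u - I y' u) = norm (integral {0..u} (\<lambda>s. g y s - g y' s))"
        unfolding I_def by (simp add: Henstock_Kurzweil_Integration.integral_diff[OF g_int g_int])
      also have "\<dots> \<le> integral {0..u} (\<lambda>s. L * E s * dist y y')"
        by (rule Henstock_Kurzweil_Integration.integral_norm_bound_integral[OF Henstock_Kurzweil_Integration.integrable_diff[OF g_int g_int] hi])
           (rule g_diff)
      also have "\<dots> \<le> E u * (dist y y' / 2)" unfolding hi' by simp
      finally have le: "norm (I y u - I y' u) \<le> E u * (dist y y' / 2)" .
      have Eu: "E u > 0" by (simp add: E_def)
      have "dist (apply_bcontfun (T y) t) (apply_bcontfun (T y') t) = inverse (E u) * norm (I y u - I y' u)"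
        unfolding T Q_def x'_def u_def[symmetric] dist_norm
        using Eu by (simp add: scaleR_right_diff_distrib[symmetric])
      also have "\<dots> \<le> inverse (E u) * (E u * (dist y y' / 2))" using Eu by (intro mult_left_mono le) auto
      also have "\<dots> = 1 / 2 * dist y y'" using Eu by simp
      finally show "dist (apply_bcontfun (T y) t) (apply_bcontfun (T y') t) \<le> 1 / 2 * dist y y'" .
    qed
  qed auto
  then obtain y where y: "T y = y" by blast
  define x where "x = x' y"
  have x_t: "x t = z + I y t" if "t \<ge> 0" for t using that by (simp add: x_def x'_def)
  have Ey: "E s *\<^sub>R apply_bcontfun y s = x s" if "s \<ge> 0" for s
  proof -
    have "apply_bcontfun y s = inverse (E s) *\<^sub>R x s" using T[of y] that by (simp add: y Q_def x_def)
    then show ?thesis by (simp add: E_def)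
  qed
  have gx: "g y s = G (P (x s)) s" if "s \<ge> 0" for s using Ey[OF that] by (simp add: g_def)
  have x0: "x 0 = z" by (simp add: x_t I0)
  have lip: "L-lipschitz_on {0..b} x" for b
    unfolding x_def using x'_lip lipschitz_on_subset by blast
  have der: "\<exists>N. negligible N \<and> (\<forall>t\<in>{0<..<b} - N. (x has_vector_derivative G (P (x t)) t) (at t))" for b
  proof (intro exI conjI ballI)
    let ?N = "{t \<in> {0<..<b}. \<not> ((\<lambda>x. integral {0..x} (g y)) has_vector_derivative g y t) (at t)}"
    show "negligible ?N" by (rule negligible_not_derivative_of_integral[OF g_int])
    fix t assume t: "t \<in> {0<..<b} - ?N"
    then have "((\<lambda>x. integral {0..x} (g y)) has_vector_derivative g y t) (at t)" by blast
    then have "((\<lambda>t. z + I y t) has_vector_derivative g y t) (at t)"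
      using has_vector_derivative_add[OF has_vector_derivative_const[of z]] by (fastforce simp: I_def)
    then have "(x has_vector_derivative g y t) (at t)"
      by (rule has_vector_derivative_transform_within_open[where S = "{0<..}"]) (use t x_t in auto)
    then show "(x has_vector_derivative G (P (x t)) t) (at t)" using gx t by simp
  qed
  \<comment> \<open>Outside the ball the projection is radial, so \<open>x t\<close> is a positive
    multiple of \<open>P (x t)\<close> and the sign of the inner product is inherited from the
    projected point.\<close>
  have inner: "2 * (x t \<bullet> G (P (x t)) t) \<le> 0" for t
  proof (cases "norm (x t) \<le> r")
    case True
    then have "P (x t) = x t" unfolding P_def by (intro closest_point_self) simp
    then show ?thesis using nice_field_inner_nonpos[OF G, of "x t" t] True r by simp
  next
    case False
    then have *: "P (x t) = (r / norm (x t)) *\<^sub>R x t" unfolding P_def by (intro radial_projection(1)[OF r(1)]) simp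
    have "x t = (norm (x t) / r) *\<^sub>R P (x t)" unfolding * using False r by auto
    then have "x t \<bullet> G (P (x t)) t = (norm (x t) / r) * (P (x t) \<bullet> G (P (x t)) t)"
      by (metis inner_scaleR_left)
    moreover have "P (x t) \<bullet> G (P (x t)) t \<le> 0"
      using nice_field_inner_nonpos[OF G, of "P (x t)" t] P(1)[of "x t"] r by linarith
    then have "(norm (x t) / r) * (P (x t) \<bullet> G (P (x t)) t) \<le> 0"
      using r by (intro mult_nonneg_nonpos) auto
    ultimately show ?thesis by linarith
  qed
  have bound: "norm (x t) \<le> norm z" if "t \<ge> 0" for t
  proof -
    obtain N where N: "negligible N" "\<forall>s\<in>{0<..<t} - N. (x has_vector_derivative G (P (x s)) s) (at s)"
      using der by blast
    have "(norm (x t))\<^sup>2 \<le> exp (0 - 0) * (norm (x 0))\<^sup>2"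
      by (rule gronwall_lipschitz_le[where \<kappa> = "\<lambda>_. 0" and N = N and x' = "\<lambda>t. G (P (x t)) t"])
         (use N lip that inner in \<open>auto intro!: derivative_eq_intros\<close>)
    then show ?thesis by (simp add: x0 power2_le_iff_abs_le)
  qed
  have Px: "P (x t) = x t" if "t \<ge> 0" for t
    unfolding P_def using bound[OF that] r by (intro closest_point_self) simp
  have "solves G b x" if "b \<ge> 0" for b
    unfolding solves_def
  proof (intro conjI)
    show "\<exists>C. C-lipschitz_on {0..b} x" using lip by blast
    show "\<forall>t\<in>{0..b}. x t \<in> unit_ball"
    proof
      fix t assume "t \<in> {0..b}"
      then have "norm (x t) \<le> norm z" using bound by simp
      then show "x t \<in> unit_ball" using z by simp
    qed
    obtain N where "negligible N" "\<forall>s\<in>{0<..<b} - N. (x has_vector_derivative G (P (x s)) s) (at s)"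
      using der by blast
    then show "\<exists>N. negligible N \<and> (\<forall>t\<in>{0<..<b} - N. (x has_vector_derivative G (x t) t) (at t))"
      using Px by (intro exI[of _ N]) simp
  qed
  then show ?thesis using x0 by blast
qed

section \<open>The flow of a nice field and its cocycle property\<close>

definition ev :: "(complex ^ 'n \<Rightarrow> real \<Rightarrow> complex ^ 'n) \<Rightarrow> real \<Rightarrow> complex ^ 'n \<Rightarrow> complex ^ 'n" where
  "ev G t z = (SOME x. x 0 = z \<and> (\<forall>b\<ge>0. solves G b x)) t"

lemma ev_solution:
  assumes "nice_field G" "norm z < 1"
  shows ev_0: "ev G 0 z = z" and ev_solves: "b \<ge> 0 \<Longrightarrow> solves G b (\<lambda>t. ev G t z)"
  using someI_ex[OF solution_exists[OF assms]] unfolding ev_def[symmetric] by auto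

lemma ev_unique:
  assumes G: "nice_field G" and x: "solves G b x" and t: "0 \<le> t" "t \<le> b"
  shows "x t = ev G t (x 0)"
proof -
  have "x 0 \<in> unit_ball" using x t by (auto simp: solves_def)
  then have n: "norm (x 0) < 1" by simp
  show ?thesis
    by (rule solves_unique[OF G x ev_solves[OF G n] t]) (use t ev_0[OF G n] in auto)
qed

lemma norm_ev_le:
  assumes G: "nice_field G" and z: "norm z < 1" and t: "0 \<le> t"
  shows "norm (ev G t z) \<le> norm z"
  using solves_norm_antimono[OF G ev_solves[OF G z t] order_refl t order_refl] ev_0[OF G z] by simp

lemma solves_cong:
  assumes x: "solves G b x" and eq: "\<And>z t. 0 < t \<Longrightarrow> t < b \<Longrightarrow> G z t = G' z t"
  shows "solves G' b x"
proof -
  obtain N where N: "negligible N" "\<forall>t\<in>{0<..<b} - N. (x has_vector_derivative G (x t) t) (at t)"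
    using x unfolding solves_def by blast
  have "\<forall>t\<in>{0<..<b} - N. (x has_vector_derivative G' (x t) t) (at t)"
    using N(2) by (simp add: eq[symmetric])
  then show ?thesis using x N(1) unfolding solves_def by blast
qed

lemma ev_cong:
  assumes G: "nice_field G" "nice_field G'" and z: "norm z < 1" and t: "0 \<le> t"
    and eq: "\<And>z s. 0 < s \<Longrightarrow> s < t \<Longrightarrow> G z s = G' z s"
  shows "ev G t z = ev G' t z"
  using ev_unique[OF G(2) solves_cong[OF ev_solves[OF G(1) z t] eq] t order_refl] ev_0[OF G(1) z] by simp

definition time_shift :: "('a \<Rightarrow> real \<Rightarrow> 'b) \<Rightarrow> real \<Rightarrow> 'a \<Rightarrow> real \<Rightarrow> 'b" where
  "time_shift G s z t = G z (t + s)"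

lemma nice_field_time_shift:
  assumes "nice_field G"
  shows "nice_field (time_shift G s)"
proof -
  have "(\<lambda>t. s + (\<Sum>j\<in>Basis. (1 * (t \<bullet> j)) *\<^sub>R j)) \<in> lebesgue \<rightarrow>\<^sub>M (lebesgue :: real measure)"
    by (rule lebesgue_affine_measurable) simp
  then have "(\<lambda>t::real. t + s) \<in> lebesgue \<rightarrow>\<^sub>M lebesgue" by (simp add: add.commute)
  then have "(\<lambda>t. f (t + s)) \<in> borel_measurable lebesgue" if "f \<in> borel_measurable lebesgue" for f :: "real \<Rightarrow> complex ^ 'a"
    using measurable_compose that by blast
  then show ?thesis using assms unfolding nice_field_def time_shift_def by blast
qed

lemma solves_time_shift:
  assumes x: "solves G b x" and s: "0 \<le> s" "s \<le> b"
  shows "solves (time_shift G s) (b - s) (\<lambda>t. x (t + s))"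
proof -
  obtain L N where L: "L-lipschitz_on {0..b} x" "\<forall>t\<in>{0..b}. x t \<in> unit_ball" "negligible N"
   "\<forall>t\<in>{0<..<b} - N. (x has_vector_derivative G (x t) t) (at t)"
    using x unfolding solves_def by blast
  show ?thesis
    unfolding solves_def
  proof (intro conjI)
    have "L-lipschitz_on {0..b - s} (\<lambda>t. x (t + s))"
    proof (rule lipschitz_onI)
      fix u v assume "u \<in> {0..b - s}" "v \<in> {0..b - s}"
      then show "dist (x (u + s)) (x (v + s)) \<le> L * dist u v"
        using lipschitz_onD[OF L(1), of "u + s" "v + s"] s by (simp add: dist_norm)
    qed (use L(1) lipschitz_on_nonneg in blast)
    then show "\<exists>C. C-lipschitz_on {0..b - s} (\<lambda>t. x (t + s))" by blast
    show "\<forall>t\<in>{0..b - s}. x (t + s) \<in> unit_ball" using L(2) s by auto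
    show "\<exists>N. negligible N \<and> (\<forall>t\<in>{0<..<b - s} - N.
        ((\<lambda>t. x (t + s)) has_vector_derivative time_shift G s (x (t + s)) t) (at t))"
    proof (intro exI[of _ "(+) (- s) ` N"] conjI ballI)
      show "negligible ((+) (- s) ` N)" using L(3) by (rule negligible_translation)
      fix t assume t: "t \<in> {0<..<b - s} - (+) (- s) ` N"
      have "t + s \<notin> N"
      proof
        assume "t + s \<in> N"
        then have "- s + (t + s) \<in> (+) (- s) ` N" by (rule imageI)
        then show False using t by simp
      qed
      then have d: "(x has_vector_derivative G (x (t + s)) (t + s)) (at (t + s))" using L(4) t s by auto
      have "((\<lambda>t. t + s) has_vector_derivative 1) (at t)"
        by (auto intro!: derivative_eq_intros)
      from vector_diff_chain_at[OF this d]
      show "((\<lambda>t. x (t + s)) has_vector_derivative time_shift G s (x (t + s)) t) (at t)"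
        by (simp add: o_def time_shift_def)
    qed
  qed
qed

lemma ev_cocycle:
  assumes G: "nice_field G" and z: "norm z < 1" and st: "0 \<le> s" "s \<le> t"
  shows "ev G t z = ev (time_shift G s) (t - s) (ev G s z)"
proof -
  have "solves (time_shift G s) (t - s) (\<lambda>u. ev G (u + s) z)"
    by (rule solves_time_shift[OF ev_solves[OF G z]]) (use st in auto)
  from ev_unique[OF nice_field_time_shift[OF G] this, of "t - s"] show ?thesis using st by simp
qed

subsection \<open>Asymptotics of the evolution\<close>

lemma lipschitz_on_exp_Icc: "\<exists>C. C-lipschitz_on {a..b} (\<lambda>t. exp (t :: real))"
proof -
  have "(exp b)-lipschitz_on {a..b} (\<lambda>t. exp (t :: real))"
  proof (rule lipschitz_onI)
    fix s t assume st: "s \<in> {a..b}" "t \<in> {a..b}"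
    show "dist (exp s) (exp t) \<le> exp b * dist s t"
      unfolding dist_norm
      by (rule field_differentiable_bound[of "{a..b}" _ exp])
         (use st in \<open>auto intro!: derivative_eq_intros\<close>)
  qed simp
  then show ?thesis by blast
qed

text \<open>The quotient \<open>c = (1 - r) / (1 + r)\<close> is the guaranteed decay rate inside
  radius \<open>r\<close>. The exponent \<open>2 * r / c\<close> is the integral of
  \<open>2 * r * exp (- c * u)\<close> over the half-line, the total defect of the true rate against
  rate 1.\<close>

definition decay_const :: "real \<Rightarrow> real" where
  "decay_const r = r * exp (2 * r / ((1 - r) / (1 + r)))"

lemma decay_const_pos: "0 < r \<Longrightarrow> decay_const r > 0"
  by (simp add: decay_const_def)

text \<open>A bootstrap: the rough rate \<open>c\<close> gives some exponential decay, and since the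
  rate tends to 1 as the point approaches 0, inserting this decay into the differential inequality
  yields the sharp rate 1.\<close>

lemma solves_decay:
  fixes G :: "complex ^ 'n \<Rightarrow> real \<Rightarrow> complex ^ 'n"
  assumes G: "nice_field G" and x: "solves G b x" and t: "0 \<le> t" "t \<le> b"
    and r: "0 < r" "r < 1" "norm (x 0) \<le> r"
  shows "norm (x t) \<le> decay_const r * exp (- t)"
proof -
  obtain L N where X: "L-lipschitz_on {0..b} x" "\<forall>t\<in>{0..b}. x t \<in> unit_ball" "negligible N"
   "\<forall>t\<in>{0<..<b} - N. (x has_vector_derivative G (x t) t) (at t)"
    using x unfolding solves_def by blast
  define c where "c = (1 - r) / (1 + r)"
  have c: "c > 0" using r by (simp add: c_def)
  have lip: "\<exists>C. C-lipschitz_on {0..u} x" if "u \<le> b" for u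
    using lipschitz_on_subset[OF X(1), of "{0..u}"] that by auto
  have le_r: "norm (x u) \<le> r" if "0 \<le> u" "u \<le> b" for u
    using solves_norm_antimono[OF G x, of 0 u] that r by auto
  have inner: "2 * (x u \<bullet> G (x u) u) \<le> - 2 * a * (norm (x u))\<^sup>2"
    if u: "0 \<le> u" "u \<le> b" and a: "a \<le> (1 - norm (x u)) / (1 + norm (x u))" for u a
  proof -
    have "x u \<bullet> G (x u) u \<le> - (norm (x u))\<^sup>2 * ((1 - norm (x u)) / (1 + norm (x u)))"
      using le_r[OF u] r by (intro nice_field_inner[OF G]) simp
    moreover have "(norm (x u))\<^sup>2 * a \<le> (norm (x u))\<^sup>2 * ((1 - norm (x u)) / (1 + norm (x u)))"
      by (intro mult_left_mono a) simp
    moreover have "- 2 * a * (norm (x u))\<^sup>2 = - 2 * ((norm (x u))\<^sup>2 * a)" by simp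
    ultimately show ?thesis by linarith
  qed
  have first: "norm (x u) \<le> r * exp (- c * u)" if u: "0 \<le> u" "u \<le> b" for u
  proof -
    have "(norm (x u))\<^sup>2 \<le> exp (- 2 * c * u - (- 2 * c * 0)) * (norm (x 0))\<^sup>2"
    proof (rule gronwall_lipschitz_le[OF u(1) lip[OF u(2)] X(3), where \<kappa> = "\<lambda>_. - 2 * c" and x' = "\<lambda>t. G (x t) t"])
      fix v assume v: "v \<in> {0<..<u} - N"
      show "2 * (x v \<bullet> G (x v) v) \<le> - 2 * c * (norm (x v))\<^sup>2"
      proof (rule inner)
        show "c \<le> (1 - norm (x v)) / (1 + norm (x v))"
          unfolding c_def using le_r[of v] v u r by (intro frac_le) (auto simp: add_pos_nonneg)
      qed (use v u in auto)
    qed (use X(4) u in \<open>auto intro!: derivative_eq_intros\<close>)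
    also have "\<dots> \<le> exp (- 2 * c * u) * r\<^sup>2" using r by (simp add: power_mono)
    also have "\<dots> = (r * exp (- c * u))\<^sup>2"
    proof -
      have "exp (- 2 * c * u) = (exp (- c * u))\<^sup>2" using exp_double[of "- c * u"] by (simp add: mult.assoc)
      then show ?thesis by (simp only: power_mult_distrib mult.commute)
    qed
    finally show ?thesis by (rule power2_le_imp_le) (use r in simp)
  qed
  define k where "k u = - 2 * u - 4 * r / c * exp (- c * u)" for u
  have "(norm (x t))\<^sup>2 \<le> exp (k t - k 0) * (norm (x 0))\<^sup>2"
  proof (rule gronwall_lipschitz_le[OF t(1) lip[OF t(2)] X(3), where \<kappa> = "\<lambda>u. - 2 + 4 * r * exp (- c * u)" and x' = "\<lambda>t. G (x t) t"])
    show "(k has_real_derivative - 2 + 4 * r * exp (- c * u)) (at u)" for u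
      unfolding k_def using c by (auto intro!: derivative_eq_intros)
    show "continuous_on {0..t} (\<lambda>u. - 2 + 4 * r * exp (- c * u))" by (intro continuous_intros)
    fix v assume v: "v \<in> {0<..<t} - N"
    have vb: "0 \<le> v" "v \<le> b" using v t by auto
    have n: "norm (x v) \<ge> 0" by simp
    \<comment> \<open>The rate \<open>(1 - a) / (1 + a)\<close> falls short of 1 by at most
      \<open>2 * a\<close>; for \<open>a = norm (x v)\<close>, already exponentially small, this
      defect is integrable, and \<open>k\<close> collects its primitive.\<close>
    have "(1 - 2 * norm (x v)) * (1 + norm (x v)) \<le> 1 - norm (x v)"
      by (simp add: algebra_simps)
    then have "1 - 2 * norm (x v) \<le> (1 - norm (x v)) / (1 + norm (x v))"
      by (simp add: pos_le_divide_eq add_pos_nonneg)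
    from inner[OF vb this]
    have "2 * (x v \<bullet> G (x v) v) \<le> - 2 * (1 - 2 * norm (x v)) * (norm (x v))\<^sup>2" .
    also have "\<dots> \<le> (- 2 + 4 * r * exp (- c * v)) * (norm (x v))\<^sup>2"
      using first[OF vb] by (intro mult_right_mono) auto
    finally show "2 * (x v \<bullet> G (x v) v) \<le> (- 2 + 4 * r * exp (- c * v)) * (norm (x v))\<^sup>2" .
  qed (use X(4) t in auto)
  also have "\<dots> \<le> exp (- 2 * t + 4 * r / c) * r\<^sup>2"
  proof (intro mult_mono)
    have "4 * r / c * exp (- c * t) \<ge> 0" using r c by simp
    then show "exp (k t - k 0) \<le> exp (- 2 * t + 4 * r / c)" by (simp add: k_def)
  qed (use r in \<open>auto intro: power_mono\<close>)
  also have "\<dots> = (r * exp (2 * r / c) * exp (- t))\<^sup>2"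
    using exp_double[of "2 * r / c"] exp_double[of "- t"]
    by (simp add: power_mult_distrib exp_add exp_diff exp_minus field_simps)
  finally show ?thesis unfolding decay_const_def c_def[symmetric]
    by (rule power2_le_imp_le) (use r in simp)
qed

text \<open>The linear part \<open>- z\<close> of the field shrinks the difference exactly by
  \<open>exp (- t)\<close>. The remaining part changes the logarithm of the difference at a rate at
  most \<open>K * exp (- u)\<close>, hence by at most \<open>K\<close> in total.\<close>

lemma solves_scaled_lower:
  fixes G :: "complex ^ 'n \<Rightarrow> real \<Rightarrow> complex ^ 'n"
  assumes G: "nice_field G" and x: "solves G b x" and y: "solves G b y" and t: "0 \<le> t" "t \<le> b"
    and r: "0 < r" "r < 1" "norm (x 0) \<le> r" "norm (y 0) \<le> r"
    and K_def: "K = field_const TYPE(complex ^ 'n) r * decay_const r"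
  shows "exp t * norm (x t - y t) \<ge> exp (- K) * norm (x 0 - y 0)"
proof -
  define C where "C = field_const TYPE(complex ^ 'n) r"
  have C: "C \<ge> 0" using field_const_nonneg[OF G r(1,2) refl] by (simp add: C_def)
  have K: "K \<ge> 0" using C decay_const_pos[OF r(1)] by (simp add: K_def C_def)
  obtain Lx N where X: "Lx-lipschitz_on {0..b} x" "\<forall>t\<in>{0..b}. x t \<in> unit_ball" "negligible N"
   "\<forall>t\<in>{0<..<b} - N. (x has_vector_derivative G (x t) t) (at t)"
    using x unfolding solves_def by blast
  obtain Ly N' where Y: "Ly-lipschitz_on {0..b} y" "\<forall>t\<in>{0..b}. y t \<in> unit_ball" "negligible N'"
   "\<forall>t\<in>{0<..<b} - N'. (y has_vector_derivative G (y t) t) (at t)"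
    using y unfolding solves_def by blast
  define d where "d t = x t - y t" for t
  have lip: "\<exists>C. C-lipschitz_on {0..t} d"
    unfolding d_def using lipschitz_on_subset[OF lipschitz_on_diff[OF X(1) Y(1)], of "{0..t}"] t by auto
  have der: "(d has_vector_derivative G (x u) u - G (y u) u) (at u)" if "u \<in> {0<..<t} - (N \<union> N')" for u
    unfolding d_def using X(4) Y(4) that t by (intro has_vector_derivative_diff) auto
  have neg: "negligible (N \<union> N')" using X Y by simp
  define k where "k u = - 2 * u + 2 * K * exp (- u)" for u
  have "exp (k t - k 0) * (norm (d 0))\<^sup>2 \<le> (norm (d t))\<^sup>2"
  proof (rule gronwall_lipschitz_ge[OF t(1) lip neg der, where \<kappa> = "\<lambda>u. - 2 - 2 * K * exp (- u)"])
    show "(k has_real_derivative - 2 - 2 * K * exp (- u)) (at u)" for u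
      unfolding k_def by (auto intro!: derivative_eq_intros)
    show "continuous_on {0..t} (\<lambda>u. - 2 - 2 * K * exp (- u))" by (intro continuous_intros)
    fix u assume u: "u \<in> {0<..<t} - (N \<union> N')"
    have ub: "0 \<le> u" "u \<le> b" using u t by auto
    have nr: "norm (x u) \<le> r" "norm (y u) \<le> r"
      using solves_norm_antimono[OF G x, of 0 u] solves_norm_antimono[OF G y, of 0 u] ub r by auto
    have mx: "max (norm (x u)) (norm (y u)) \<le> decay_const r * exp (- u)"
      using solves_decay[OF G x ub r(1-3)] solves_decay[OF G y ub r(1,2,4)] by simp
    define e where "e = G (x u) u + x u - (G (y u) u + y u)"
    have "norm e \<le> C * max (norm (x u)) (norm (y u)) * norm (d u)"
      unfolding e_def d_def by (rule nice_field_distortion[OF G r(1,2) _ nr]) (simp add: C_def)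
    also have "\<dots> \<le> C * (decay_const r * exp (- u)) * norm (d u)"
      using C mx by (intro mult_right_mono mult_left_mono) auto
    also have "\<dots> = K * exp (- u) * norm (d u)" by (simp add: K_def C_def)
    finally have "norm (d u) * norm e \<le> norm (d u) * (K * exp (- u) * norm (d u))"
      by (intro mult_left_mono) auto
    then have "\<bar>d u \<bullet> e\<bar> \<le> K * exp (- u) * (norm (d u))\<^sup>2"
      using Cauchy_Schwarz_ineq2[of "d u" e] by (simp add: power2_eq_square mult_ac)
    moreover have "d u \<bullet> (G (x u) u - G (y u) u) = d u \<bullet> e - (norm (d u))\<^sup>2"
    proof -
      have "G (x u) u - G (y u) u = e - d u" by (simp add: e_def d_def)
      then show ?thesis by (simp add: inner_diff_right power2_norm_eq_inner)
    qed
    ultimately show "2 * (d u \<bullet> (G (x u) u - G (y u) u)) \<ge> (- 2 - 2 * K * exp (- u)) * (norm (d u))\<^sup>2"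
      by (simp add: algebra_simps)
  qed
  moreover have "exp (- 2 * t - 2 * K) * (norm (d 0))\<^sup>2 \<le> exp (k t - k 0) * (norm (d 0))\<^sup>2"
    using K by (intro mult_right_mono) (auto simp: k_def)
  moreover have "exp (- 2 * t - 2 * K) * (norm (d 0))\<^sup>2 = (exp (- t) * (exp (- K) * norm (d 0)))\<^sup>2"
    using exp_double[of "- K"] exp_double[of "- t"] exp_add[of "- 2 * t" "- 2 * K"]
    by (simp add: power_mult_distrib)
  ultimately have "(exp (- t) * (exp (- K) * norm (d 0)))\<^sup>2 \<le> (norm (d t))\<^sup>2" by linarith
  then have "exp (- t) * (exp (- K) * norm (d 0)) \<le> norm (d t)" by (rule power2_le_imp_le) simp
  then have "exp t * (exp (- t) * (exp (- K) * norm (d 0))) \<le> exp t * norm (d t)"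
    by (intro mult_left_mono) auto
  moreover have "exp t * (exp (- t) * (exp (- K) * norm (d 0))) = exp (- K) * norm (d 0)"
    by (simp add: exp_minus)
  ultimately have "exp (- K) * norm (d 0) \<le> exp t * norm (d t)" by linarith
  then show ?thesis by (simp only: d_def)
qed

text \<open>The derivative of \<open>exp t *\<^sub>R x t\<close> is \<open>exp t\<close> times a
  quantity quadratic in \<open>x t\<close>, hence of order \<open>exp (- t)\<close>. Two radii are
  kept apart: \<open>r\<close> fixes the distortion constant, while \<open>r0\<close> may shrink
  with the starting point, so that the bound becomes quadratic in it; this is exploited in
  \<open>evlim_quadratic\<close>.\<close>

lemma solves_scaled_cauchy:
  fixes G :: "complex ^ 'n \<Rightarrow> real \<Rightarrow> complex ^ 'n"
  assumes G: "nice_field G" and x: "solves G b x" and st: "0 \<le> s" "s \<le> t" "t \<le> b"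
    and r: "0 < r" "r < 1" and r0: "0 < r0" "r0 \<le> r" "norm (x 0) \<le> r0"
  shows "norm (exp t *\<^sub>R x t - exp s *\<^sub>R x s)
    \<le> field_const TYPE(complex ^ 'n) r * (decay_const r0)\<^sup>2 * exp (- s)"
proof -
  define C where "C = field_const TYPE(complex ^ 'n) r"
  define M where "M = decay_const r0"
  have C: "C \<ge> 0" using field_const_nonneg[OF G r(1,2) refl] by (simp add: C_def)
  obtain L N where X: "L-lipschitz_on {0..b} x" "\<forall>t\<in>{0..b}. x t \<in> unit_ball" "negligible N"
   "\<forall>t\<in>{0<..<b} - N. (x has_vector_derivative G (x t) t) (at t)"
    using x unfolding solves_def by blast
  \<comment> \<open>The value 0 at exceptional times makes the norm bound hold at every time of the
    interval.\<close>
  define f where "f u = (if u \<in> N \<union> {s, t} then 0 else exp u *\<^sub>R (G (x u) u + x u))" for u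
  have neg: "negligible (N \<union> {s, t})" using X by simp
  have "(f has_integral (exp t *\<^sub>R x t - exp s *\<^sub>R x s)) {s..t}"
  proof (rule lipschitz_on_ae_derivative_has_integral[OF st(2) _ neg])
    show "\<exists>C. C-lipschitz_on {s..t} (\<lambda>u. exp u *\<^sub>R x u)"
    proof (rule lipschitz_on_bounded_bilinear[OF bounded_bilinear_scaleR lipschitz_on_exp_Icc])
      show "\<exists>C. C-lipschitz_on {s..t} x" using lipschitz_on_subset[OF X(1), of "{s..t}"] st by auto
    qed
    fix u assume u: "u \<in> {s<..<t} - (N \<union> {s, t})"
    have "(x has_vector_derivative G (x u) u) (at u)" using X(4) u st by auto
    moreover have "(exp has_real_derivative exp u) (at u)" by (rule DERIV_exp)
    ultimately have "((\<lambda>u. exp u *\<^sub>R x u) has_vector_derivative exp u *\<^sub>R G (x u) u + exp u *\<^sub>R x u) (at u)"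
      by (rule has_vector_derivative_scaleR[rotated])
    then show "((\<lambda>u. exp u *\<^sub>R x u) has_vector_derivative f u) (at u)"
      using u by (simp add: f_def scaleR_add_right)
  qed
  moreover have "((\<lambda>u. C * M\<^sup>2 * exp (- u)) has_integral (- C * M\<^sup>2 * exp (- t) - (- C * M\<^sup>2 * exp (- s)))) {s..t}"
  proof (rule fundamental_theorem_of_calculus[OF st(2)])
    fix u assume "u \<in> {s..t}"
    have "((\<lambda>u. - C * M\<^sup>2 * exp (- u)) has_real_derivative C * M\<^sup>2 * exp (- u)) (at u within {s..t})"
      by (auto intro!: derivative_eq_intros)
    then show "((\<lambda>u. - C * M\<^sup>2 * exp (- u)) has_vector_derivative C * M\<^sup>2 * exp (- u)) (at u within {s..t})"
      by (simp add: has_real_derivative_iff_has_vector_derivative)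
  qed
  moreover have "norm (f u) \<le> C * M\<^sup>2 * exp (- u)" if u: "u \<in> {s..t}" for u
  proof (cases "u \<in> N \<union> {s, t}")
    case True
    then show ?thesis using C by (simp add: f_def)
  next
    case False
    have ub: "0 \<le> u" "u \<le> b" using u st by auto
    have "norm (x u) \<le> r" using solves_norm_antimono[OF G x, of 0 u] ub r0 by auto
    then have "norm (G (x u) u + x u) \<le> C * (norm (x u))\<^sup>2"
      by (intro nice_field_quadratic[OF G r(1,2)]) (simp_all add: C_def)
    also have "\<dots> \<le> C * (M * exp (- u))\<^sup>2"
      using solves_decay[OF G x ub r0(1) _ r0(3)] r r0 C by (intro mult_left_mono power_mono) (auto simp: M_def)
    finally have "exp u * norm (G (x u) u + x u) \<le> exp u * (C * (M * exp (- u))\<^sup>2)"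
      by (intro mult_left_mono) auto
    also have "\<dots> = C * M\<^sup>2 * exp (- u)"
      by (simp add: power_mult_distrib power2_eq_square exp_minus)
    finally show ?thesis using False by (simp add: f_def)
  qed
  ultimately have "norm (exp t *\<^sub>R x t - exp s *\<^sub>R x s) \<le> - C * M\<^sup>2 * exp (- t) - (- C * M\<^sup>2 * exp (- s))"
    using Henstock_Kurzweil_Integration.integral_norm_bound_integral[of f "{s..t}" "\<lambda>u. C * M\<^sup>2 * exp (- u)"]
    by (metis (no_types, lifting) has_integral_integrable_integral)
  also have "\<dots> \<le> C * M\<^sup>2 * exp (- s)" using C by simp
  finally show ?thesis by (simp add: C_def M_def)
qed

text \<open>The limit is taken along integer times; the rate estimate that follows extends it to all
  real times.\<close>

definition evlim :: "(complex ^ 'n \<Rightarrow> real \<Rightarrow> complex ^ 'n) \<Rightarrow> complex ^ 'n \<Rightarrow> complex ^ 'n" where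
  "evlim G z = lim (\<lambda>k. exp (real k) *\<^sub>R ev G (real k) z)"

context
  fixes G :: "complex ^ 'n \<Rightarrow> real \<Rightarrow> complex ^ 'n"
  assumes G: "nice_field G"
begin

lemma ev_tendsto_evlim_rate:
  assumes r: "0 < r" "r < 1" and r0: "0 < r0" "r0 \<le> r" "norm z \<le> r0" and s: "0 \<le> s"
  shows "norm (exp s *\<^sub>R ev G s z - evlim G z) \<le> field_const TYPE(complex ^ 'n) r * (decay_const r0)\<^sup>2 * exp (- s)"
proof -
  define B where "B = field_const TYPE(complex ^ 'n) r * (decay_const r0)\<^sup>2"
  have B: "B \<ge> 0" using field_const_nonneg[OF G r(1,2) refl] by (simp add: B_def)
  have z: "norm z < 1" using r r0 by simp
  define w where "w t = exp t *\<^sub>R ev G t z" for t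
  have ww: "norm (w t - w s) \<le> B * exp (- s)" if "0 \<le> s" "s \<le> t" for s t
    unfolding w_def B_def
    by (rule solves_scaled_cauchy[OF G ev_solves[OF G z, of t] that order_refl r r0(1,2)])
       (use that ev_0[OF G z] r0 in auto)
  have exp0: "(\<lambda>n. B * exp (- real n)) \<longlonglongrightarrow> B * 0"
    by (intro tendsto_mult tendsto_const filterlim_compose[OF exp_at_bot] filterlim_compose[OF filterlim_uminus_at_bot_at_top])
       (rule filterlim_real_sequentially)
  have "Cauchy (\<lambda>k. w (real k))"
  proof (rule metric_CauchyI)
    fix e :: real assume "e > 0"
    then have "\<forall>\<^sub>F n in sequentially. B * exp (- real n) < e / 2"
      using order_tendstoD(2)[OF exp0, of "e / 2"] by simp
    then obtain n where n: "B * exp (- real n) < e / 2" by (auto simp: eventually_sequentially)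
    have "dist (w (real k)) (w (real n)) < e / 2" if "k \<ge> n" for k
      using ww[of "real n" "real k"] that n by (simp add: dist_norm)
    then have "\<forall>m\<ge>n. \<forall>k\<ge>n. dist (w (real m)) (w (real k)) < e"
      using dist_triangle_half_l by blast
    then show "\<exists>M. \<forall>m\<ge>M. \<forall>n\<ge>M. dist (w (real m)) (w (real n)) < e" by blast
  qed
  then have lim: "(\<lambda>k. w (real k)) \<longlonglongrightarrow> evlim G z"
    unfolding evlim_def w_def by (simp add: Cauchy_convergent_iff convergent_LIMSEQ_iff)
  have "norm (w s - evlim G z) \<le> B * exp (- s)"
  proof (rule LIMSEQ_le_const2)
    show "(\<lambda>k. norm (w s - w (real k))) \<longlonglongrightarrow> norm (w s - evlim G z)" by (intro tendsto_intros lim)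
    have "norm (w s - w (real k)) \<le> B * exp (- s)" if "k \<ge> nat \<lceil>s\<rceil>" for k
      using ww[OF s, of "real k"] that by (simp add: norm_minus_commute nat_le_iff ceiling_le_iff)
    then show "\<exists>N. \<forall>n\<ge>N. norm (w s - w (real n)) \<le> B * exp (- s)" by blast
  qed
  then show ?thesis by (simp add: w_def B_def)
qed

lemma uniform_limit_ev_evlim:
  assumes K: "compact K" "K \<subseteq> unit_ball"
  shows "uniform_limit K (\<lambda>s z. exp s *\<^sub>R ev G s z) (evlim G) at_top"
proof -
  obtain r where r: "0 < r" "r < 1" "K \<subseteq> cball 0 r"
    using compact_subset_ball_cball[OF K zero_less_one] by blast
  define B where "B = field_const TYPE(complex ^ 'n) r * (decay_const r)\<^sup>2"
  show ?thesis
  proof (rule uniform_limitI_bound[where b = "\<lambda>s. B * exp (- s)"])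
    show "\<forall>\<^sub>F s in at_top. \<forall>z\<in>K. norm (exp s *\<^sub>R ev G s z - evlim G z) \<le> B * exp (- s)"
      using eventually_ge_at_top[of 0]
    proof eventually_elim
      case (elim s)
      then show ?case using ev_tendsto_evlim_rate[OF r(1,2,1) order_refl _ elim] r(3) unfolding B_def by auto
    qed
    have "((\<lambda>s. B * exp (- s)) \<longlongrightarrow> B * 0) at_top"
      by (intro tendsto_mult tendsto_const filterlim_compose[OF exp_at_bot] filterlim_uminus_at_bot_at_top)
    then show "((\<lambda>s. B * exp (- s)) \<longlongrightarrow> 0) at_top" by simp
  qed
qed

lemma ev_tendsto_evlim:
  assumes "norm z < 1"
  shows "((\<lambda>s. exp s *\<^sub>R ev G s z) \<longlongrightarrow> evlim G z) at_top"
  using tendsto_uniform_limitI[OF uniform_limit_ev_evlim[of "{z}"]] assms by auto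

text \<open>The lower bound for scaled differences passes to the limit. Its constant does not depend
  on the field, so it also holds for the time-shifted limit maps.\<close>

lemma evlim_lower:
  assumes r: "0 < r" "r < 1" "norm z \<le> r" "norm w \<le> r"
  shows "norm (evlim G z - evlim G w)
    \<ge> exp (- (field_const TYPE(complex ^ 'n) r * decay_const r)) * norm (z - w)"
proof (rule tendsto_lowerbound)
  have z: "norm z < 1" "norm w < 1" using r by auto
  show "((\<lambda>s. norm (exp s *\<^sub>R ev G s z - exp s *\<^sub>R ev G s w)) \<longlongrightarrow> norm (evlim G z - evlim G w)) at_top"
    by (intro tendsto_intros ev_tendsto_evlim z)
  show "\<forall>\<^sub>F s in at_top. exp (- (field_const TYPE(complex ^ 'n) r * decay_const r)) * norm (z - w)
       \<le> norm (exp s *\<^sub>R ev G s z - exp s *\<^sub>R ev G s w)"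
    using eventually_ge_at_top[of 0]
  proof eventually_elim
    case (elim s)
    have "exp s * norm (ev G s z - ev G s w) \<ge> exp (- (field_const TYPE(complex ^ 'n) r * decay_const r)) * norm (ev G 0 z - ev G 0 w)"
      by (rule solves_scaled_lower[OF G ev_solves[OF G z(1) elim] ev_solves[OF G z(2) elim] elim order_refl r(1,2) _ _ refl])
         (use ev_0[OF G] z r in auto)
    then show ?case using ev_0[OF G] z by (simp add: scaleR_right_diff_distrib[symmetric])
  qed
qed simp

end

lemma evlim_cocycle:
  assumes G: "nice_field G" and z: "norm z < 1" and s: "0 \<le> s"
  shows "evlim G z = exp s *\<^sub>R evlim (time_shift G s) (ev G s z)"
proof -
  have G': "nice_field (time_shift G s)" by (rule nice_field_time_shift[OF G])
  have n: "norm (ev G s z) < 1" using norm_ev_le[OF G z s] z by linarith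
  have "((\<lambda>t. exp s *\<^sub>R (exp (t - s) *\<^sub>R ev (time_shift G s) (t - s) (ev G s z))) \<longlongrightarrow>
      exp s *\<^sub>R evlim (time_shift G s) (ev G s z)) at_top"
  proof (intro tendsto_scaleR tendsto_const)
    have "filterlim (\<lambda>t. t - s) at_top at_top"
      using filterlim_at_top_add_at_top filterlim_tendsto_add_at_top[OF tendsto_const[of "- s"] filterlim_ident] by simp
    from filterlim_compose[OF ev_tendsto_evlim[OF G' n] this]
    show "((\<lambda>t. exp (t - s) *\<^sub>R ev (time_shift G s) (t - s) (ev G s z)) \<longlongrightarrow> evlim (time_shift G s) (ev G s z)) at_top" .
  qed
  moreover have "\<forall>\<^sub>F t in at_top. exp s *\<^sub>R (exp (t - s) *\<^sub>R ev (time_shift G s) (t - s) (ev G s z)) = exp t *\<^sub>R ev G t z"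
    using eventually_ge_at_top[of s]
  proof eventually_elim
    case (elim t)
    then show ?case using ev_cocycle[OF G z s elim] by (simp add: exp_add[symmetric])
  qed
  ultimately have "((\<lambda>t. exp t *\<^sub>R ev G t z) \<longlongrightarrow> exp s *\<^sub>R evlim (time_shift G s) (ev G s z)) at_top"
    by (rule Lim_transform_eventually)
  then show ?thesis using ev_tendsto_evlim[OF G z] tendsto_unique[OF trivial_limit_at_top_linorder] by blast
qed

subsection \<open>Membership in the class S0\<close>

lemma uminus_in_class_M: "(\<lambda>z\<in>unit_ball. - z) \<in> (class_M :: (complex ^ 'n \<Rightarrow> complex ^ 'n) set)"
proof -
  have "hol_on (\<lambda>z. (-1) *\<^sub>R z) (unit_ball :: (complex ^ 'n) set)" by (intro hol_on_scaleR hol_on_ident)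
  then have "(\<lambda>z\<in>unit_ball. - z) \<in> (Hol :: (complex ^ 'n \<Rightarrow> complex ^ 'n) set)"
    using restrict_in_Hol[of "\<lambda>z. - z"] by simp
  moreover have "((\<lambda>z\<in>unit_ball. - z) has_derivative (\<lambda>v. - v)) (at (0 :: complex ^ 'n))"
    using has_derivative_transform_within_open[of "\<lambda>z. - z" "\<lambda>v. - v" "0 :: complex ^ 'n" UNIV unit_ball
        "\<lambda>z\<in>unit_ball. - z"] by (auto intro!: derivative_eq_intros)
  moreover have "Re (hinner (- z) z) \<le> 0" for z :: "complex ^ 'n" by (simp add: Re_hinner)
  ultimately show ?thesis by (simp add: class_M_def)
qed

lemma uminus_field:
  shows nice_field_uminus: "nice_field (\<lambda>(z :: complex ^ 'n) _. - z)"
    and ev_uminus: "\<lbrakk>norm z < 1; t \<ge> 0\<rbrakk> \<Longrightarrow> ev (\<lambda>(z :: complex ^ 'n) _. - z) t z = exp (- t) *\<^sub>R z"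
    and evlim_uminus: "norm z < 1 \<Longrightarrow> evlim (\<lambda>(z :: complex ^ 'n) _. - z) z = z"
proof -
  show nice: "nice_field (\<lambda>(z :: complex ^ 'n) _. - z)"
    unfolding nice_field_def using uminus_in_class_M by simp
  show ev: "ev (\<lambda>(z :: complex ^ 'n) _. - z) t z = exp (- t) *\<^sub>R z" if z: "norm z < 1" and t: "t \<ge> 0" for t and z :: "complex ^ 'n"
  proof -
    have "solves (\<lambda>z _. - z) t (\<lambda>t. exp (- t) *\<^sub>R z)"
      unfolding solves_def
    proof (intro conjI)
      have "(norm z)-lipschitz_on {0..t} (\<lambda>t. exp (- t) *\<^sub>R z)"
      proof (rule lipschitz_onI)
        fix u v :: real assume uv: "u \<in> {0..t}" "v \<in> {0..t}"
        have "norm (exp (- u) - exp (- v)) \<le> 1 * norm (u - v)"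
          by (rule field_differentiable_bound[of "{0..t}" _ "\<lambda>u. - exp (- u)"])
             (use uv in \<open>auto intro!: derivative_eq_intros\<close>)
        then have "norm (exp (- u) - exp (- v)) * norm z \<le> norm (u - v) * norm z"
          by (intro mult_right_mono) auto
        then show "dist (exp (- u) *\<^sub>R z) (exp (- v) *\<^sub>R z) \<le> norm z * dist u v"
          by (simp add: dist_norm scaleR_left_diff_distrib[symmetric] mult.commute)
      qed simp
      then show "\<exists>C. C-lipschitz_on {0..t} (\<lambda>t. exp (- t) *\<^sub>R z)" by blast
      show "\<forall>t\<in>{0..t}. exp (- t) *\<^sub>R z \<in> unit_ball"
      proof
        fix u assume u: "u \<in> {0..t}"
        have "exp (- u) * norm z \<le> 1 * norm z" using u by (intro mult_right_mono) auto
        then show "exp (- u) *\<^sub>R z \<in> unit_ball" using z by simp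
      qed
      have "((\<lambda>t. exp (- t) *\<^sub>R z) has_vector_derivative - (exp (- u) *\<^sub>R z)) (at u)" for u
      proof -
        have "((\<lambda>t. exp (- t)) has_real_derivative - exp (- u)) (at u)" by (auto intro!: derivative_eq_intros)
        from has_vector_derivative_scaleR[OF this has_vector_derivative_const[of z]]
        show ?thesis by simp
      qed
      then show "\<exists>N. negligible N \<and> (\<forall>u\<in>{0<..<t} - N. ((\<lambda>t. exp (- t) *\<^sub>R z) has_vector_derivative - (exp (- u) *\<^sub>R z)) (at u))"
        by (intro exI[of _ "{}"]) auto
    qed
    from ev_unique[OF nice this t order_refl] show ?thesis by simp
  qed
  show "evlim (\<lambda>(z :: complex ^ 'n) _. - z) z = z" if z: "norm z < 1" for z :: "complex ^ 'n"
  proof -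
    have "((\<lambda>s. exp s *\<^sub>R ev (\<lambda>z _. - z) s z) \<longlongrightarrow> z) at_top"
    proof (rule Lim_transform_eventually[OF tendsto_const])
      show "\<forall>\<^sub>F s in at_top. z = exp s *\<^sub>R ev (\<lambda>z _. - z) s z"
        using eventually_ge_at_top[of 0] by eventually_elim (simp add: ev[OF z] exp_add[symmetric])
    qed
    with ev_tendsto_evlim[OF nice z] show ?thesis
      using tendsto_unique[OF trivial_limit_at_top_linorder] by blast
  qed
qed

lemma evlim_cong:
  assumes G: "nice_field G" "nice_field G'" and z: "norm z < 1"
    and eq: "\<And>z s. 0 < s \<Longrightarrow> G z s = G' z s"
  shows "evlim G z = evlim G' z"
  unfolding evlim_def by (subst ev_cong[OF G z _ eq]) auto

text \<open>Continuing with \<open>- z\<close> after time \<open>t\<close> makes \<open>exp s *\<^sub>R ev s\<close> constant from then on, so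
  scaled flow maps at finite times are themselves limit maps.\<close>

definition stop_field :: "(complex ^ 'n \<Rightarrow> real \<Rightarrow> complex ^ 'n) \<Rightarrow> real \<Rightarrow> complex ^ 'n \<Rightarrow> real \<Rightarrow> complex ^ 'n" where
  "stop_field G t z s = (if s < t then G z s else - z)"

lemma nice_field_switch:
  assumes "nice_field G" "nice_field H" "A \<in> sets lebesgue"
  shows "nice_field (\<lambda>z s. if s \<in> A then G z s else H z s)"
  unfolding nice_field_def
proof (intro conjI allI ballI)
  show "(\<lambda>z\<in>unit_ball. if t \<in> A then G z t else H z t) \<in> class_M" for t
    using assms unfolding nice_field_def by (cases "t \<in> A") simp_all
  show "(\<lambda>s. if s \<in> A then G z s else H z s) \<in> borel_measurable lebesgue" if "z \<in> unit_ball" for z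
    using assms that unfolding nice_field_def by (intro measurable_If_set) auto
qed

lemma nice_field_stop:
  assumes "nice_field G"
  shows "nice_field (stop_field G t)"
  using nice_field_switch[OF assms nice_field_uminus, of "{..<t}"]
  by (simp add: stop_field_def[abs_def])

lemma evlim_stop_field:
  assumes G: "nice_field G" and z: "norm z < 1" and t: "0 \<le> t"
  shows "evlim (stop_field G t) z = exp t *\<^sub>R ev G t z"
proof -
  have S: "nice_field (stop_field G t)" by (rule nice_field_stop[OF G])
  have "ev (stop_field G t) t z = ev G t z"
    by (rule ev_cong[OF S G z t]) (simp add: stop_field_def)
  moreover have "norm (ev G t z) < 1" using norm_ev_le[OF G z t] z by linarith
  moreover from this have "evlim (time_shift (stop_field G t) t) (ev G t z) = evlim (\<lambda>z _. - z) (ev G t z)"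
    by (intro evlim_cong nice_field_time_shift S nice_field_uminus) (simp_all add: time_shift_def stop_field_def)
  ultimately show ?thesis using evlim_cocycle[OF S z t] by (simp add: evlim_uminus)
qed

lemma AE_lebesgue_on_iff_negligible:
  assumes "S \<in> sets lebesgue"
  shows "(AE t in lebesgue_on S. P t) \<longleftrightarrow> (\<exists>N. negligible N \<and> (\<forall>t\<in>S - N. P t))"
proof
  assume "AE t in lebesgue_on S. P t"
  then have "AE t in lebesgue. t \<in> S \<longrightarrow> P t" using assms by (simp add: AE_restrict_space_iff)
  then obtain N where "N \<in> null_sets lebesgue" "{t \<in> space lebesgue. \<not> (t \<in> S \<longrightarrow> P t)} \<subseteq> N"
    by (auto simp: eventually_ae_filter)
  then show "\<exists>N. negligible N \<and> (\<forall>t\<in>S - N. P t)"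
    by (intro exI[of _ N]) (auto simp: negligible_iff_null_sets)
next
  assume "\<exists>N. negligible N \<and> (\<forall>t\<in>S - N. P t)"
  then obtain N where N: "negligible N" "\<forall>t\<in>S - N. P t" by blast
  have "AE t in lebesgue. t \<in> S \<longrightarrow> P t"
    by (rule AE_I'[of N]) (use N in \<open>auto simp: negligible_iff_null_sets\<close>)
  then show "AE t in lebesgue_on S. P t" using assms by (simp add: AE_restrict_space_iff)
qed

lemma ev_herglotz:
  assumes G: "nice_field G"
  shows nice_field_herglotz: "herglotz_vector_field G" and evolution_ev: "evolution G (ev G)"
proof -
  show "herglotz_vector_field G"
    unfolding herglotz_vector_field_def
    using G by (auto simp: nice_field_def intro: measurable_restrict_space1)
  show "evolution G (ev G)"
    unfolding evolution_def
  proof (intro ballI conjI allI impI)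
    fix z :: "complex ^ 'a" assume "z \<in> unit_ball"
    then have z: "norm z < 1" by simp
    show "ev G 0 z = z" by (rule ev_0[OF G z])
    show "ev G t z \<in> unit_ball" if "t \<ge> 0" for t using norm_ev_le[OF G z that] z by simp
    show "abs_continuous_on 0 b (\<lambda>t. ev G t z)" if "b \<ge> 0" for b
      using ev_solves[OF G z that] lipschitz_imp_abs_continuous_on unfolding solves_def by blast
    have "\<forall>n::nat. \<exists>N. negligible N \<and> (\<forall>t\<in>{0<..<real n} - N. ((\<lambda>t. ev G t z) has_vector_derivative G (ev G t z) t) (at t))"
      using ev_solves[OF G z] unfolding solves_def by simp
    then obtain N where N: "\<And>n::nat. negligible (N n)"
       "\<And>n t. t \<in> {0<..<real n} - N n \<Longrightarrow> ((\<lambda>t. ev G t z) has_vector_derivative G (ev G t z) t) (at t)"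
      by metis
    have sets: "{0::real..} \<in> sets lebesgue" by simp
    show "AE t in lebesgue_on {0..}. ((\<lambda>s. ev G s z) has_vector_derivative G (ev G t z) t) (at t)"
      unfolding AE_lebesgue_on_iff_negligible[OF sets]
    proof (intro exI[of _ "insert 0 (\<Union>n. N n)"] conjI ballI)
      have "negligible (\<Union>n. N n)" using N(1) by (intro negligible_countable_Union) auto
      then show "negligible (insert 0 (\<Union>n. N n))" by simp
      fix t :: real assume t: "t \<in> {0..} - insert 0 (\<Union>n. N n)"
      obtain n :: nat where "t < real n" using reals_Archimedean2 by blast
      then show "((\<lambda>s. ev G s z) has_vector_derivative G (ev G t z) t) (at t)"
        using N(2)[of t n] t by auto
    qed
  qed
qed

lemma restrict_evlim_in_class_S0:
  assumes G: "nice_field G"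
  shows "restrict (evlim G) unit_ball \<in> class_S0"
proof -
  have "uniform_limit K (scaled_evolution (ev G)) (restrict (evlim G) unit_ball) at_top"
    if K: "compact K" "K \<subseteq> unit_ball" for K
  proof (rule uniform_limit_cong'[THEN iffD1, OF _ _ uniform_limit_ev_evlim[OF G K]])
    show "exp x *\<^sub>R ev G x y = scaled_evolution (ev G) x y" "evlim G y = restrict (evlim G) unit_ball y" if "y \<in> K" for x y
      using K that by (auto simp: scaled_evolution_def subset_iff)
  qed
  then show ?thesis
    unfolding class_S0_def evolution_limit_def loc_uniform_limit_def
    using nice_field_herglotz[OF G] evolution_ev[OF G] by auto
qed

lemma restrict_ev_in_class_S0:
  assumes G: "nice_field G" and t: "0 \<le> t"
  shows "(\<lambda>z\<in>unit_ball. exp t *\<^sub>R ev G t z) \<in> class_S0"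
proof -
  have "(\<lambda>z\<in>unit_ball. exp t *\<^sub>R ev G t z) = restrict (evlim (stop_field G t)) unit_ball"
    by (rule restrict_ext) (simp add: evlim_stop_field[OF G _ t])
  then show ?thesis using restrict_evlim_in_class_S0[OF nice_field_stop[OF G]] by simp
qed

section \<open>Identifying a given evolution with the flow \<open>ev\<close>\<close>

lemma abs_continuous_on_subinterval:
  assumes f: "abs_continuous_on a b f" and "a \<le> c" "d \<le> b"
  shows "abs_continuous_on c d f"
  unfolding abs_continuous_on_def
proof (intro allI impI)
  fix e :: real assume e: "e > 0"
  from f[unfolded abs_continuous_on_def, THEN spec, THEN mp, OF e]
  obtain \<delta> where d: "\<delta> > 0" and *: "\<forall>D. finite D \<and> (\<forall>(u, v)\<in>D. a \<le> u \<and> u \<le> v \<and> v \<le> b) \<and>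
        pairwise (\<lambda>p q. {fst p<..<snd p} \<inter> {fst q<..<snd q} = {}) D \<and> (\<Sum>(u, v)\<in>D. v - u) < \<delta>
        \<longrightarrow> (\<Sum>(u, v)\<in>D. norm (f v - f u)) < e"
    by (elim exE conjE)
  show "\<exists>\<delta>>0. \<forall>D. finite D \<and> (\<forall>(u, v)\<in>D. c \<le> u \<and> u \<le> v \<and> v \<le> d) \<and>
        pairwise (\<lambda>p q. {fst p<..<snd p} \<inter> {fst q<..<snd q} = {}) D \<and> (\<Sum>(u, v)\<in>D. v - u) < \<delta>
        \<longrightarrow> (\<Sum>(u, v)\<in>D. norm (f v - f u)) < e"
  proof (intro exI[of _ \<delta>] conjI d allI impI, elim conjE)
    fix D assume D: "finite D" "\<forall>(u, v)\<in>D. c \<le> u \<and> u \<le> v \<and> v \<le> d"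
      "pairwise (\<lambda>p q. {fst p<..<snd p} \<inter> {fst q<..<snd q} = {}) D" "(\<Sum>(u, v)\<in>D. v - u) < \<delta>"
    have "\<forall>(u, v)\<in>D. a \<le> u \<and> u \<le> v \<and> v \<le> b" using D(2) assms(2,3) by force
    then show "(\<Sum>(u, v)\<in>D. norm (f v - f u)) < e" using *[THEN spec, of D] D by blast
  qed
qed

lemma abs_continuous_on_continuous_on:
  assumes f: "abs_continuous_on a b f"
  shows "continuous_on {a..b} f"
  unfolding continuous_on_iff
proof (intro ballI allI impI)
  fix s e :: real assume s: "s \<in> {a..b}" and e: "e > 0"
  from f[unfolded abs_continuous_on_def, THEN spec, THEN mp, OF e]
  obtain \<delta> where d: "\<delta> > 0" and *: "\<forall>D. finite D \<and> (\<forall>(u, v)\<in>D. a \<le> u \<and> u \<le> v \<and> v \<le> b) \<and>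
        pairwise (\<lambda>p q. {fst p<..<snd p} \<inter> {fst q<..<snd q} = {}) D \<and> (\<Sum>(u, v)\<in>D. v - u) < \<delta>
        \<longrightarrow> (\<Sum>(u, v)\<in>D. norm (f v - f u)) < e"
    by (elim exE conjE)
  have "norm (f v - f u) < e" if "a \<le> u" "u \<le> v" "v \<le> b" "v - u < \<delta>" for u v
    using *[THEN spec, of "{(u, v)}"] that by simp
  then have "\<forall>t\<in>{a..b}. dist t s < \<delta> \<longrightarrow> dist (f t) (f s) < e"
    using s by (smt (verit, best) atLeastAtMost_iff dist_commute dist_norm dist_real_def)
  then show "\<exists>d>0. \<forall>x'\<in>{a..b}. dist x' s < d \<longrightarrow> dist (f x') (f s) < e" using d by blast
qed

lemma herglotz_nice_field:
  fixes G :: "complex ^ 'n \<Rightarrow> real \<Rightarrow> complex ^ 'n"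
  assumes her: "herglotz_vector_field G"
  obtains G' N where "nice_field G'" "negligible N" "\<And>z t. \<lbrakk>z \<in> unit_ball; 0 < t; t \<notin> N\<rbrakk> \<Longrightarrow> G' z t = G z t"
proof -
  have sets: "{0::real<..} \<in> sets lebesgue" by simp
  have "AE t in lebesgue_on {0<..}. (\<lambda>z\<in>unit_ball. G z t) \<in> class_M"
    using her by (simp add: herglotz_vector_field_def)
  then obtain N where N: "negligible N" "\<forall>t\<in>{0<..} - N. (\<lambda>z\<in>unit_ball. G z t) \<in> class_M"
    unfolding AE_lebesgue_on_iff_negligible[OF sets] by blast
  have NS: "N \<in> sets lebesgue" using N(1) by (simp add: negligible_iff_null_sets null_sets_def)
  define A where "A = {0<..} - N"
  have A: "A \<in> sets lebesgue" using NS by (auto simp: A_def)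
  define G' where "G' z t = (if t \<in> A then G z t else - z)" for z t
  have "nice_field G'"
    unfolding nice_field_def
  proof (intro conjI allI ballI)
    show "(\<lambda>z\<in>unit_ball. G' z t) \<in> class_M" for t
    proof (cases "t \<in> A")
      case True
      then have "(\<lambda>z\<in>unit_ball. G z t) \<in> class_M" using N(2) by (simp add: A_def)
      then show ?thesis using True by (simp add: G'_def)
    qed (simp add: G'_def uminus_in_class_M)
    fix z :: "complex ^ 'n" assume z: "z \<in> unit_ball"
    have m: "G z \<in> borel_measurable (lebesgue_on {0<..})"
      using her z by (simp add: herglotz_vector_field_def)
    have mA: "G z \<in> borel_measurable (lebesgue_on A)"
      by (rule measurable_restrict_mono[OF m]) (auto simp: A_def)
    have "(\<lambda>t. if t \<in> A then G z t else - z) \<in> borel_measurable lebesgue"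
      using A mA measurable_If_restrict_space_iff[of lebesgue "\<lambda>t. t \<in> A" "G z" "\<lambda>_. - z" borel] by simp
    then show "G' z \<in> borel_measurable lebesgue" by (simp add: G'_def[abs_def])
  qed
  then show ?thesis using N(1) by (intro that[of G' N]) (auto simp: G'_def A_def)
qed

text \<open>On \<open>{0..t}\<close> the trajectory is compact in the open ball, so the field is
  bounded along it; an absolutely continuous curve with bounded derivative is Lipschitz, and
  uniqueness applies.\<close>

lemma evolution_eq_ev:
  fixes G G' :: "complex ^ 'n \<Rightarrow> real \<Rightarrow> complex ^ 'n"
  assumes evo: "evolution G \<phi>" and G': "nice_field G'" and N: "negligible N"
    and eq: "\<And>z t. \<lbrakk>z \<in> unit_ball; 0 < t; t \<notin> N\<rbrakk> \<Longrightarrow> G' z t = G z t"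
    and z: "z \<in> unit_ball" and t: "0 \<le> t"
  shows "\<phi> t z = ev G' t z"
proof -
  define x where "x t = \<phi> t z" for t
  have x: "x 0 = z" "\<And>t. t \<ge> 0 \<Longrightarrow> x t \<in> unit_ball" "abs_continuous_on 0 t x"
    "AE t in lebesgue_on {0..}. (x has_vector_derivative G (x t) t) (at t)"
    using evo z t unfolding evolution_def x_def by auto
  have sets: "{0::real..} \<in> sets lebesgue" by simp
  obtain N' where N': "negligible N'" "\<forall>s\<in>{0..} - N'. (x has_vector_derivative G (x s) s) (at s)"
    using x(4) unfolding AE_lebesgue_on_iff_negligible[OF sets] by blast
  have cont: "continuous_on {0..t} x" by (rule abs_continuous_on_continuous_on[OF x(3)])
  have "x ` {0..t} \<subseteq> ball 0 1" using x(2) by auto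
  then obtain r where r: "0 < r" "r < 1" "x ` {0..t} \<subseteq> cball 0 r"
    using compact_subset_ball_cball[OF compact_continuous_image[OF cont compact_Icc] _ zero_less_one] by blast
  define C where "C = field_const TYPE(complex ^ 'n) r + 1"
  have der: "(x has_vector_derivative G' (x s) s) (at s)" if "s \<in> {0..t} - (N \<union> N' \<union> {0})" for s
    using N'(2) eq[of "x s" s] x(2)[of s] that by auto
  have neg: "negligible (N \<union> N' \<union> {0})" using N N'(1) by simp
  have "norm (x v - x u) \<le> C * (v - u)" if uv: "0 \<le> u" "u \<le> v" "v \<le> t" for u v
  proof -
    define g where "g s = (if s \<in> N \<union> N' \<union> {0} then 0 else G' (x s) s)" for s
    have "(g has_integral (x v - x u)) {u..v}"
    proof (rule abs_continuous_on_has_integral[OF uv(2) _ neg])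
      show "abs_continuous_on u v x" by (rule abs_continuous_on_subinterval[OF x(3)]) (use uv in auto)
      show "(x has_vector_derivative g s) (at s within {u..v})" if "s \<in> {u..v} - (N \<union> N' \<union> {0})" for s
        using der[of s] that uv by (auto simp: g_def intro: has_vector_derivative_at_within)
    qed
    moreover have "norm (g s) \<le> C" if "s \<in> {u..v}" for s
    proof -
      have "x s \<in> x ` {0..t}" using that uv by auto
      then have "norm (x s) \<le> r" using r(3) by auto
      from nice_field_bound[OF G' r(1,2) refl this, of s]
      show ?thesis using field_const_nonneg[OF G' r(1,2) refl] by (simp add: g_def C_def)
    qed
    moreover have "C \<ge> 0" using field_const_nonneg[OF G' r(1,2) refl] by (simp add: C_def)
    ultimately have "norm (x v - x u) \<le> C * content {u..v}"
      by (intro has_integral_bound_real[of C "{}" g]) simp_all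
    then show ?thesis using uv by simp
  qed
  note * = this
  have "C-lipschitz_on {0..t} x"
  proof (rule lipschitz_onI)
    fix u v assume "u \<in> {0..t}" "v \<in> {0..t}"
    then show "dist (x u) (x v) \<le> C * dist u v"
      using *[of u v] *[of v u] by (cases "u \<le> v") (auto simp: dist_norm norm_minus_commute)
  next
    show "0 \<le> C" using field_const_nonneg[OF G' r(1,2) refl] by (simp add: C_def)
  qed
  then have "solves G' t x"
    unfolding solves_def using x(2) der neg by (intro conjI exI[of _ "N \<union> N' \<union> {0}"]) auto
  from ev_unique[OF G' this t order_refl] show ?thesis by (simp add: x(1)) (simp add: x_def)
qed

subsection \<open>Complex derivatives of functionals\<close>

text \<open>The generated topology is unfolded, by induction over its construction, into uniform
  closeness on a compact set. That open sets consist of holomorphic maps is what later supplies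
  holomorphy of the members of \<open>class_S0\<close>.\<close>

lemma Hol_topology_nbhd:
  fixes F :: "complex ^ 'n \<Rightarrow> complex ^ 'n"
  assumes U: "openin Hol_topology U" and F: "F \<in> U"
  shows "F \<in> Hol" and "\<exists>K \<eta>. compact K \<and> K \<subseteq> unit_ball \<and> \<eta> > 0 \<and>
     (\<forall>g\<in>Hol. (\<forall>z\<in>K. norm (g z - F z) < \<eta>) \<longrightarrow> g \<in> U)"
proof -
  define S where "S = {{f \<in> (Hol :: (complex ^ 'n \<Rightarrow> complex ^ 'n) set). f ` K \<subseteq> V} | K V. compact K \<and> K \<subseteq> unit_ball \<and> open V}"
  have gen: "generate_topology_on S U"
    using U unfolding Hol_topology_def S_def by (simp add: openin_topology_generated_by_iff)
  have main: "U \<subseteq> Hol \<and> (\<forall>F\<in>U. \<exists>K \<eta>. compact K \<and> K \<subseteq> unit_ball \<and> \<eta> > 0 \<and>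
     (\<forall>g\<in>Hol. (\<forall>z\<in>K. norm (g z - F z) < \<eta>) \<longrightarrow> g \<in> U))"
    using gen
  proof (induction rule: generate_topology_on.induct)
    case Empty
    then show ?case by simp
  next
    case (Int a b)
    show ?case
    proof (intro conjI ballI)
      show "a \<inter> b \<subseteq> Hol" using Int.IH by blast
      fix F assume "F \<in> a \<inter> b"
      then obtain K1 e1 K2 e2 where 1: "compact K1" "K1 \<subseteq> unit_ball" "e1 > 0"
         "\<forall>g\<in>Hol. (\<forall>z\<in>K1. norm (g z - F z) < e1) \<longrightarrow> g \<in> a"
         and 2: "compact K2" "K2 \<subseteq> unit_ball" "e2 > 0"
         "\<forall>g\<in>Hol. (\<forall>z\<in>K2. norm (g z - F z) < e2) \<longrightarrow> g \<in> b"
        using Int.IH by blast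
      show "\<exists>K \<eta>. compact K \<and> K \<subseteq> unit_ball \<and> \<eta> > 0 \<and>
         (\<forall>g\<in>Hol. (\<forall>z\<in>K. norm (g z - F z) < \<eta>) \<longrightarrow> g \<in> a \<inter> b)"
        by (rule exI[of _ "K1 \<union> K2"], rule exI[of _ "min e1 e2"]) (use 1 2 in auto)
    qed
  next
    case (UN K)
    show ?case
    proof (intro conjI ballI)
      show "\<Union>K \<subseteq> Hol" using UN.IH by blast
      fix F assume "F \<in> \<Union>K"
      then obtain k where k: "k \<in> K" "F \<in> k" by blast
      obtain K1 e1 where "compact K1" "K1 \<subseteq> unit_ball" "e1 > 0"
         "\<forall>g\<in>Hol. (\<forall>z\<in>K1. norm (g z - F z) < e1) \<longrightarrow> g \<in> k"
        using UN.IH[OF k(1)] k(2) by blast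
      then show "\<exists>K1 \<eta>. compact K1 \<and> K1 \<subseteq> unit_ball \<and> \<eta> > 0 \<and>
         (\<forall>g\<in>Hol. (\<forall>z\<in>K1. norm (g z - F z) < \<eta>) \<longrightarrow> g \<in> \<Union>K)"
        using k(1) by blast
    qed
  next
    case (Basis s)
    then obtain K V where s: "s = {f \<in> Hol. f ` K \<subseteq> V}" "compact K" "K \<subseteq> unit_ball" "open V"
      unfolding S_def by blast
    show ?case
    proof (intro conjI ballI)
      show "s \<subseteq> Hol" using s by blast
      fix F assume F: "F \<in> s"
      then have FH: "F \<in> Hol" "F ` K \<subseteq> V" using s by auto
      have "continuous_on K F"
        using hol_on_continuous_on[of F unit_ball] FH(1) s(3) unfolding Hol_iff by (blast intro: continuous_on_subset)
      then have "compact (F ` K)" using s(2) by (rule compact_continuous_image)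
      then obtain e where e: "e > 0" "(\<Union>x\<in>F ` K. ball x e) \<subseteq> V"
        using compact_subset_open_imp_ball_epsilon_subset[OF _ s(4) FH(2)] by blast
      have "g \<in> s" if g: "g \<in> Hol" "\<forall>z\<in>K. norm (g z - F z) < e" for g
      proof -
        have "g z \<in> V" if "z \<in> K" for z
        proof -
          have "g z \<in> ball (F z) e" using g(2) that by (simp add: dist_norm norm_minus_commute)
          then show ?thesis using e(2) that by blast
        qed
        then show ?thesis using g(1) s(1) by blast
      qed
      then show "\<exists>K \<eta>. compact K \<and> K \<subseteq> unit_ball \<and> \<eta> > 0 \<and>
         (\<forall>g\<in>Hol. (\<forall>z\<in>K. norm (g z - F z) < \<eta>) \<longrightarrow> g \<in> s)"
        using s(2,3) e(1) by blast
    qed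
  qed
  show "F \<in> Hol" by (rule subsetD[OF main[THEN conjunct1] F])
  show "\<exists>K \<eta>. compact K \<and> K \<subseteq> unit_ball \<and> \<eta> > 0 \<and>
     (\<forall>g\<in>Hol. (\<forall>z\<in>K. norm (g z - F z) < \<eta>) \<longrightarrow> g \<in> U)"
    by (rule bspec[OF main[THEN conjunct2] F])
qed

lemma topspace_Hol_topology: "topspace Hol_topology = (Hol :: (complex ^ 'n \<Rightarrow> complex ^ 'n) set)"
proof
  show "topspace Hol_topology \<subseteq> (Hol :: (complex ^ 'n \<Rightarrow> complex ^ 'n) set)"
    by (rule subsetI) (rule Hol_topology_nbhd(1)[OF openin_topspace])
  have "openin Hol_topology {f \<in> (Hol :: (complex ^ 'n \<Rightarrow> complex ^ 'n) set). f ` {} \<subseteq> UNIV}"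
    unfolding Hol_topology_def
    by (rule topology_generated_by_Basis, rule CollectI, rule exI[of _ "{}"], rule exI[of _ UNIV]) simp
  from openin_subset[OF this] show "(Hol :: (complex ^ 'n \<Rightarrow> complex ^ 'n) set) \<subseteq> topspace Hol_topology" by simp
qed

lemma Hol_comb:
  assumes "f \<in> Hol" "h \<in> Hol"
  shows "(\<lambda>z\<in>unit_ball. f z + c *s h z) \<in> Hol"
  using assms by (intro restrict_in_Hol hol_on_add hol_on_smult) (simp_all add: Hol_iff)

section \<open>The derivative at \<open>F\<close> as a continuous complex linear functional\<close>

locale functional_derivative =
  fixes \<Phi> :: "(complex ^ 'n \<Rightarrow> complex ^ 'n) \<Rightarrow> complex"
    and V :: "(complex ^ 'n \<Rightarrow> complex ^ 'n) set"
    and \<Lambda> :: "(complex ^ 'n \<Rightarrow> complex ^ 'n) \<Rightarrow> (complex ^ 'n \<Rightarrow> complex ^ 'n) \<Rightarrow> complex"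
    and F :: "complex ^ 'n \<Rightarrow> complex ^ 'n"
  assumes V: "openin Hol_topology V" and F: "F \<in> V"
    and diff: "\<And>f h. f \<in> V \<Longrightarrow> h \<in> Hol \<Longrightarrow> differentiable_along \<Phi> f h (\<Lambda> f h)"
    and cont: "continuous_map (prod_topology (subtopology Hol_topology V) Hol_topology) euclidean (\<lambda>(f, h). \<Lambda> f h)"
begin

lemma F_Hol: "F \<in> Hol" using Hol_topology_nbhd(1)[OF V F] .

lemma V_Hol: "f \<in> V \<Longrightarrow> f \<in> Hol" using Hol_topology_nbhd(1)[OF V] .

lemma functional_derivative_continuity:
  assumes h: "h \<in> Hol" and e: "e > 0"
  shows "\<exists>K \<eta>. compact K \<and> K \<subseteq> unit_ball \<and> \<eta> > 0 \<and>
    (\<forall>g\<in>Hol. \<forall>k\<in>Hol. (\<forall>z\<in>K. norm (g z - F z) < \<eta> \<and> norm (k z - h z) < \<eta>)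
       \<longrightarrow> g \<in> V \<and> norm (\<Lambda> g k - \<Lambda> F h) < e)"
proof -
  let ?X = "prod_topology (subtopology Hol_topology V) (Hol_topology :: (complex ^ 'n \<Rightarrow> complex ^ 'n) topology)"
  have top: "topspace ?X = V \<times> Hol"
    using V_Hol by (auto simp: topspace_prod_topology topspace_subtopology topspace_Hol_topology)
  define W where "W = {p \<in> topspace ?X. (case p of (f, h) \<Rightarrow> \<Lambda> f h) \<in> ball (\<Lambda> F h) e}"
  have W: "openin ?X W"
    unfolding W_def using cont by (rule openin_continuous_map_preimage) (simp add: open_openin[symmetric])
  have FW: "(F, h) \<in> W" unfolding W_def top using F h e by simp
  obtain A B where A: "openin (subtopology Hol_topology V) A" "F \<in> A" and B: "openin Hol_topology B" "h \<in> B"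
    and AB: "A \<times> B \<subseteq> W"
    using W[unfolded openin_prod_topology_alt, rule_format, OF FW] by blast
  obtain A' where A': "openin Hol_topology A'" "A = A' \<inter> V" using A(1) by (auto simp: openin_subtopology)
  have A'': "openin Hol_topology A" using A' V by (simp add: openin_Int)
  obtain K1 e1 where 1: "compact K1" "K1 \<subseteq> unit_ball" "e1 > 0"
         "\<forall>g\<in>Hol. (\<forall>z\<in>K1. norm (g z - F z) < e1) \<longrightarrow> g \<in> A"
    using Hol_topology_nbhd(2)[OF A'' A(2)] by blast
  obtain K2 e2 where 2: "compact K2" "K2 \<subseteq> unit_ball" "e2 > 0"
         "\<forall>g\<in>Hol. (\<forall>z\<in>K2. norm (g z - h z) < e2) \<longrightarrow> g \<in> B"
    using Hol_topology_nbhd(2)[OF B] by blast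
  have "g \<in> V \<and> norm (\<Lambda> g k - \<Lambda> F h) < e"
    if g: "g \<in> Hol" "k \<in> Hol" "\<forall>z\<in>K1 \<union> K2. norm (g z - F z) < min e1 e2 \<and> norm (k z - h z) < min e1 e2" for g k
  proof -
    have "g \<in> A" using 1(4) g by simp
    moreover have "k \<in> B" using 2(4) g by simp
    ultimately have "(g, k) \<in> W" using AB by blast
    then show ?thesis unfolding W_def top by (simp add: dist_norm norm_minus_commute)
  qed
  then show ?thesis using 1 2 by (intro exI[of _ "K1 \<union> K2"] exI[of _ "min e1 e2"]) auto
qed

text \<open>Base point and direction may both move. Along the real segment from \<open>f m\<close>
  in direction \<open>h m\<close> the real part of \<open>\<Phi>\<close> is differentiable, so the
  quotient equals \<open>Re (\<Lambda> (g \<xi>) (h m))\<close> at an intermediate point, which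
  joint continuity compares with \<open>Re (\<Lambda> F H)\<close>. Real parts are taken because the
  mean value theorem needs real values.\<close>

lemma directional_limit:
  fixes f h :: "nat \<Rightarrow> complex ^ 'n \<Rightarrow> complex ^ 'n" and \<epsilon> :: "nat \<Rightarrow> real"
  assumes \<epsilon>: "\<And>m. \<epsilon> m > 0" "\<epsilon> \<longlonglongrightarrow> 0" and f: "\<And>m. f m \<in> Hol" and h: "\<And>m. h m \<in> Hol" and H: "H \<in> Hol"
    and fF: "\<And>K. compact K \<Longrightarrow> K \<subseteq> unit_ball \<Longrightarrow> uniform_limit K f F sequentially"
    and hH: "\<And>K. compact K \<Longrightarrow> K \<subseteq> unit_ball \<Longrightarrow> uniform_limit K h H sequentially"
  shows "(\<lambda>m. (Re (\<Phi> (\<lambda>z\<in>unit_ball. f m z + of_real (\<epsilon> m) *s h m z)) - Re (\<Phi> (f m))) / \<epsilon> m)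
     \<longlonglongrightarrow> Re (\<Lambda> F H)"
proof (rule LIMSEQ_I)
  fix e :: real assume e: "e > 0"
  obtain K \<eta> where K: "compact K" "K \<subseteq> unit_ball" and \<eta>: "\<eta> > 0" and
    close: "\<And>g k. \<lbrakk>g \<in> Hol; k \<in> Hol; \<forall>z\<in>K. norm (g z - F z) < \<eta> \<and> norm (k z - H z) < \<eta>\<rbrakk>
       \<Longrightarrow> g \<in> V \<and> norm (\<Lambda> g k - \<Lambda> F H) < e"
    using functional_derivative_continuity[OF H e] by blast
  have "continuous_on K H"
    using hol_on_continuous_on[of H unit_ball] H K(2) unfolding Hol_iff by (blast intro: continuous_on_subset)
  then have "bounded (H ` K)" using K(1) by (intro compact_imp_bounded compact_continuous_image)
  then obtain B where B: "B > 0" "\<And>z. z \<in> K \<Longrightarrow> norm (H z) \<le> B" unfolding bounded_pos by auto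
  \<comment> \<open>Half of \<open>\<eta>\<close> is reserved for the base point and half for the
    displacement along the segment, where directions are bounded by \<open>B + \<eta>\<close> on
    \<open>K\<close>; hence the threshold for \<open>\<epsilon> m\<close>.\<close>
  have \<eta>2: "\<eta> / 2 > 0" using \<eta> by simp
  have "\<forall>\<^sub>F m in sequentially. \<epsilon> m < \<eta> / (2 * (B + \<eta>))"
    using \<epsilon>(2) \<eta> B(1) by (intro order_tendstoD(2)) auto
  moreover have "\<forall>\<^sub>F m in sequentially. \<forall>z\<in>K. dist (f m z) (F z) < \<eta> / 2"
    by (rule uniform_limitD[OF fF[OF K] \<eta>2])
  moreover have "\<forall>\<^sub>F m in sequentially. \<forall>z\<in>K. dist (h m z) (H z) < \<eta>"
    by (rule uniform_limitD[OF hH[OF K] \<eta>])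
  ultimately have "\<forall>\<^sub>F m in sequentially. norm ((Re (\<Phi> (\<lambda>z\<in>unit_ball. f m z + of_real (\<epsilon> m) *s h m z)) - Re (\<Phi> (f m))) / \<epsilon> m - Re (\<Lambda> F H)) < e"
  proof eventually_elim
    case (elim m)
    define g where "g s = (\<lambda>z\<in>unit_ball. f m z + of_real s *s h m z)" for s :: real
    have gH: "g s \<in> Hol" for s unfolding g_def by (rule Hol_comb[OF f h])
    have near: "g s \<in> V \<and> norm (\<Lambda> (g s) (h m) - \<Lambda> F H) < e" if s: "0 \<le> s" "s \<le> \<epsilon> m" for s
    proof (rule close[OF gH h], intro ballI conjI)
      fix z assume z: "z \<in> K"
      then have zb: "z \<in> unit_ball" using K(2) by blast
      show dh: "norm (h m z - H z) < \<eta>" using elim(3) z by (simp add: dist_norm)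
      then have "norm (h m z) \<le> B + \<eta>"
        using B(2)[OF z] norm_triangle_ineq[of "H z" "h m z - H z"] by simp
      then have "s * norm (h m z) \<le> \<epsilon> m * (B + \<eta>)" using s by (intro mult_mono) auto
      also have "\<dots> < \<eta> / 2" using elim(1) B(1) \<eta> by (simp add: pos_less_divide_eq mult_ac)
      finally have "s * norm (h m z) < \<eta> / 2" .
      moreover have "norm (f m z - F z) < \<eta> / 2" using elim(2) z by (simp add: dist_norm)
      moreover have "norm (g s z - F z) \<le> norm (f m z - F z) + s * norm (h m z)"
        using norm_triangle_ineq[of "f m z - F z" "s *\<^sub>R h m z"] zb s
        by (simp add: g_def vector_smult_of_real algebra_simps)
      ultimately show "norm (g s z - F z) < \<eta>" by linarith
    qed
    have "((\<lambda>s. Re (\<Phi> (g s))) has_real_derivative Re (\<Lambda> (g s) (h m))) (at s)" if s: "0 \<le> s" "s \<le> \<epsilon> m" for s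
    proof -
      have comb: "(\<lambda>z\<in>unit_ball. g s z + of_real \<delta> *s h m z) = g (s + \<delta>)" for \<delta> :: real
        unfolding g_def by (rule restrict_ext) (simp add: vector_sadd_rdistrib)
      have "((\<lambda>\<delta>. (\<Phi> (\<lambda>z\<in>unit_ball. g s z + \<delta> *s h m z) - \<Phi> (g s)) / \<delta>) \<longlongrightarrow> \<Lambda> (g s) (h m)) (at 0)"
        using diff[of "g s" "h m"] near[OF s] h unfolding differentiable_along_def by blast
      moreover have "filterlim complex_of_real (at 0) (at 0)"
        by (auto simp: filterlim_at eventually_at_filter intro!: tendsto_eq_intros)
      ultimately have "((\<lambda>\<delta>. (\<Phi> (\<lambda>z\<in>unit_ball. g s z + of_real \<delta> *s h m z) - \<Phi> (g s)) / of_real \<delta>) \<longlongrightarrow> \<Lambda> (g s) (h m)) (at 0)"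
        by (rule filterlim_compose)
      then have "((\<lambda>\<delta>. Re ((\<Phi> (g (s + \<delta>)) - \<Phi> (g s)) / of_real \<delta>)) \<longlongrightarrow> Re (\<Lambda> (g s) (h m))) (at 0)"
        unfolding comb by (rule tendsto_Re)
      then show ?thesis by (simp add: DERIV_def)
    qed
    then obtain \<xi> where \<xi>: "0 < \<xi>" "\<xi> < \<epsilon> m"
      "Re (\<Phi> (g (\<epsilon> m))) - Re (\<Phi> (g 0)) = (\<epsilon> m - 0) * Re (\<Lambda> (g \<xi>) (h m))"
      using MVT2[OF \<epsilon>(1), of m "\<lambda>s. Re (\<Phi> (g s))" "\<lambda>s. Re (\<Lambda> (g s) (h m))"] by blast
    have "g 0 = f m"
      using f[of m] by (auto simp: g_def Hol_iff fun_eq_iff extensional_def)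
    then have "(Re (\<Phi> (g (\<epsilon> m))) - Re (\<Phi> (f m))) / \<epsilon> m = Re (\<Lambda> (g \<xi>) (h m))"
      using \<xi>(3) \<epsilon>(1)[of m] by simp
    moreover have "\<bar>Re (\<Lambda> (g \<xi>) (h m)) - Re (\<Lambda> F H)\<bar> < e"
      using abs_Re_le_cmod[of "\<Lambda> (g \<xi>) (h m) - \<Lambda> F H"] near[of \<xi>] \<xi> by simp
    ultimately show ?case by (simp add: g_def)
  qed
  then show "\<exists>no. \<forall>m\<ge>no. norm ((Re (\<Phi> (\<lambda>z\<in>unit_ball. f m z + of_real (\<epsilon> m) *s h m z)) - Re (\<Phi> (f m))) / \<epsilon> m - Re (\<Lambda> F H)) < e"
    by (simp add: eventually_sequentially)
qed

text \<open>Restricting first lets \<open>L\<close> act on formulas defined on the whole space, with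
  a value depending only on the ball.\<close>

definition L :: "(complex ^ 'n \<Rightarrow> complex ^ 'n) \<Rightarrow> complex" where
  "L h = \<Lambda> F (restrict h unit_ball)"

lemma L_eqI: "(\<And>z. z \<in> unit_ball \<Longrightarrow> h z = k z) \<Longrightarrow> L h = L k"
  unfolding L_def by (metis restrict_ext)

lemma differentiable_along_L:
  assumes "hol_on h unit_ball"
  shows "((\<lambda>\<delta>. (\<Phi> (\<lambda>z\<in>unit_ball. F z + \<delta> *s h z) - \<Phi> F) / \<delta>) \<longlongrightarrow> L h) (at 0)"
proof -
  have "(\<lambda>z\<in>unit_ball. F z + \<delta> *s restrict h unit_ball z) = (\<lambda>z\<in>unit_ball. F z + \<delta> *s h z)" for \<delta>
    by (rule restrict_ext) simp
  then show ?thesis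
    using diff[OF F restrict_in_Hol[OF assms]] unfolding differentiable_along_def L_def by simp
qed

lemma L_smult:
  assumes h: "hol_on h unit_ball"
  shows "L (\<lambda>z. c *s h z) = c * L h"
proof (rule tendsto_unique[OF _ differentiable_along_L[OF hol_on_smult[OF h]]])
  show "((\<lambda>\<delta>. (\<Phi> (\<lambda>z\<in>unit_ball. F z + \<delta> *s (c *s h z)) - \<Phi> F) / \<delta>) \<longlongrightarrow> c * L h) (at 0)"
  proof (cases "c = 0")
    case True
    have "(\<lambda>z\<in>unit_ball. F z) = F" using F_Hol by (auto simp: Hol_iff fun_eq_iff extensional_def)
    then show ?thesis using True by simp
  next
    case False
    have "filterlim (\<lambda>\<delta>. \<delta> * c) (at 0) (at 0)"
      using False by (auto simp: filterlim_at eventually_at_filter intro!: tendsto_eq_intros)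
    from tendsto_mult[OF tendsto_const[of c] filterlim_compose[OF differentiable_along_L[OF h] this]]
    show ?thesis using False by (simp add: vector_smult_assoc)
  qed
qed simp

lemma L_zero: "L (\<lambda>_. 0) = 0"
  using L_smult[OF hol_on_const[of 0], of 0] by simp

text \<open>The step from \<open>F\<close> in direction \<open>h + k\<close> is split into a step
  along \<open>h\<close> and then one along \<open>k\<close> from the displaced base point
  \<open>f m\<close>; \<open>directional_limit\<close> permits this moving base point.\<close>

lemma Re_L_add:
  assumes h: "hol_on h unit_ball" and k: "hol_on k unit_ball"
  shows "Re (L (\<lambda>z. h z + k z)) = Re (L h) + Re (L k)"
proof -
  define \<epsilon> where "\<epsilon> m = inverse (real (Suc m))" for m
  have \<epsilon>: "\<And>m. \<epsilon> m > 0" "\<epsilon> \<longlonglongrightarrow> 0" unfolding \<epsilon>_def by (simp, rule LIMSEQ_inverse_real_of_nat)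
  define h' k' s' where "h' = restrict h unit_ball" and "k' = restrict k unit_ball"
    and "s' = restrict (\<lambda>z. h z + k z) unit_ball"
  have H: "h' \<in> Hol" "k' \<in> Hol" "s' \<in> Hol"
    unfolding h'_def k'_def s'_def by (intro restrict_in_Hol hol_on_add h k)+
  define f where "f m = (\<lambda>z\<in>unit_ball. F z + of_real (\<epsilon> m) *s h' z)" for m
  have f: "f m \<in> Hol" for m unfolding f_def by (rule Hol_comb[OF F_Hol H(1)])
  have fF: "uniform_limit K f F sequentially" if K: "compact K" "K \<subseteq> unit_ball" for K
  proof -
    have "continuous_on K h" using hol_on_continuous_on[OF h] K(2) by (rule continuous_on_subset)
    then have "bounded (h ` K)" using K(1) by (intro compact_imp_bounded compact_continuous_image)
    then obtain B where B: "\<And>z. z \<in> K \<Longrightarrow> norm (h z) \<le> B" unfolding bounded_pos by auto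
    show ?thesis
    proof (rule uniform_limitI_bound[where b = "\<lambda>m. \<epsilon> m * B"])
      have "norm (f m z - F z) \<le> \<epsilon> m * B" if z: "z \<in> K" for m z
      proof -
        have "z \<in> unit_ball" using z K by blast
        then have "norm (f m z - F z) = \<epsilon> m * norm (h z)"
          using \<epsilon>(1)[of m] by (simp add: f_def h'_def norm_vector_smult)
        then show ?thesis using B[OF z] \<epsilon>(1)[of m] by simp
      qed
      then show "\<forall>\<^sub>F m in sequentially. \<forall>z\<in>K. norm (f m z - F z) \<le> \<epsilon> m * B" by (intro always_eventually) blast
      show "(\<lambda>m. \<epsilon> m * B) \<longlonglongrightarrow> 0" by (rule tendsto_mult_left_zero[OF \<epsilon>(2)])
    qed
  qed
  have const: "uniform_limit K (\<lambda>_. G) G sequentially" for K and G :: "complex ^ 'n \<Rightarrow> complex ^ 'n"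
    by (rule uniform_limit_const)
  have 1: "(\<lambda>m. (Re (\<Phi> (\<lambda>z\<in>unit_ball. F z + of_real (\<epsilon> m) *s h' z)) - Re (\<Phi> F)) / \<epsilon> m) \<longlonglongrightarrow> Re (\<Lambda> F h')"
    by (rule directional_limit[OF \<epsilon> F_Hol H(1) H(1) const const])
  have 2: "(\<lambda>m. (Re (\<Phi> (\<lambda>z\<in>unit_ball. f m z + of_real (\<epsilon> m) *s k' z)) - Re (\<Phi> (f m))) / \<epsilon> m) \<longlonglongrightarrow> Re (\<Lambda> F k')"
    by (rule directional_limit[OF \<epsilon> f H(2) H(2) fF const])
  have 3: "(\<lambda>m. (Re (\<Phi> (\<lambda>z\<in>unit_ball. F z + of_real (\<epsilon> m) *s s' z)) - Re (\<Phi> F)) / \<epsilon> m) \<longlonglongrightarrow> Re (\<Lambda> F s')"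
    by (rule directional_limit[OF \<epsilon> F_Hol H(3) H(3) const const])
  have eq: "(\<lambda>z\<in>unit_ball. F z + of_real (\<epsilon> m) *s s' z) = (\<lambda>z\<in>unit_ball. f m z + of_real (\<epsilon> m) *s k' z)" for m
    by (rule restrict_ext) (simp add: f_def h'_def k'_def s'_def vector_add_ldistrib)
  have "(\<lambda>m. (Re (\<Phi> (\<lambda>z\<in>unit_ball. F z + of_real (\<epsilon> m) *s s' z)) - Re (\<Phi> F)) / \<epsilon> m) \<longlonglongrightarrow> Re (\<Lambda> F k') + Re (\<Lambda> F h')"
    using tendsto_add[OF 2 1] unfolding eq f_def[symmetric] by (simp add: add_divide_distrib[symmetric])
  from LIMSEQ_unique[OF 3 this] show ?thesis by (simp add: L_def h'_def k'_def s'_def)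
qed

lemma L_add:
  assumes h: "hol_on h unit_ball" and k: "hol_on k unit_ball"
  shows "L (\<lambda>z. h z + k z) = L h + L k"
proof (rule complex_eqI)
  show "Re (L (\<lambda>z. h z + k z)) = Re (L h + L k)" by (simp add: Re_L_add[OF h k])
  \<comment> \<open>Complex homogeneity turns an imaginary part into a real part, so additivity of
    real parts suffices.\<close>
  have Im: "Im (L f) = - Re (L (\<lambda>z. \<i> *s f z))" if "hol_on f unit_ball" for f
    using L_smult[OF that, of \<i>] by simp
  have "Re (L (\<lambda>z. \<i> *s h z + \<i> *s k z)) = Re (L (\<lambda>z. \<i> *s h z)) + Re (L (\<lambda>z. \<i> *s k z))"
    by (intro Re_L_add hol_on_smult h k)
  then show "Im (L (\<lambda>z. h z + k z)) = Im (L h + L k)"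
    using Im[OF h] Im[OF k] Im[OF hol_on_add[OF h k]] by (simp add: vector_add_ldistrib)
qed

lemma L_diff:
  assumes h: "hol_on h unit_ball" and k: "hol_on k unit_ball"
  shows "L (\<lambda>z. h z - k z) = L h - L k"
  using L_add[OF h hol_on_smult[OF k, of "-1"]] L_smult[OF k, of "-1"]
  by (simp add: vector_sneg_minus1[symmetric])

text \<open>Continuity in the direction at the zero map bounds \<open>L\<close> by 1 on maps that
  are small on a compact set; homogeneity rescales this to a linear bound by the maximum on that
  set.\<close>

lemma L_bounded:
  obtains K C where "compact K" "K \<subseteq> unit_ball" "C \<ge> 0"
    "\<And>h \<eta>. \<lbrakk>hol_on h unit_ball; \<eta> > 0; \<And>z. z \<in> K \<Longrightarrow> norm (h z) \<le> \<eta>\<rbrakk> \<Longrightarrow> norm (L h) \<le> C * \<eta>"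
proof -
  define Z where "Z = restrict (\<lambda>_. 0 :: complex ^ 'n) (unit_ball :: (complex ^ 'n) set)"
  have Z: "Z \<in> Hol" unfolding Z_def by (intro restrict_in_Hol hol_on_const)
  have LZ: "\<Lambda> F Z = 0" using L_zero by (simp add: L_def Z_def)
  obtain K e where K: "compact K" "K \<subseteq> unit_ball" and e: "e > 0" and
    close: "\<And>g k. \<lbrakk>g \<in> Hol; k \<in> Hol; \<forall>z\<in>K. norm (g z - F z) < e \<and> norm (k z - Z z) < e\<rbrakk>
       \<Longrightarrow> g \<in> V \<and> norm (\<Lambda> g k - \<Lambda> F Z) < 1"
    using functional_derivative_continuity[OF Z zero_less_one] by blast
  show ?thesis
  proof (rule that[OF K, of "2 / e"])
    fix h :: "complex ^ 'n \<Rightarrow> complex ^ 'n" and \<eta> :: real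
    assume h: "hol_on h unit_ball" and \<eta>: "\<eta> > 0" and le: "\<And>z. z \<in> K \<Longrightarrow> norm (h z) \<le> \<eta>"
    define c where "c = complex_of_real (e / (2 * \<eta>))"
    have c: "norm c = e / (2 * \<eta>)" using e \<eta> by (simp only: c_def norm_of_real) simp
    define k where "k = restrict (\<lambda>z. c *s h z) unit_ball"
    have kH: "k \<in> Hol" unfolding k_def by (intro restrict_in_Hol hol_on_smult h)
    have "norm (k z - Z z) < e" if z: "z \<in> K" for z
    proof -
      have "norm (k z - Z z) = e / (2 * \<eta>) * norm (h z)"
        using z K by (simp add: k_def Z_def norm_vector_smult c subset_iff)
      also have "\<dots> \<le> e / (2 * \<eta>) * \<eta>" using e \<eta> le[OF z] by (intro mult_left_mono) auto
      also have "\<dots> < e" using e \<eta> by simp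
      finally show ?thesis .
    qed
    then have "norm (\<Lambda> F k) < 1" using close[OF F_Hol kH] e LZ by simp
    then have "norm (c * L h) < 1" using L_smult[OF h, of c] by (simp add: L_def k_def)
    then have "e / (2 * \<eta>) * norm (L h) < 1" by (simp add: norm_mult c)
    then show "norm (L h) \<le> 2 / e * \<eta>" using e \<eta> by (simp add: field_simps)
  qed (use e in simp)
qed

text \<open>The difference quotients serve as moving directions from the fixed base
  \<open>F\<close>, so that a step of size \<open>\<epsilon> m\<close> lands exactly on the
  competitor \<open>f m\<close>, where maximality applies.\<close>

lemma Re_L_nonpos:
  assumes max: "\<And>f. f \<in> S \<Longrightarrow> Re (\<Phi> f) \<le> Re (\<Phi> F)" and S: "S \<subseteq> Hol"
    and \<epsilon>: "\<And>m. \<epsilon> m > 0" "\<epsilon> \<longlonglongrightarrow> 0" and f: "\<And>m. f m \<in> S" and H: "hol_on H unit_ball"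
    and lim: "\<And>K. compact K \<Longrightarrow> K \<subseteq> unit_ball \<Longrightarrow>
      uniform_limit K (\<lambda>m z. (1 / \<epsilon> m) *\<^sub>R (f m z - F z)) H sequentially"
  shows "Re (L H) \<le> 0"
proof -
  define h where "h m = restrict (\<lambda>z. (1 / \<epsilon> m) *\<^sub>R (f m z - F z)) unit_ball" for m
  have fH: "f m \<in> Hol" for m using f S by blast
  have hH: "h m \<in> Hol" for m
    unfolding h_def using fH[of m] F_Hol by (intro restrict_in_Hol hol_on_scaleR hol_on_diff) (auto simp: Hol_iff)
  have HH: "restrict H unit_ball \<in> Hol" by (rule restrict_in_Hol[OF H])
  have hlim: "uniform_limit K h (restrict H unit_ball) sequentially" if K: "compact K" "K \<subseteq> unit_ball" for K
  proof (rule uniform_limit_cong'[THEN iffD1, OF _ _ lim[OF K]])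
    show "(1 / \<epsilon> m) *\<^sub>R (f m z - F z) = h m z" "H z = restrict H unit_ball z" if "z \<in> K" for m z
      using that K by (auto simp: h_def subset_iff)
  qed
  have "(\<lambda>m. (Re (\<Phi> (\<lambda>z\<in>unit_ball. F z + of_real (\<epsilon> m) *s h m z)) - Re (\<Phi> F)) / \<epsilon> m) \<longlonglongrightarrow> Re (\<Lambda> F (restrict H unit_ball))"
    by (rule directional_limit[OF \<epsilon> F_Hol hH HH uniform_limit_const hlim])
  moreover have "(\<lambda>z\<in>unit_ball. F z + of_real (\<epsilon> m) *s h m z) = f m" for m
  proof
    fix z show "(\<lambda>z\<in>unit_ball. F z + of_real (\<epsilon> m) *s h m z) z = f m z"
      using fH[of m] \<epsilon>(1)[of m]
      by (cases "z \<in> unit_ball") (auto simp: h_def vector_smult_of_real Hol_iff extensional_def)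
  qed
  ultimately have "(\<lambda>m. (Re (\<Phi> (f m)) - Re (\<Phi> F)) / \<epsilon> m) \<longlonglongrightarrow> Re (L H)" by (simp add: L_def)
  moreover have "(Re (\<Phi> (f m)) - Re (\<Phi> F)) / \<epsilon> m \<le> 0" for m
    using max[OF f[of m]] \<epsilon>(1)[of m] by (simp add: divide_nonpos_pos)
  ultimately show ?thesis by (intro LIMSEQ_le_const2) auto
qed

end

subsection \<open>Needle variations\<close>

text \<open>In time \<open>t\<close> a solution moves by at most \<open>L * t\<close>, so freezing
  the space variable changes the field by at most \<open>L * (L * t)\<close>, and the integral by
  the second-order term.\<close>

lemma solves_speed:
  fixes G :: "complex ^ 'n \<Rightarrow> real \<Rightarrow> complex ^ 'n"
  assumes G: "nice_field G" and x: "solves G b x" and t: "0 \<le> t" "t \<le> b"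
    and r: "0 < r" "r < 1" "norm (x 0) \<le> r" and L_def: "L = field_const TYPE(complex ^ 'n) r + 1"
  shows "norm (x t - x 0) \<le> L * t" and "norm (x t - x 0 - integral {0..t} (G (x 0))) \<le> L\<^sup>2 * t\<^sup>2"
proof -
  have L: "L \<ge> 0" using field_const_nonneg[OF G r(1,2) refl] by (simp add: L_def)
  obtain K N where X: "K-lipschitz_on {0..b} x" "\<forall>t\<in>{0..b}. x t \<in> unit_ball" "negligible N"
   "\<forall>t\<in>{0<..<b} - N. (x has_vector_derivative G (x t) t) (at t)"
    using x unfolding solves_def by blast
  have le_r: "norm (x u) \<le> r" if "0 \<le> u" "u \<le> b" for u
    using solves_norm_antimono[OF G x, of 0 u] that r by auto
  define f where "f u = (if u \<in> N then G (x 0) u else G (x u) u)" for u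
  have f: "(f has_integral (x u - x 0)) {0..u}" if u: "0 \<le> u" "u \<le> b" for u
  proof (rule lipschitz_on_ae_derivative_has_integral[OF u(1) _ X(3)])
    show "\<exists>C. C-lipschitz_on {0..u} x" using lipschitz_on_subset[OF X(1), of "{0..u}"] u by auto
    show "(x has_vector_derivative f s) (at s)" if "s \<in> {0<..<u} - N" for s
      using X(4) that u by (auto simp: f_def)
  qed
  have speed: "norm (x u - x 0) \<le> L * u" if u: "0 \<le> u" "u \<le> b" for u
  proof -
    have "norm (x u - x 0) \<le> L * content {0..u}"
    proof (rule has_integral_bound_real[OF L _ f[OF u], of "{}"])
      show "norm (f s) \<le> L" if "s \<in> {0..u} - {}" for s
        unfolding f_def L_def using nice_field_bound[OF G r(1,2) refl] le_r[of s] le_r[of 0] that u by auto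
    qed simp
    then show ?thesis using u by simp
  qed
  show "norm (x t - x 0) \<le> L * t" by (rule speed[OF t])
  have meas: "G (x 0) \<in> borel_measurable lebesgue"
  proof -
    have "x 0 \<in> unit_ball" using le_r[of 0] t r by auto
    then show ?thesis using G by (simp add: nice_field_def)
  qed
  have int: "G (x 0) integrable_on {0..t}"
    using measurable_bounded_lemma[OF meas, of "\<lambda>_. L" 0 t] nice_field_bound[OF G r(1,2) refl r(3)]
    unfolding L_def by auto
  have "((\<lambda>u. f u - G (x 0) u) has_integral (x t - x 0 - integral {0..t} (G (x 0)))) {0..t}"
    by (intro has_integral_diff f t integrable_integral int)
  moreover have "norm (f u - G (x 0) u) \<le> L\<^sup>2 * t" if u: "u \<in> {0..t}" for u
  proof (cases "u \<in> N")
    case True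
    then show ?thesis using t by (simp add: f_def)
  next
    case False
    have ub: "0 \<le> u" "u \<le> b" using u t by auto
    have "norm (f u - G (x 0) u) \<le> L * norm (x u - x 0)"
      using nice_field_lipschitz[OF G r(1,2) refl le_r[OF ub] r(3), of u] False by (simp add: f_def L_def)
    also have "\<dots> \<le> L * (L * u)" by (intro mult_left_mono speed[OF ub] L)
    also have "\<dots> \<le> L * (L * t)" using u L by (intro mult_left_mono) auto
    finally show ?thesis by (simp add: power2_eq_square mult.assoc)
  qed
  ultimately have "norm (x t - x 0 - integral {0..t} (G (x 0))) \<le> L\<^sup>2 * t * content {0..t}"
    using t by (intro has_integral_bound_real[of "L\<^sup>2 * t" "{}"]) auto
  then show "norm (x t - x 0 - integral {0..t} (G (x 0))) \<le> L\<^sup>2 * t\<^sup>2"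
    using t by (simp add: power2_eq_square mult_ac)
qed

lemma integral_time_shift:
  fixes f :: "real \<Rightarrow> 'a::euclidean_space"
  assumes "f integrable_on {a..b}"
  shows "integral {0..b - a} (\<lambda>t. f (t + a)) = integral {a..b} f"
proof -
  have "((\<lambda>t. f (1 *\<^sub>R t + a)) has_integral (1 / \<bar>1\<bar> ^ DIM(real)) *\<^sub>R integral {a..b} f)
     ((\<lambda>t. (1 / 1) *\<^sub>R t + - ((1 / 1) *\<^sub>R a)) ` cbox a b)"
    by (rule has_integral_affinity) (use assms in auto)
  moreover have "(\<lambda>t. t + - a) ` {a..b} = {0..b - a}"
    by (auto intro!: image_eqI[of _ _ "_ + a"])
  ultimately show ?thesis by (intro integral_unique) simp
qed

lemma nice_field_integrable:
  fixes G :: "complex ^ 'n \<Rightarrow> real \<Rightarrow> complex ^ 'n"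
  assumes G: "nice_field G" and z: "norm z < 1"
  shows "G z integrable_on {a..b}"
proof -
  define r where "r = (norm z + 1) / 2"
  have r: "0 < r" "r < 1" "norm z \<le> r" using z by (auto simp: r_def add_nonneg_pos)
  have "G z \<in> borel_measurable lebesgue" using G z by (simp add: nice_field_def)
  then show ?thesis
    using measurable_bounded_lemma[of "G z" "\<lambda>_. field_const TYPE(complex ^ 'n) r + 1" a b]
      nice_field_bound[OF G r(1,2) refl r(3)] by auto
qed

lemma ev_step:
  fixes G :: "complex ^ 'n \<Rightarrow> real \<Rightarrow> complex ^ 'n"
  assumes G: "nice_field G" and r: "0 < r" "r < 1" and z: "norm z \<le> r" and e: "0 \<le> e"
    and L_def: "L = field_const TYPE(complex ^ 'n) r + 1"
  shows "norm (ev (time_shift G (T - e)) e z - z) \<le> L * e"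
    and "norm (ev (time_shift G (T - e)) e z - z - integral {T - e..T} (G z)) \<le> L\<^sup>2 * e\<^sup>2"
proof -
  have z1: "norm z < 1" using z r by simp
  have S: "nice_field (time_shift G (T - e))" by (rule nice_field_time_shift[OF G])
  have "integral {0..e} (time_shift G (T - e) z) = integral {T - e..T} (G z)"
    using integral_time_shift[OF nice_field_integrable[OF G z1], where a = "T - e" and b = T]
    unfolding time_shift_def[abs_def] by (simp only: diff_diff_eq2 add_diff_cancel_left')
  then show "norm (ev (time_shift G (T - e)) e z - z) \<le> L * e"
    and "norm (ev (time_shift G (T - e)) e z - z - integral {T - e..T} (G z)) \<le> L\<^sup>2 * e\<^sup>2"
    using solves_speed[OF S ev_solves[OF S z1 e] e order_refl r _ L_def] z by (simp_all add: ev_0[OF S z1])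
qed

definition needle :: "(complex ^ 'n \<Rightarrow> real \<Rightarrow> complex ^ 'n) \<Rightarrow> (complex ^ 'n \<Rightarrow> complex ^ 'n) \<Rightarrow>
    real \<Rightarrow> real \<Rightarrow> complex ^ 'n \<Rightarrow> real \<Rightarrow> complex ^ 'n" where
  "needle G h T e = (\<lambda>z s. if s \<in> {T - e..T} then h z else G z s)"

lemma nice_field_const:
  assumes "(\<lambda>z\<in>unit_ball. h z) \<in> class_M"
  shows "nice_field (\<lambda>z _. h z)"
  using assms by (simp add: nice_field_def)

lemma nice_field_needle:
  assumes "nice_field G" "(\<lambda>z\<in>unit_ball. h z) \<in> class_M"
  shows "nice_field (needle G h T e)"
  unfolding needle_def by (rule nice_field_switch[OF nice_field_const[OF assms(2)] assms(1)]) simp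

text \<open>The cocycle property cuts the evolution at \<open>T - e\<close> and at \<open>T\<close>:
  outside the needle the field is \<open>G\<close>, so only the middle flow is affected by
  \<open>h\<close>.\<close>

lemma evlim_needle:
  assumes G: "nice_field G" and h: "(\<lambda>z\<in>unit_ball. h z) \<in> class_M" and z: "norm z < 1" and e: "0 \<le> e" "e \<le> T"
  shows "evlim (needle G h T e) z
    = exp T *\<^sub>R evlim (time_shift G T) (ev (time_shift (\<lambda>z _. h z) (T - e)) e (ev G (T - e) z))"
proof -
  define N where "N = needle G h T e"
  have N: "nice_field N" unfolding N_def by (rule nice_field_needle[OF G h])
  have T: "0 \<le> T" "0 \<le> T - e" "T - e \<le> T" using e by auto
  have w: "norm (ev N (T - e) z) < 1" using norm_ev_le[OF N z T(2)] z by linarith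
  have 1: "ev N (T - e) z = ev G (T - e) z"
    by (rule ev_cong[OF N G z T(2)]) (simp add: N_def needle_def)
  have "ev (time_shift N (T - e)) e (ev N (T - e) z) = ev (time_shift (\<lambda>z _. h z) (T - e)) e (ev N (T - e) z)"
    by (rule ev_cong[OF nice_field_time_shift[OF N] nice_field_time_shift[OF nice_field_const[OF h]] w e(1)])
       (simp add: N_def needle_def time_shift_def)
  then have 2: "ev N T z = ev (time_shift (\<lambda>z _. h z) (T - e)) e (ev G (T - e) z)"
    using ev_cocycle[OF N z T(2,3)] 1 by simp
  have v: "norm (ev N T z) < 1" using norm_ev_le[OF N z T(1)] z by linarith
  have "evlim (time_shift N T) (ev N T z) = evlim (time_shift G T) (ev N T z)"
    by (rule evlim_cong[OF nice_field_time_shift[OF N] nice_field_time_shift[OF G] v])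
       (simp add: N_def needle_def time_shift_def)
  then show ?thesis using evlim_cocycle[OF N z T(1)] 2 by (simp add: N_def)
qed

text \<open>Univalence with a lower Lipschitz bound is all that is used of the flow maps: it makes
  the derivatives injective and the inverse maps continuous.\<close>

lemma has_derivative_lower_bound:
  fixes f :: "'a::real_normed_vector \<Rightarrow> 'b::real_normed_vector"
  assumes D: "(f has_derivative D) (at z)" and S: "open S" "z \<in> S"
    and low: "\<And>w. w \<in> S \<Longrightarrow> norm (f w - f z) \<ge> \<kappa> * norm (w - z)"
  shows "norm (D v) \<ge> \<kappa> * norm v"
proof (cases "v = 0")
  case False
  have lin: "linear D" using D has_derivative_linear by blast
  show ?thesis
  proof (rule field_le_epsilon)
    fix e :: real assume e: "e > 0"
    define e' where "e' = e / norm v"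
    have e': "e' > 0" using e False by (simp add: e'_def)
    obtain d where d: "d > 0" "\<And>w. norm (w - z) < d \<Longrightarrow> norm (f w - f z - D (w - z)) \<le> e' * norm (w - z)"
      using D e' unfolding has_derivative_at_alt by blast
    obtain d2 where d2: "d2 > 0" "ball z d2 \<subseteq> S" using S open_contains_ball by blast
    define t where "t = min d d2 / (2 * norm v)"
    have t: "t > 0" "t * norm v < d" "t * norm v < d2" using d d2 False by (auto simp: t_def min_def)
    define w where "w = z + t *\<^sub>R v"
    have w: "w - z = t *\<^sub>R v" "norm (w - z) = t * norm v" using t by (auto simp: w_def)
    have "w \<in> S" using d2(2) w(2) t(3) by (auto simp: dist_norm norm_minus_commute)
    then have "\<kappa> * (t * norm v) \<le> norm (f w - f z)" using low[of w] unfolding w(2) by blast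
    also have "\<dots> \<le> norm (f w - f z - D (w - z)) + norm (D (w - z))"
      using norm_triangle_ineq[of "f w - f z - D (w - z)" "D (w - z)"] by simp
    also have "\<dots> \<le> e' * (t * norm v) + t * norm (D v)"
      using d(2)[of w] w t by (simp add: linear_scale[OF lin])
    finally have "t * (\<kappa> * norm v) \<le> t * (norm (D v) + e' * norm v)" by (simp add: algebra_simps)
    then show "\<kappa> * norm v \<le> norm (D v) + e" using t False by (simp add: e'_def)
  qed
qed simp

subsection \<open>The variational argument\<close>

lemma hol_on_restrict_iff: "hol_on (restrict f unit_ball) unit_ball \<longleftrightarrow> hol_on f unit_ball"
  using hol_on_cong[of unit_ball f "restrict f unit_ball"] hol_on_cong[of unit_ball "restrict f unit_ball" f] by auto

context
  assumes S0_Hol: "(class_S0 :: (complex ^ 'n \<Rightarrow> complex ^ 'n) set) \<subseteq> Hol"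
begin

lemma hol_on_evlim:
  fixes G :: "complex ^ 'n \<Rightarrow> real \<Rightarrow> complex ^ 'n"
  assumes "nice_field G"
  shows "hol_on (evlim G) unit_ball"
  using restrict_evlim_in_class_S0[OF assms] S0_Hol by (auto simp: Hol_iff hol_on_restrict_iff)

lemma hol_on_ev:
  fixes G :: "complex ^ 'n \<Rightarrow> real \<Rightarrow> complex ^ 'n"
  assumes "nice_field G" "0 \<le> t"
  shows "hol_on (ev G t) unit_ball"
proof -
  have "hol_on (\<lambda>z. exp t *\<^sub>R ev G t z) unit_ball"
    using restrict_ev_in_class_S0[OF assms] S0_Hol by (auto simp: Hol_iff hol_on_restrict_iff)
  from hol_on_scaleR[OF this, of "exp (- t)"] show ?thesis by (simp add: exp_minus)
qed

lemma evlim_derivative_injective: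
  fixes G :: "complex ^ 'n \<Rightarrow> real \<Rightarrow> complex ^ 'n"
  assumes G: "nice_field G" and r: "0 < r" "r < 1" "norm z < r" and D: "(evlim G has_derivative D) (at z)"
  shows "norm (D v) \<ge> exp (- (field_const TYPE(complex ^ 'n) r * decay_const r)) * norm v"
  by (rule has_derivative_lower_bound[OF D, of "ball 0 r"])
     (use r in \<open>auto intro!: evlim_lower[OF G r(1,2)]\<close>)

end

text \<open>The map \<open>g\<close> stands for \<open>G(\<sqdot>, T)\<close> but is known only as a
  limit of averages: \<open>T\<close> may be one of the times at which the given field is not in the
  class. Holomorphy and normalisation of \<open>g\<close> are therefore derived from the averages.
  The constant \<open>c\<close> is the gap in the numerical range.\<close>

locale regular_time =
  fixes G :: "complex ^ 'n \<Rightarrow> real \<Rightarrow> complex ^ 'n" and T c :: real and g :: "complex ^ 'n \<Rightarrow> complex ^ 'n"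
  assumes S0_Hol: "(class_S0 :: (complex ^ 'n \<Rightarrow> complex ^ 'n) set) \<subseteq> Hol"
    and G: "nice_field G" and T: "0 < T" and c: "0 < c"
    and avg: "\<And>K. compact K \<Longrightarrow> K \<subseteq> unit_ball \<Longrightarrow>
      uniform_limit K (\<lambda>\<epsilon> z. (1 / \<epsilon>) *\<^sub>R integral {T - \<epsilon>..T} (G z)) g (at_right 0)"
    and strict: "\<And>z. norm z < 1 \<Longrightarrow> Re (hinner (g z) z) \<le> - c * (norm z)\<^sup>2"
begin

text \<open>The averages of \<open>G\<close> and the difference quotients of the flow over the same
  short interval differ by \<open>O(\<epsilon>)\<close>. The latter are holomorphic because the flow
  maps are, which gives holomorphy of \<open>g\<close> without differentiating under an
  integral.\<close>

lemma quotient_limit: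
  assumes K: "compact K" "K \<subseteq> unit_ball"
  shows "uniform_limit K (\<lambda>\<epsilon> z. (1 / \<epsilon>) *\<^sub>R (ev (time_shift G (T - \<epsilon>)) \<epsilon> z - z)) g (at_right 0)"
proof -
  obtain r where r: "0 < r" "r < 1" "K \<subseteq> cball 0 r"
    using compact_subset_ball_cball[OF K zero_less_one] by blast
  define L where "L = field_const TYPE(complex ^ 'n) r + 1"
  have "uniform_limit K (\<lambda>\<epsilon> z. (1 / \<epsilon>) *\<^sub>R (ev (time_shift G (T - \<epsilon>)) \<epsilon> z - z) - (1 / \<epsilon>) *\<^sub>R integral {T - \<epsilon>..T} (G z)) (\<lambda>_. 0) (at_right 0)"
  proof (rule uniform_limitI_bound[where b = "\<lambda>\<epsilon>. L\<^sup>2 * \<epsilon>"])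
    have pos: "\<forall>\<^sub>F \<epsilon> in at_right (0::real). 0 < \<epsilon>" by (simp add: eventually_at_right_less)
    then show "\<forall>\<^sub>F \<epsilon> in at_right 0. \<forall>z\<in>K. norm ((1 / \<epsilon>) *\<^sub>R (ev (time_shift G (T - \<epsilon>)) \<epsilon> z - z) - (1 / \<epsilon>) *\<^sub>R integral {T - \<epsilon>..T} (G z) - 0) \<le> L\<^sup>2 * \<epsilon>"
    proof eventually_elim
      case (elim \<epsilon>)
      show ?case
      proof
        fix z assume "z \<in> K"
        then have z: "norm z \<le> r" using r by auto
        have "norm ((1 / \<epsilon>) *\<^sub>R (ev (time_shift G (T - \<epsilon>)) \<epsilon> z - z - integral {T - \<epsilon>..T} (G z))) \<le> (1 / \<epsilon>) * (L\<^sup>2 * \<epsilon>\<^sup>2)"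
          using ev_step(2)[OF G r(1,2) z _ L_def, of \<epsilon> T] elim by (simp add: divide_right_mono)
        then show "norm ((1 / \<epsilon>) *\<^sub>R (ev (time_shift G (T - \<epsilon>)) \<epsilon> z - z) - (1 / \<epsilon>) *\<^sub>R integral {T - \<epsilon>..T} (G z) - 0) \<le> L\<^sup>2 * \<epsilon>"
          using elim by (simp add: scaleR_right_diff_distrib power2_eq_square)
      qed
    qed
    show "((\<lambda>\<epsilon>. L\<^sup>2 * \<epsilon>) \<longlongrightarrow> 0) (at_right 0)" by (auto intro!: tendsto_eq_intros)
  qed
  from uniform_limit_add[OF this avg[OF K]] show ?thesis by simp
qed

text \<open>Sequences of step sizes match the sequential limit theorems above; the numerator keeps
  each needle inside the interval from 0 to \<open>T\<close>.\<close>

definition steps :: "nat \<Rightarrow> real" where "steps m = min 1 T / real (Suc m)"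

lemma steps: "steps m > 0" "steps m \<le> T" "steps \<longlonglongrightarrow> 0" "filterlim steps (at_right 0) sequentially"
proof -
  show p: "steps m > 0" for m using T by (simp add: steps_def)
  have "min 1 T / real (Suc m) \<le> min 1 T / 1" using T by (intro divide_left_mono) auto
  then show "steps m \<le> T" by (simp add: steps_def)
  have "(\<lambda>m. min 1 T * inverse (real (Suc m))) \<longlonglongrightarrow> 0"
    by (rule tendsto_mult_right_zero[OF LIMSEQ_inverse_real_of_nat])
  then show lim: "steps \<longlonglongrightarrow> 0" by (simp add: steps_def[abs_def] divide_inverse)
  show "filterlim steps (at_right 0) sequentially"
    unfolding filterlim_at using lim p by (auto simp: less_imp_neq[symmetric])
qed

lemma hol_on_g: "hol_on g unit_ball"
proof (rule hol_on_uniform_limit[OF open_ball])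
  show "hol_on (\<lambda>z. (1 / steps m) *\<^sub>R (ev (time_shift G (T - steps m)) (steps m) z - z)) unit_ball" for m
    by (intro hol_on_scaleR hol_on_diff hol_on_ident hol_on_ev[OF S0_Hol] nice_field_time_shift G) (simp add: steps less_imp_le)
  show "uniform_limit K (\<lambda>m z. (1 / steps m) *\<^sub>R (ev (time_shift G (T - steps m)) (steps m) z - z)) g sequentially"
    if "compact K" "K \<subseteq> unit_ball" for K
    by (rule filterlim_compose[OF quotient_limit[OF that] steps(4)])
qed

lemma g_quadratic: "norm z \<le> 1/2 \<Longrightarrow> norm (g z + z) \<le> field_const TYPE(complex ^ 'n) (1/2) * (norm z)\<^sup>2"
proof -
  assume z: "norm z \<le> 1/2"
  define C where "C = field_const TYPE(complex ^ 'n) (1/2)"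
  have z1: "norm z < 1" using z by simp
  have "((\<lambda>\<epsilon>. (1 / \<epsilon>) *\<^sub>R integral {T - \<epsilon>..T} (G z)) \<longlongrightarrow> g z) (at_right 0)"
    using tendsto_uniform_limitI[OF avg[of "{z}"], of z] z1 by simp
  then have "((\<lambda>\<epsilon>. norm ((1 / \<epsilon>) *\<^sub>R integral {T - \<epsilon>..T} (G z) + z)) \<longlongrightarrow> norm (g z + z)) (at_right 0)"
    by (intro tendsto_intros)
  then show ?thesis unfolding C_def[symmetric]
  proof (rule tendsto_upperbound)
    have pos: "\<forall>\<^sub>F \<epsilon> in at_right (0::real). 0 < \<epsilon>" by (simp add: eventually_at_right_less)
    then show "\<forall>\<^sub>F \<epsilon> in at_right 0. norm ((1 / \<epsilon>) *\<^sub>R integral {T - \<epsilon>..T} (G z) + z) \<le> C * (norm z)\<^sup>2"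
    proof eventually_elim
      case (elim \<epsilon>)
      have "((\<lambda>s. G z s + z) has_integral (integral {T - \<epsilon>..T} (G z) + content {T - \<epsilon>..T} *\<^sub>R z)) {T - \<epsilon>..T}"
        using has_integral_add[OF integrable_integral[OF nice_field_integrable[OF G z1]] has_integral_const_real[of z "T - \<epsilon>" T]] .
      then have "norm (integral {T - \<epsilon>..T} (G z) + content {T - \<epsilon>..T} *\<^sub>R z) \<le> (C * (norm z)\<^sup>2) * content {T - \<epsilon>..T}"
      proof (rule has_integral_bound_real[of _ "{}", rotated 2])
        show "0 \<le> C * (norm z)\<^sup>2" using field_const_nonneg[OF G, of "1/2" C] by (simp add: C_def)
        show "norm (G z s + z) \<le> C * (norm z)\<^sup>2" if "s \<in> {T - \<epsilon>..T} - {}" for s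
          by (rule nice_field_quadratic[OF G _ _ _ z]) (simp_all add: C_def)
      qed simp
      then have "norm (integral {T - \<epsilon>..T} (G z) + \<epsilon> *\<^sub>R z) \<le> (C * (norm z)\<^sup>2) * \<epsilon>" using elim by simp
      then have "(1 / \<epsilon>) * norm (integral {T - \<epsilon>..T} (G z) + \<epsilon> *\<^sub>R z) \<le> (1 / \<epsilon>) * ((C * (norm z)\<^sup>2) * \<epsilon>)"
        using elim by (intro mult_left_mono) auto
      moreover have "(1 / \<epsilon>) *\<^sub>R integral {T - \<epsilon>..T} (G z) + z = (1 / \<epsilon>) *\<^sub>R (integral {T - \<epsilon>..T} (G z) + \<epsilon> *\<^sub>R z)"
        using elim by (simp add: scaleR_add_right)
      ultimately show ?case using elim by simp
    qed
  qed simp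
qed

text \<open>Both normalisations at 0 follow from \<open>h z + z\<close> being of order two, a
  property shared by \<open>g z + z\<close> and \<open>\<delta> *s q z\<close>. The condition on the
  numerical range survives because the perturbation costs at most
  \<open>norm \<delta> * C * (norm z)\<^sup>2\<close>, which the gap \<open>c\<close>
  covers.\<close>

lemma perturbed_in_class_M:
  assumes q: "hol_on q unit_ball" and qq: "\<And>z. norm z < 1 \<Longrightarrow> norm (q z) \<le> C * (norm z)\<^sup>2"
    and \<delta>: "norm \<delta> * C \<le> c" and C: "C \<ge> 0"
  shows "(\<lambda>z\<in>unit_ball. g z + \<delta> *s q z) \<in> class_M"
proof -
  define h where "h z = g z + \<delta> *s q z" for z
  have hh: "hol_on h unit_ball" unfolding h_def by (intro hol_on_add hol_on_g hol_on_smult q)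
  define B where "B = field_const TYPE(complex ^ 'n) (1/2) + norm \<delta> * C"
  have hquad: "norm (h z + z) \<le> B * (norm z)\<^sup>2" if z: "norm z \<le> 1/2" for z
  proof -
    have "norm (h z + z) \<le> norm (g z + z) + norm (\<delta> *s q z)"
      using norm_triangle_ineq[of "g z + z" "\<delta> *s q z"] by (simp add: h_def algebra_simps)
    also have "\<dots> \<le> field_const TYPE(complex ^ 'n) (1/2) * (norm z)\<^sup>2 + norm \<delta> * (C * (norm z)\<^sup>2)"
      unfolding norm_vector_smult using z by (intro add_mono g_quadratic mult_left_mono qq) auto
    finally show ?thesis by (simp add: B_def algebra_simps)
  qed
  have h0: "h 0 = 0" using hquad[of 0] by simp
  have "(h has_derivative (\<lambda>v. - v)) (at 0)"
    unfolding has_derivative_at_alt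
  proof (intro conjI allI impI)
    show "bounded_linear (\<lambda>v::complex ^ 'n. - v)" by (rule bounded_linear_minus[OF bounded_linear_ident])
    fix e :: real assume e: "e > 0"
    define d where "d = min (1/2) (e / (\<bar>B\<bar> + 1))"
    have d: "d > 0" using e by (simp add: d_def)
    have "norm (h y - h 0 - - (y - 0)) \<le> e * norm (y - 0)" if y: "norm (y - 0) < d" for y
    proof -
      have "norm (h y + y) \<le> B * (norm y)\<^sup>2" using y by (intro hquad) (simp add: d_def)
      also have "\<dots> \<le> (\<bar>B\<bar> + 1) * norm y * norm y"
        by (simp add: power2_eq_square mult.assoc mult_right_mono)
      also have "\<dots> \<le> e * norm y"
      proof (rule mult_right_mono)
        have "norm y \<le> e / (\<bar>B\<bar> + 1)" using y by (simp add: d_def)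
        then show "(\<bar>B\<bar> + 1) * norm y \<le> e" by (simp add: pos_le_divide_eq mult.commute)
      qed simp
      finally show ?thesis by (simp add: h0)
    qed
    then show "\<exists>d>0. \<forall>y. norm (y - 0) < d \<longrightarrow> norm (h y - h 0 - - (y - 0)) \<le> e * norm (y - 0)" using d by blast
  qed
  then have hd: "(restrict h unit_ball has_derivative (\<lambda>v. - v)) (at 0)"
    using has_derivative_transform_within_open[of h "\<lambda>v. - v" 0 UNIV unit_ball "restrict h unit_ball"] by auto
  have "Re (hinner (h z) z) \<le> 0" if z: "norm z < 1" for z
  proof -
    have "Re (hinner (\<delta> *s q z) z) \<le> norm (hinner (\<delta> *s q z) z)" by (rule complex_Re_le_cmod)
    also have "\<dots> \<le> norm (\<delta> *s q z) * norm z" by (rule norm_hinner_le)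
    also have "\<dots> \<le> norm \<delta> * (C * (norm z)\<^sup>2) * 1"
      unfolding norm_vector_smult using z C by (intro mult_mono mult_left_mono qq) auto
    also have "\<dots> = (norm \<delta> * C) * (norm z)\<^sup>2" by simp
    also have "\<dots> \<le> c * (norm z)\<^sup>2" using \<delta> by (intro mult_right_mono) auto
    finally show ?thesis using strict[OF z] by (simp add: h_def hinner_add_left)
  qed
  moreover have "restrict h unit_ball \<in> Hol" by (rule restrict_in_Hol[OF hh])
  ultimately have "restrict h unit_ball \<in> class_M"
    using hd h0 unfolding class_M_def by simp
  then show ?thesis by (simp add: h_def[abs_def])
qed

abbreviation "phiT \<equiv> ev G T"
abbreviation "FT \<equiv> evlim (time_shift G T)"

lemma phiT_ball: "norm z < 1 \<Longrightarrow> norm (phiT z) < 1"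
  using norm_ev_le[OF G, of z T] T by fastforce

lemma hol_on_FT: "hol_on FT unit_ball"
  by (rule hol_on_evlim[OF S0_Hol nice_field_time_shift[OF G]])

text \<open>Both \<open>\<phi>\<^sub>T\<close> and its perturbation start from \<open>w = \<phi>\<^bsub>T-\<epsilon>\<^esub> z\<close>; expanding the two flows over the
  short interval and replacing \<open>w\<close> by \<open>\<phi>\<^sub>T z\<close> costs only \<open>O(\<epsilon>\<^sup>2)\<close>.\<close>

lemma needle_limit:
  assumes h: "(\<lambda>z\<in>unit_ball. h z) \<in> class_M" and K: "compact K" "K \<subseteq> unit_ball"
  shows "uniform_limit K
    (\<lambda>\<epsilon> z. (1 / \<epsilon>) *\<^sub>R (ev (time_shift (\<lambda>z _. h z) (T - \<epsilon>)) \<epsilon> (ev G (T - \<epsilon>) z) - phiT z))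
    (\<lambda>z. h (phiT z) - g (phiT z)) (at_right 0)"
proof -
  obtain r where r: "0 < r" "r < 1" "K \<subseteq> cball 0 r"
    using compact_subset_ball_cball[OF K zero_less_one] by blast
  define L where "L = field_const TYPE(complex ^ 'n) r + 1"
  have L0: "L \<ge> 0" using field_const_nonneg[OF G r(1,2) refl] by (simp add: L_def)
  define A where "A \<epsilon> p = (1 / \<epsilon>) *\<^sub>R integral {T - \<epsilon>..T} (G p)" for \<epsilon> p
  have Hn: "nice_field (\<lambda>z _. h z)" by (rule nice_field_const[OF h])
  have phi_r: "norm (phiT z) \<le> r" if "z \<in> K" for z
    using norm_ev_le[OF G, of z T] T that r by fastforce
  have evs: "\<forall>\<^sub>F \<epsilon> in at_right (0::real). 0 < \<epsilon> \<and> \<epsilon> < T"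
    using T by (auto simp: eventually_at_right_less eventually_conj_iff intro: eventually_at_rightI[of 0 T])
  \<comment> \<open>The limit of averages is used on the whole ball of radius \<open>r\<close>, into
    which \<open>phiT\<close> maps \<open>K\<close> because norms do not increase.\<close>
  have u1: "uniform_limit K (\<lambda>\<epsilon> z. A \<epsilon> (phiT z)) (\<lambda>z. g (phiT z)) (at_right 0)"
  proof -
    have "uniform_limit (cball 0 r) A g (at_right 0)"
      unfolding A_def[abs_def] by (rule avg) (use r in auto)
    then show ?thesis
      unfolding uniform_limit_iff
    proof (intro allI impI)
      fix e :: real assume *: "\<forall>e>0. \<forall>\<^sub>F n in at_right 0. \<forall>x\<in>cball 0 r. dist (A n x) (g x) < e" and e: "e > 0"
      from *[rule_format, OF e] show "\<forall>\<^sub>F \<epsilon> in at_right 0. \<forall>z\<in>K. dist (A \<epsilon> (phiT z)) (g (phiT z)) < e"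
        by eventually_elim (use phi_r in auto)
    qed
  qed
  have u2: "uniform_limit K (\<lambda>\<epsilon> z. (1 / \<epsilon>) *\<^sub>R (ev (time_shift (\<lambda>z _. h z) (T - \<epsilon>)) \<epsilon> (ev G (T - \<epsilon>) z) - phiT z)
       + A \<epsilon> (phiT z)) (\<lambda>z. h (phiT z)) (at_right 0)"
  proof (rule uniform_limitI_bound[where b = "\<lambda>\<epsilon>. 4 * L\<^sup>2 * \<epsilon>"])
    show "\<forall>\<^sub>F \<epsilon> in at_right 0. \<forall>z\<in>K. norm ((1 / \<epsilon>) *\<^sub>R (ev (time_shift (\<lambda>z _. h z) (T - \<epsilon>)) \<epsilon> (ev G (T - \<epsilon>) z) - phiT z)
       + A \<epsilon> (phiT z) - h (phiT z)) \<le> 4 * L\<^sup>2 * \<epsilon>"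
      using evs
    proof eventually_elim
      case (elim \<epsilon>)
      show ?case
      proof
        fix z assume zK: "z \<in> K"
        have z: "norm z \<le> r" "norm z < 1" using zK r by force+
        define w where "w = ev G (T - \<epsilon>) z"
        define p where "p = phiT z"
        define p' where "p' = ev (time_shift (\<lambda>z _. h z) (T - \<epsilon>)) \<epsilon> w"
        have w: "norm w \<le> r" using norm_ev_le[OF G z(2), of "T - \<epsilon>"] elim z(1) by (simp add: w_def)
        have p: "norm p \<le> r" unfolding p_def by (rule phi_r[OF zK])
        have pw: "p = ev (time_shift G (T - \<epsilon>)) \<epsilon> w"
          using ev_cocycle[OF G z(2), of "T - \<epsilon>" T] elim by (simp add: p_def w_def)
        have e0: "0 \<le> \<epsilon>" using elim by simp
        note s1 = ev_step[OF G r(1,2) w e0 L_def, of T, folded pw]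
        note s2 = ev_step(2)[OF Hn r(1,2) w e0 L_def, of T, folded p'_def]
        have w1: "norm w < 1" "norm p < 1" using w p r by auto
        have Ih: "integral {T - \<epsilon>..T} (\<lambda>_. h w) = \<epsilon> *\<^sub>R h w" using elim by simp
        have IG: "norm (integral {T - \<epsilon>..T} (G w) - integral {T - \<epsilon>..T} (G p)) \<le> L\<^sup>2 * \<epsilon>\<^sup>2"
        proof -
          have "norm (integral {T - \<epsilon>..T} (G w) - integral {T - \<epsilon>..T} (G p)) \<le> (L * (L * \<epsilon>)) * content {T - \<epsilon>..T}"
          proof (rule has_integral_bound_real[of _ "{}"])
            show "((\<lambda>s. G w s - G p s) has_integral (integral {T - \<epsilon>..T} (G w) - integral {T - \<epsilon>..T} (G p))) {T - \<epsilon>..T}"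
              by (intro has_integral_diff integrable_integral nice_field_integrable[OF G] w1)
            show "norm (G w s - G p s) \<le> L * (L * \<epsilon>)" if "s \<in> {T - \<epsilon>..T} - {}" for s
            proof -
              have "norm (G w s - G p s) \<le> L * norm (w - p)"
                unfolding L_def by (rule nice_field_lipschitz[OF G r(1,2) refl w p])
              also have "\<dots> \<le> L * (L * \<epsilon>)" using s1(1) L0 by (intro mult_left_mono) (auto simp: norm_minus_commute)
              finally show ?thesis .
            qed
          qed (use L0 e0 in auto)
          then show ?thesis using elim by (simp add: power2_eq_square mult_ac)
        qed
        have hw: "norm (h w - h p) \<le> L * (L * \<epsilon>)"
        proof -
          have "norm (h w - h p) \<le> L * norm (w - p)"
            unfolding L_def by (rule nice_field_lipschitz[OF Hn r(1,2) refl w p])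
          also have "\<dots> \<le> L * (L * \<epsilon>)" using s1(1) L0 by (intro mult_left_mono) (auto simp: norm_minus_commute)
          finally show ?thesis .
        qed
        \<comment> \<open>Four errors of size \<open>L\<^sup>2 * \<epsilon>\<^sup>2\<close>: the
          expansions of the two flows, and the replacement of \<open>w\<close> by \<open>p\<close>
          in the integral of \<open>G\<close> and in \<open>h\<close>.\<close>
        have "p' - p + integral {T - \<epsilon>..T} (G p) - \<epsilon> *\<^sub>R h p
          = (p' - w - integral {T - \<epsilon>..T} (\<lambda>_. h w)) - (p - w - integral {T - \<epsilon>..T} (G w))
            - (integral {T - \<epsilon>..T} (G w) - integral {T - \<epsilon>..T} (G p)) + \<epsilon> *\<^sub>R (h w - h p)"
          unfolding Ih by (simp add: scaleR_right_diff_distrib)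
        also have "norm \<dots> \<le> L\<^sup>2 * \<epsilon>\<^sup>2 + L\<^sup>2 * \<epsilon>\<^sup>2 + L\<^sup>2 * \<epsilon>\<^sup>2 + \<epsilon> * (L * (L * \<epsilon>))"
        proof -
          have tri: "norm (a - b - c + d) \<le> norm a + norm b + norm c + norm d" for a b c d :: "complex ^ 'n"
            using norm_triangle_ineq[of "a - b - c" d] norm_triangle_ineq4[of "a - b" c] norm_triangle_ineq4[of a b]
            by linarith
          have "norm (\<epsilon> *\<^sub>R (h w - h p)) \<le> \<epsilon> * (L * (L * \<epsilon>))" using hw e0 by (simp add: mult_left_mono)
          then show ?thesis by (intro order_trans[OF tri] add_mono s1(2) s2 IG)
        qed
        also have "\<dots> = 4 * L\<^sup>2 * \<epsilon>\<^sup>2" by (simp add: power2_eq_square)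
        finally have "(1 / \<epsilon>) * norm (p' - p + integral {T - \<epsilon>..T} (G p) - \<epsilon> *\<^sub>R h p) \<le> (1 / \<epsilon>) * (4 * L\<^sup>2 * \<epsilon>\<^sup>2)"
          using elim by (intro mult_left_mono) auto
        also have "\<dots> = 4 * L\<^sup>2 * \<epsilon>" using elim by (simp add: power2_eq_square)
        finally have "norm ((1 / \<epsilon>) *\<^sub>R (p' - p + integral {T - \<epsilon>..T} (G p) - \<epsilon> *\<^sub>R h p)) \<le> 4 * L\<^sup>2 * \<epsilon>"
          using elim by simp
        moreover have "(1 / \<epsilon>) *\<^sub>R (p' - p + integral {T - \<epsilon>..T} (G p) - \<epsilon> *\<^sub>R h p)
            = (1 / \<epsilon>) *\<^sub>R (p' - p) + A \<epsilon> p - h p"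
          using elim by (simp add: A_def scaleR_add_right scaleR_right_diff_distrib)
        ultimately have "norm ((1 / \<epsilon>) *\<^sub>R (p' - p) + A \<epsilon> p - h p) \<le> 4 * L\<^sup>2 * \<epsilon>"
          by (simp only:)
        then show "norm ((1 / \<epsilon>) *\<^sub>R (ev (time_shift (\<lambda>z _. h z) (T - \<epsilon>)) \<epsilon> (ev G (T - \<epsilon>) z) - phiT z)
           + A \<epsilon> (phiT z) - h (phiT z)) \<le> 4 * L\<^sup>2 * \<epsilon>" by (simp only: p_def p'_def w_def)
      qed
    qed
    show "((\<lambda>\<epsilon>. 4 * L\<^sup>2 * \<epsilon>) \<longlongrightarrow> 0) (at_right 0)" by (auto intro!: tendsto_eq_intros)
  qed
  from uniform_limit_minus[OF u2 u1] show ?thesis by simp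
qed

end

locale extremal_regular_time = functional_derivative \<Phi> V \<Lambda> F + regular_time G T c g
  for \<Phi> :: "(complex ^ 'n \<Rightarrow> complex ^ 'n) \<Rightarrow> complex" and V \<Lambda> F
    and G :: "complex ^ 'n \<Rightarrow> real \<Rightarrow> complex ^ 'n" and T c g +
  assumes F_eq: "F = restrict (evlim G) unit_ball"
    and maximal: "\<And>f. f \<in> class_S0 \<Longrightarrow> Re (\<Phi> f) \<le> Re (\<Phi> F)"
begin

definition DF :: "complex ^ 'n \<Rightarrow> complex ^ 'n \<Rightarrow> complex ^ 'n" where
  "DF z = (SOME D. (FT has_derivative D) (at z) \<and> (\<forall>c v. D (c *s v) = c *s D v))"

lemma DF:
  assumes "norm z < 1"
  shows "(FT has_derivative DF z) (at z)" and "DF z (a *s v) = a *s DF z v"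
proof -
  have "\<exists>D. (FT has_derivative D) (at z) \<and> (\<forall>c v. D (c *s v) = c *s D v)"
    using hol_on_FT assms unfolding hol_on_def by simp
  from someI_ex[OF this] show "(FT has_derivative DF z) (at z)" "DF z (a *s v) = a *s DF z v"
    unfolding DF_def[symmetric] by auto
qed

lemma DF_diff: "norm z < 1 \<Longrightarrow> DF z (v - w) = DF z v - DF z w"
  using has_derivative_linear[OF DF(1)] linear_diff by blast

lemma FT_bounds:
  assumes r: "0 < r" "r < 1"
  shows "\<exists>B>0. \<exists>s>0. \<forall>p v. norm p \<le> r \<longrightarrow> norm (DF p v) \<le> B * norm v \<and>
    (norm v \<le> s \<longrightarrow> norm (FT (p + v) - FT p - DF p v) \<le> B * (norm v)\<^sup>2)"
proof -
  define s where "s = (1 - r) / 2"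
  have s: "s > 0" "r + s < 1" using r by (auto simp: s_def field_simps)
  have "cball 0 (r + s) \<subseteq> (unit_ball :: (complex ^ 'n) set)" using s by auto
  from hol_on_bounded_cball[OF hol_on_FT this]
  obtain M where M: "M > 0" "\<And>w. w \<in> cball 0 (r + s) \<Longrightarrow> norm (FT w) \<le> M" by blast
  define B where "B = max (M / s) (2 * M / s\<^sup>2)"
  have B: "B > 0" using M s by (simp add: B_def less_max_iff_disj)
  have "norm (DF p v) \<le> B * norm v \<and> (norm v \<le> s / 2 \<longrightarrow> norm (FT (p + v) - FT p - DF p v) \<le> B * (norm v)\<^sup>2)"
    if p: "norm p \<le> r" for p v
  proof -
    have p1: "norm p < 1" using p r by simp
    have cb: "cball p s \<subseteq> cball 0 (r + s)"
    proof
      fix w assume "w \<in> cball p s"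
      then show "w \<in> cball 0 (r + s)" using p norm_triangle_ineq[of p "w - p"] by (simp add: dist_norm norm_minus_commute)
    qed
    have cb1: "cball p s \<subseteq> unit_ball" using cb s by (auto simp: subset_iff)
    have Mp: "norm (FT w) \<le> M" if "w \<in> cball p s" for w using M(2) cb that by blast
    have "norm (DF p v) \<le> M / s * norm v"
      by (rule cauchy_estimate_derivative[OF hol_on_FT cb1 s(1) Mp DF[OF p1]])
    also have "\<dots> \<le> B * norm v" by (intro mult_right_mono) (auto simp: B_def)
    finally have 1: "norm (DF p v) \<le> B * norm v" .
    have "norm (FT (p + v) - FT p - DF p v) \<le> B * (norm v)\<^sup>2" if v: "norm v \<le> s / 2"
    proof -
      have "norm (FT (p + v) - FT p - DF p v) \<le> 2 * M / s\<^sup>2 * (norm v)\<^sup>2"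
        by (rule hol_on_quadratic_bound[OF hol_on_FT cb1 s(1) Mp DF[OF p1] v])
      also have "\<dots> \<le> B * (norm v)\<^sup>2" by (intro mult_right_mono) (auto simp: B_def)
      finally show ?thesis .
    qed
    with 1 show ?thesis by blast
  qed
  then show ?thesis using B s by (intro exI[of _ B] conjI exI[of _ "s / 2"]) auto
qed

lemma phiT_cball: "norm z \<le> r \<Longrightarrow> r < 1 \<Longrightarrow> norm (phiT z) \<le> r"
  using norm_ev_le[OF G, of z T] T by fastforce

text \<open>This is the chain rule with uniform error: the varied end point is
  \<open>p + \<epsilon> *\<^sub>R a m z\<close> with \<open>a m\<close> converging to
  \<open>h - g\<close> at \<open>p\<close>, and \<open>FT\<close> is expanded to first order there
  with a quadratic remainder.\<close>

lemma variation_limit: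
  assumes h: "(\<lambda>z\<in>unit_ball. h z) \<in> class_M" and K: "compact K" "K \<subseteq> unit_ball"
  shows "uniform_limit K (\<lambda>m z. (1 / steps m) *\<^sub>R (evlim (needle G h T (steps m)) z - evlim G z))
     (\<lambda>z. exp T *\<^sub>R DF (phiT z) (h (phiT z) - g (phiT z))) sequentially"
proof -
  obtain r where r: "0 < r" "r < 1" "K \<subseteq> cball 0 r"
    using compact_subset_ball_cball[OF K zero_less_one] by blast
  obtain B s where B: "B > 0" "s > 0" "\<And>p v. norm p \<le> r \<Longrightarrow> norm (DF p v) \<le> B * norm v"
    "\<And>p v. \<lbrakk>norm p \<le> r; norm v \<le> s\<rbrakk> \<Longrightarrow> norm (FT (p + v) - FT p - DF p v) \<le> B * (norm v)\<^sup>2"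
    using FT_bounds[OF r(1,2)] by blast
  define v where "v z = h (phiT z) - g (phiT z)" for z
  define a where "a m z = (1 / steps m) *\<^sub>R (ev (time_shift (\<lambda>z _. h z) (T - steps m)) (steps m) (ev G (T - steps m) z) - phiT z)" for m z
  have av: "uniform_limit K a v sequentially"
    unfolding a_def[abs_def] v_def[abs_def] by (rule filterlim_compose[OF needle_limit[OF h K] steps(4)])
  have cb: "cball 0 r \<subseteq> (unit_ball :: (complex ^ 'n) set)" using r by auto
  have "hol_on h unit_ball" using class_M_hol_on[OF h] by (simp add: hol_on_restrict_iff)
  then obtain Mh where Mh: "\<And>w. w \<in> cball 0 r \<Longrightarrow> norm (h w) \<le> Mh" using hol_on_bounded_cball[OF _ cb] by blast
  obtain Mg where Mg: "\<And>w. w \<in> cball 0 r \<Longrightarrow> norm (g w) \<le> Mg" using hol_on_bounded_cball[OF hol_on_g cb] by blast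
  \<comment> \<open>The limit direction is bounded by \<open>B0 - 1\<close>, so \<open>a m\<close>
    is bounded by \<open>B0\<close> once it is within distance 1 of it.\<close>
  define B0 where "B0 = max 0 (Mh + Mg) + 1"
  have B0: "B0 \<ge> 1" by (simp add: B0_def)
  have pr: "norm (phiT z) \<le> r" if "z \<in> K" for z using phiT_cball[of z r] that r by auto
  have vB: "norm (v z) \<le> B0 - 1" if "z \<in> K" for z
    using norm_triangle_ineq4[of "h (phiT z)" "g (phiT z)"] Mh[of "phiT z"] Mg[of "phiT z"] pr[OF that]
    by (simp add: v_def B0_def)
  show ?thesis
    unfolding v_def[symmetric]
  proof (rule uniform_limitI)
    fix e :: real assume e: "e > 0"
    \<comment> \<open>Two errors of size \<open>B * e'\<close> occur, the remainder of
      \<open>FT\<close> and the deviation of \<open>a m\<close> from its limit, and both are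
      multiplied by \<open>exp T\<close>.\<close>
    define e' where "e' = e / (2 * exp T * B)"
    have e': "e' > 0" using e B by (simp add: e'_def)
    have "\<forall>\<^sub>F m in sequentially. \<forall>z\<in>K. dist (a m z) (v z) < min 1 e'"
      using e' by (intro uniform_limitD[OF av]) auto
    moreover have "\<forall>\<^sub>F m in sequentially. steps m < s / B0"
      using steps(3) B(2) B0 by (intro order_tendstoD(2)) auto
    moreover have "\<forall>\<^sub>F m in sequentially. steps m < e' / B0\<^sup>2"
      using steps(3) e' B0 by (intro order_tendstoD(2)) auto
    ultimately show "\<forall>\<^sub>F m in sequentially. \<forall>z\<in>K. dist ((1 / steps m) *\<^sub>R (evlim (needle G h T (steps m)) z - evlim G z)) (exp T *\<^sub>R DF (phiT z) (v z)) < e"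
    proof eventually_elim
      case (elim m)
      show ?case
      proof
        fix z assume zK: "z \<in> K"
        define \<epsilon> where "\<epsilon> = steps m"
        have \<epsilon>: "0 < \<epsilon>" "\<epsilon> \<le> T" using steps(1,2) by (auto simp: \<epsilon>_def)
        have z1: "norm z < 1" using zK K(2) by auto
        define p where "p = phiT z"
        have p: "norm p \<le> r" "norm p < 1" using pr[OF zK] r by (auto simp: p_def)
        have avz: "norm (a m z - v z) < 1" "norm (a m z - v z) < e'"
          using elim(1) zK by (auto simp: dist_norm)
        have aB: "norm (a m z) \<le> B0" using norm_triangle_ineq[of "v z" "a m z - v z"] avz(1) vB[OF zK] by simp
        have "p + \<epsilon> *\<^sub>R a m z = ev (time_shift (\<lambda>z _. h z) (T - \<epsilon>)) \<epsilon> (ev G (T - \<epsilon>) z)"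
          using \<epsilon> by (simp add: a_def p_def \<epsilon>_def)
        then have "evlim (needle G h T \<epsilon>) z = exp T *\<^sub>R FT (p + \<epsilon> *\<^sub>R a m z)"
          using evlim_needle[OF G h z1 _ \<epsilon>(2)] \<epsilon> by simp
        moreover have "evlim G z = exp T *\<^sub>R FT p"
          using evlim_cocycle[OF G z1, of T] T by (simp add: p_def)
        ultimately have eq: "(1 / \<epsilon>) *\<^sub>R (evlim (needle G h T \<epsilon>) z - evlim G z) - exp T *\<^sub>R DF p (v z)
           = exp T *\<^sub>R ((1 / \<epsilon>) *\<^sub>R (FT (p + \<epsilon> *\<^sub>R a m z) - FT p) - DF p (v z))"
          by (simp add: scaleR_right_diff_distrib mult.commute)
        have lin: "linear (DF p)" using has_derivative_linear[OF DF(1)[OF p(2)]] .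
        have eq2: "(1 / \<epsilon>) *\<^sub>R (FT (p + \<epsilon> *\<^sub>R a m z) - FT p) - DF p (v z)
           = (1 / \<epsilon>) *\<^sub>R (FT (p + \<epsilon> *\<^sub>R a m z) - FT p - DF p (\<epsilon> *\<^sub>R a m z)) + DF p (a m z - v z)"
          using \<epsilon> by (simp add: linear_scale[OF lin] linear_diff[OF lin] scaleR_right_diff_distrib)
        have "\<epsilon> * norm (a m z) \<le> \<epsilon> * B0" using aB \<epsilon> by (intro mult_left_mono) auto
        also have "\<dots> \<le> s" using elim(2) B0 by (simp add: \<epsilon>_def pos_less_divide_eq less_imp_le)
        finally have "norm (\<epsilon> *\<^sub>R a m z) \<le> s" using \<epsilon> by simp
        from B(4)[OF p(1) this]
        have "(1 / \<epsilon>) * norm (FT (p + \<epsilon> *\<^sub>R a m z) - FT p - DF p (\<epsilon> *\<^sub>R a m z)) \<le> (1 / \<epsilon>) * (B * (norm (\<epsilon> *\<^sub>R a m z))\<^sup>2)"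
          using \<epsilon> by (intro mult_left_mono) auto
        also have "\<dots> = B * \<epsilon> * (norm (a m z))\<^sup>2" using \<epsilon> by (simp add: power_mult_distrib power2_eq_square)
        also have "\<dots> \<le> B * \<epsilon> * B0\<^sup>2" using aB B \<epsilon> by (intro mult_left_mono power_mono) auto
        also have "\<dots> < B * e'" using elim(3) B B0 by (simp add: \<epsilon>_def pos_less_divide_eq)
        finally have n1: "(1 / \<epsilon>) * norm (FT (p + \<epsilon> *\<^sub>R a m z) - FT p - DF p (\<epsilon> *\<^sub>R a m z)) < B * e'" .
        have n2: "norm (DF p (a m z - v z)) \<le> B * e'"
          using order_trans[OF B(3)[OF p(1)] mult_left_mono[of "norm (a m z - v z)" e' B]] avz(2) B(1) by simp
        have "norm ((1 / \<epsilon>) *\<^sub>R (FT (p + \<epsilon> *\<^sub>R a m z) - FT p) - DF p (v z)) < 2 * B * e'"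
          unfolding eq2
          using norm_triangle_ineq[of "(1 / \<epsilon>) *\<^sub>R (FT (p + \<epsilon> *\<^sub>R a m z) - FT p - DF p (\<epsilon> *\<^sub>R a m z))" "DF p (a m z - v z)"] n1 n2 \<epsilon>
          by simp
        then have "exp T * norm ((1 / \<epsilon>) *\<^sub>R (FT (p + \<epsilon> *\<^sub>R a m z) - FT p) - DF p (v z)) < exp T * (2 * B * e')"
          by (intro mult_strict_left_mono) auto
        also have "\<dots> = e" using B by (simp add: e'_def)
        finally show "dist ((1 / steps m) *\<^sub>R (evlim (needle G h T (steps m)) z - evlim G z)) (exp T *\<^sub>R DF (phiT z) (v z)) < e"
          unfolding dist_norm \<epsilon>_def[symmetric] p_def[symmetric] eq by simp
      qed
    qed
  qed
qed

text \<open>The varied limit maps belong to \<open>class_S0\<close> and are holomorphic, so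
  maximality applies to their difference quotients, and the limit direction is holomorphic as
  well.\<close>

lemma Re_L_variation:
  assumes h: "(\<lambda>z\<in>unit_ball. h z) \<in> class_M"
  shows hol_on_variation: "hol_on (\<lambda>z. exp T *\<^sub>R DF (phiT z) (h (phiT z) - g (phiT z))) unit_ball"
    and Re_L_variation_nonpos: "Re (L (\<lambda>z. exp T *\<^sub>R DF (phiT z) (h (phiT z) - g (phiT z)))) \<le> 0"
proof -
  let ?H = "\<lambda>z. exp T *\<^sub>R DF (phiT z) (h (phiT z) - g (phiT z))"
  have N: "nice_field (needle G h T (steps m))" for m by (rule nice_field_needle[OF G h])
  show hol: "hol_on ?H unit_ball"
  proof (rule hol_on_uniform_limit[OF open_ball])
    show "hol_on (\<lambda>z. (1 / steps m) *\<^sub>R (evlim (needle G h T (steps m)) z - evlim G z)) unit_ball" for m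
      by (intro hol_on_scaleR hol_on_diff hol_on_evlim[OF S0_Hol] N G)
    show "uniform_limit K (\<lambda>m z. (1 / steps m) *\<^sub>R (evlim (needle G h T (steps m)) z - evlim G z)) ?H sequentially"
      if "compact K" "K \<subseteq> unit_ball" for K by (rule variation_limit[OF h that])
  qed
  show "Re (L ?H) \<le> 0"
  proof (rule Re_L_nonpos[OF maximal S0_Hol steps(1,3) _ hol])
    show "restrict (evlim (needle G h T (steps m))) unit_ball \<in> class_S0" for m
      by (rule restrict_evlim_in_class_S0[OF N])
    fix K :: "(complex ^ 'n) set" assume K: "compact K" "K \<subseteq> unit_ball"
    show "uniform_limit K (\<lambda>m z. (1 / steps m) *\<^sub>R (restrict (evlim (needle G h T (steps m))) unit_ball z - F z)) ?H sequentially"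
    proof (rule uniform_limit_cong'[THEN iffD1, OF _ _ variation_limit[OF h K]])
      show "(1 / steps m) *\<^sub>R (evlim (needle G h T (steps m)) z - evlim G z) =
          (1 / steps m) *\<^sub>R (restrict (evlim (needle G h T (steps m))) unit_ball z - F z)" if "z \<in> K" for m z
        using K(2) that by (auto simp: F_eq subset_iff)
    qed simp
  qed
qed

text \<open>Every \<open>\<delta>\<close> on the circle of radius \<open>d\<close> gives an
  admissible field, so \<open>Re (exp T * \<delta> * L Q) \<le> 0\<close> on the whole circle, which
  forces \<open>L Q = 0\<close>. Holomorphy of \<open>Q\<close> comes from the variation for one
  nonzero \<open>\<delta>\<close> after dividing by the factor.\<close>

lemma L_DF_zero:
  assumes q: "hol_on q unit_ball" and qq: "\<And>z. norm z < 1 \<Longrightarrow> norm (q z) \<le> C * (norm z)\<^sup>2"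
  shows hol_on_DF: "hol_on (\<lambda>z. DF (phiT z) (q (phiT z))) unit_ball"
    and L_DF_eq_0: "L (\<lambda>z. DF (phiT z) (q (phiT z))) = 0"
proof -
  define Q where "Q z = DF (phiT z) (q (phiT z))" for z
  define C' where "C' = \<bar>C\<bar> + 1"
  have C': "C' > 0" by (simp add: C'_def)
  have qq': "norm (q z) \<le> C' * (norm z)\<^sup>2" if "norm z < 1" for z
    using order_trans[OF qq[OF that] mult_right_mono[of C C' "(norm z)\<^sup>2"]] by (simp add: C'_def)
  define d where "d = c / C'"
  have d: "d > 0" using c C' by (simp add: d_def)
  have var: "hol_on (\<lambda>z. (exp T * \<delta>) *s Q z) unit_ball \<and> Re (L (\<lambda>z. (exp T * \<delta>) *s Q z)) \<le> 0"
    if \<delta>: "norm \<delta> = d" for \<delta> :: complex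
  proof -
    have h: "(\<lambda>z\<in>unit_ball. g z + \<delta> *s q z) \<in> class_M"
      by (rule perturbed_in_class_M[OF q qq']) (use \<delta> C' in \<open>auto simp: d_def\<close>)
    have eq: "exp T *\<^sub>R DF (phiT z) (g (phiT z) + \<delta> *s q (phiT z) - g (phiT z)) = (exp T * \<delta>) *s Q z"
      if "z \<in> unit_ball" for z
      using DF(2)[OF phiT_ball, of z] that
      by (simp add: Q_def vector_smult_of_real[symmetric] vector_smult_assoc del: of_real_exp)
    show ?thesis
      using hol_on_cong[OF open_ball hol_on_variation[OF h] eq] Re_L_variation_nonpos[OF h] L_eqI[OF eq] by simp
  qed
  define k where "k = exp T * complex_of_real d"
  have k: "k \<noteq> 0" using d by (simp add: k_def)
  have "hol_on (\<lambda>z. k *s Q z) unit_ball" using var[of "of_real d"] d by (simp add: k_def)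
  then have "hol_on (\<lambda>z. inverse k *s (k *s Q z)) unit_ball" by (rule hol_on_smult)
  then have hQ: "hol_on Q unit_ball" using k by (simp add: vector_smult_assoc)
  then show "hol_on (\<lambda>z. DF (phiT z) (q (phiT z))) unit_ball" by (simp add: Q_def[abs_def])
  have "L Q = 0"
  proof (rule ccontr)
    assume nz: "L Q \<noteq> 0"
    \<comment> \<open>This choice rotates \<open>\<delta> * L Q\<close> onto the positive real axis,
      contradicting the inequality.\<close>
    define \<delta> where "\<delta> = of_real (d / norm (L Q)) * cnj (L Q)"
    have \<delta>: "norm \<delta> = d" using nz d by (simp add: \<delta>_def norm_mult norm_divide)
    have "L (\<lambda>z. (exp T * \<delta>) *s Q z) = of_real (exp T * (d / norm (L Q))) * (L Q * cnj (L Q))"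
      unfolding L_smult[OF hQ] by (simp add: \<delta>_def)
    also have "\<dots> = of_real (exp T * (d / norm (L Q)) * (norm (L Q))\<^sup>2)"
      unfolding complex_norm_square[symmetric] by simp
    finally have "Re (L (\<lambda>z. (exp T * \<delta>) *s Q z)) = exp T * (d / norm (L Q)) * (norm (L Q))\<^sup>2" by simp
    moreover have "exp T * (d / norm (L Q)) * (norm (L Q))\<^sup>2 > 0" using nz d by simp
    ultimately show False using var[OF \<delta>] by simp
  qed
  then show "L (\<lambda>z. DF (phiT z) (q (phiT z))) = 0" by (simp add: Q_def[abs_def])
qed

end

subsection \<open>Vanishing of the derivative functional\<close>

lemma nonpos_if_le_mult_pos:
  fixes x A :: real
  assumes "A \<ge> 0" "\<And>e. e > 0 \<Longrightarrow> x \<le> A * e"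
  shows "x \<le> 0"
proof (rule field_le_epsilon)
  fix e :: real assume e: "e > 0"
  have "x \<le> A * (e / (A + 1))" by (rule assms(2)) (use assms(1) e in simp)
  also have "\<dots> = e * (A / (A + 1))" by simp
  also have "\<dots> \<le> e * 1" using assms(1) e by (intro mult_left_mono) auto
  finally show "x \<le> 0 + e" by simp
qed

context extremal_regular_time
begin

lemma L_bounded_cball:
  obtains r C where "0 < r" "r < 1" "C \<ge> 0"
    "\<And>h \<eta>. \<lbrakk>hol_on h unit_ball; \<eta> > 0; \<And>z. norm z \<le> r \<Longrightarrow> norm (h z) \<le> \<eta>\<rbrakk> \<Longrightarrow> norm (L h) \<le> C * \<eta>"
proof -
  obtain K C where K: "compact K" "K \<subseteq> unit_ball" and C: "C \<ge> 0"
    "\<And>h \<eta>. \<lbrakk>hol_on h unit_ball; \<eta> > 0; \<And>z. z \<in> K \<Longrightarrow> norm (h z) \<le> \<eta>\<rbrakk> \<Longrightarrow> norm (L h) \<le> C * \<eta>"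
    using L_bounded by blast
  obtain r where r: "0 < r" "r < 1" "K \<subseteq> cball 0 r"
    using compact_subset_ball_cball[OF K zero_less_one] by blast
  show ?thesis
  proof (rule that[OF r(1,2) C(1)])
    fix h :: "complex ^ 'n \<Rightarrow> complex ^ 'n" and \<eta> :: real
    assume h: "hol_on h unit_ball" "\<eta> > 0" "\<And>z. norm z \<le> r \<Longrightarrow> norm (h z) \<le> \<eta>"
    show "norm (L h) \<le> C * \<eta>" by (rule C(2)[OF h(1,2)]) (use h(3) r(3) in auto)
  qed
qed

text \<open>Order at least two is expressed by a bound near 0 with free constants, a form that
  survives solving the linear equation for \<open>DF\<close> and composing with an inverse
  flow.\<close>

definition vanishes_at :: "real \<Rightarrow> bool" where
  "vanishes_at t \<longleftrightarrow> (\<forall>p C \<rho>. hol_on p unit_ball \<longrightarrow> \<rho> > 0 \<longrightarrow>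
     (\<forall>z. norm z < \<rho> \<longrightarrow> norm (p z) \<le> C * (norm z)\<^sup>2) \<longrightarrow> L (\<lambda>z. p (ev G t z)) = 0)"

lemma DF_lower:
  assumes "0 < r" "r < 1" "norm z < r"
  shows "norm (DF z v) \<ge> exp (- (field_const TYPE(complex ^ 'n) r * decay_const r)) * norm v"
  by (rule evlim_derivative_injective[OF S0_Hol nice_field_time_shift[OF G] assms DF(1)]) (use assms in auto)

lemma hol_on_compose_ev:
  assumes "hol_on p unit_ball" "0 \<le> t"
  shows "hol_on (\<lambda>z. p (ev G t z)) unit_ball"
proof (rule hol_on_compose[OF hol_on_ev[OF S0_Hol G assms(2)] assms(1)])
  show "ev G t ` unit_ball \<subseteq> unit_ball"
  proof (rule image_subsetI)
    fix z :: "complex ^ 'n" assume "z \<in> unit_ball"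
    then show "ev G t z \<in> unit_ball" using norm_ev_le[OF G _ assms(2), of z] by simp
  qed
qed

text \<open>The solution \<open>q\<close> of \<open>DF z (q z) = p z\<close> inherits order two only
  near 0, while \<open>L_DF_zero\<close> asks for a quadratic bound on the whole ball. Polynomial
  approximations \<open>q'\<close> have one, and boundedness of \<open>L\<close> passes the
  vanishing to the limit.\<close>

lemma vanishes_at_T: "vanishes_at T"
  unfolding vanishes_at_def
proof (intro allI impI)
  fix p :: "complex ^ 'n \<Rightarrow> complex ^ 'n" and C \<rho> :: real
  assume p: "hol_on p unit_ball" and \<rho>: "\<rho> > 0" and pq: "\<forall>z. norm z < \<rho> \<longrightarrow> norm (p z) \<le> C * (norm z)\<^sup>2"
  have inj: "v = 0" if "z \<in> unit_ball" "DF z v = 0" for z v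
  proof -
    have z: "norm z < 1" using that by simp
    have r: "0 < (norm z + 1) / 2" "(norm z + 1) / 2 < 1" "norm z < (norm z + 1) / 2"
      using z by (auto simp: add_nonneg_pos)
    have "exp (- (field_const TYPE(complex ^ 'n) ((norm z + 1) / 2) * decay_const ((norm z + 1) / 2))) * norm v \<le> 0"
      using DF_lower[OF r, of v] that(2) by simp
    then show ?thesis by (simp add: mult_le_0_iff)
  qed
  have D: "(evlim (time_shift G T) has_derivative DF z) (at z)" "DF z (a *s v) = a *s DF z v"
    if "z \<in> unit_ball" for z a v
    using DF that by simp_all
  obtain q where q: "hol_on q unit_ball" "\<And>z. z \<in> unit_ball \<Longrightarrow> DF z (q z) = p z"
    by (rule hol_on_solve_derivative[OF hol_on_FT D inj p], assumption+, rule that, assumption+)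
  define \<kappa> where "\<kappa> = exp (- (field_const TYPE(complex ^ 'n) (1/2) * decay_const (1/2)))"
  have \<kappa>: "\<kappa> > 0" by (simp add: \<kappa>_def)
  have qq: "norm (q z) \<le> C / \<kappa> * (norm z)\<^sup>2" if z: "norm z < min \<rho> (1/2)" for z
  proof -
    have "\<kappa> * norm (q z) \<le> norm (DF z (q z))"
      unfolding \<kappa>_def by (rule DF_lower) (use z in auto)
    also have "\<dots> \<le> C * (norm z)\<^sup>2" using q(2)[of z] pq z by simp
    finally show ?thesis using \<kappa> by (simp add: pos_le_divide_eq mult.commute)
  qed
  have \<rho>': "min \<rho> (1/2) > 0" using \<rho> by simp
  obtain r CL where r: "0 < r" "r < 1" and CL: "CL \<ge> 0"
    "\<And>h \<eta>. \<lbrakk>hol_on h unit_ball; \<eta> > 0; \<And>z. norm z \<le> r \<Longrightarrow> norm (h z) \<le> \<eta>\<rbrakk> \<Longrightarrow> norm (L h) \<le> CL * \<eta>"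
    using L_bounded_cball by blast
  obtain B where B: "B > 0" "\<And>p v. norm p \<le> r \<Longrightarrow> norm (DF p v) \<le> B * norm v"
    using FT_bounds[OF r] by blast
  have hp: "hol_on (\<lambda>z. p (phiT z)) unit_ball" using hol_on_compose_ev[OF p] T by simp
  have "norm (L (\<lambda>z. p (phiT z))) \<le> (CL * B) * e" if e: "e > 0" for e
  proof -
    obtain q' C' where q': "hol_on q' unit_ball" "\<And>z. z \<in> unit_ball \<Longrightarrow> norm (q' z) \<le> C' * (norm z)\<^sup>2"
      "\<And>z. z \<in> cball 0 r \<Longrightarrow> norm (q z - q' z) \<le> e"
      by (rule quadratic_approximation[OF q(1) r \<rho>' qq e], assumption, rule that, assumption+)
    have q'2: "norm (q' z) \<le> C' * (norm z)\<^sup>2" if "norm z < 1" for z using q'(2) that by simp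
    define Q where "Q z = DF (phiT z) (q' (phiT z))" for z
    have Q: "hol_on Q unit_ball" "L Q = 0"
      unfolding Q_def[abs_def] by (rule hol_on_DF[OF q'(1) q'2] L_DF_eq_0[OF q'(1) q'2]; assumption)+
    have "norm (L (\<lambda>z. p (phiT z) - Q z)) \<le> CL * (B * e)"
    proof (rule CL(2))
      show "hol_on (\<lambda>z. p (phiT z) - Q z) unit_ball" by (intro hol_on_diff hp Q)
      show "norm (p (phiT z) - Q z) \<le> B * e" if z: "norm z \<le> r" for z
      proof -
        have n: "norm (phiT z) \<le> r" by (rule phiT_cball[OF z r(2)])
        then have n1: "norm (phiT z) < 1" using r by simp
        have "p (phiT z) - Q z = DF (phiT z) (q (phiT z) - q' (phiT z))"
          using q(2)[of "phiT z"] n1 by (simp add: Q_def DF_diff[OF n1])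
        then have "norm (p (phiT z) - Q z) \<le> B * norm (q (phiT z) - q' (phiT z))" using B(2)[OF n] by simp
        also have "\<dots> \<le> B * e" using q'(3)[of "phiT z"] n B(1) by (intro mult_left_mono) auto
        finally show ?thesis .
      qed
    qed (use B e in simp)
    then show ?thesis using L_diff[OF hp Q(1)] Q(2) by (simp add: mult.assoc)
  qed
  then have "norm (L (\<lambda>z. p (phiT z))) \<le> 0"
    by (intro nonpos_if_le_mult_pos[of "CL * B"]) (use CL B in auto)
  then show "L (\<lambda>z. p (phiT z)) = 0" by simp
qed

text \<open>A short flow is close to the identity, so its image contains a ball larger than the one
  carrying the functional; there the inverse flow is approximated by Taylor polynomials. This replaces
  the fact that images of evolution families are Runge domains.\<close>

lemma vanishes_at_step:
  obtains \<eta> where "\<eta> > 0" "\<And>s \<tau>. \<lbrakk>0 \<le> s; 0 \<le> \<tau>; \<tau> \<le> \<eta>; vanishes_at (s + \<tau>)\<rbrakk> \<Longrightarrow> vanishes_at s"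
proof -
  obtain r CL where r: "0 < r" "r < 1" and CL: "CL \<ge> 0"
    "\<And>h \<eta>. \<lbrakk>hol_on h unit_ball; \<eta> > 0; \<And>z. norm z \<le> r \<Longrightarrow> norm (h z) \<le> \<eta>\<rbrakk> \<Longrightarrow> norm (L h) \<le> CL * \<eta>"
    using L_bounded_cball by blast
  \<comment> \<open>The radii \<open>r < R2 < R1 < 1\<close> are equally spaced. Below time
    \<open>\<eta> = (R1 - R2) / M\<close> the flow moves points of \<open>cball 0 R1\<close> by at
    most \<open>R1 - R2\<close>.\<close>
  define R1 where "R1 = (2 + r) / 3"
  define R2 where "R2 = (1 + 2 * r) / 3"
  have R: "0 < R1" "R1 < 1" "r < R2" "R2 < R1" "0 < R2" using r by (auto simp: R1_def R2_def)
  define M where "M = field_const TYPE(complex ^ 'n) R1 + 1"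
  have M: "M > 0" using field_const_nonneg[OF G R(1,2) refl] by (simp add: M_def)
  define \<eta> where "\<eta> = (R1 - R2) / M"
  have \<eta>: "\<eta> > 0" using R M by (simp add: \<eta>_def)
  show ?thesis
  proof (rule that[OF \<eta>])
    fix s \<tau> :: real assume s: "0 \<le> s" and \<tau>: "0 \<le> \<tau>" "\<tau> \<le> \<eta>" and van: "vanishes_at (s + \<tau>)"
    define \<psi> where "\<psi> = ev (time_shift G s) \<tau>"
    have S: "nice_field (time_shift G s)" by (rule nice_field_time_shift[OF G])
    have h\<psi>: "hol_on \<psi> unit_ball" unfolding \<psi>_def by (rule hol_on_ev[OF S0_Hol S \<tau>(1)])
    have low: "norm (\<psi> z - \<psi> w) \<ge> exp (- (field_const TYPE(complex ^ 'n) \<rho> + 1) * \<tau>) * norm (z - w)"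
      if "0 < \<rho>" "\<rho> < 1" "norm z \<le> \<rho>" "norm w \<le> \<rho>" for z w \<rho>
    proof -
      have zw: "norm z < 1" "norm w < 1" using that by auto
      show ?thesis
        using solves_lipschitz_lower[OF S ev_solves[OF S zw(1) \<tau>(1)] ev_solves[OF S zw(2) \<tau>(1)] \<tau>(1) order_refl that(1,2) _ _ refl] that
        by (simp add: \<psi>_def ev_0[OF S zw(1)] ev_0[OF S zw(2)])
    qed
    have \<psi>0: "\<psi> 0 = 0" using norm_ev_le[OF S, of 0 \<tau>] \<tau> by (simp add: \<psi>_def)
    have inj: "inj_on \<psi> unit_ball"
    proof (rule inj_onI)
      fix z w :: "complex ^ 'n" assume zw: "z \<in> unit_ball" "w \<in> unit_ball" "\<psi> z = \<psi> w"
      define \<rho> where "\<rho> = (max (norm z) (norm w) + 1) / 2"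
      have "0 < \<rho>" "\<rho> < 1" "norm z \<le> \<rho>" "norm w \<le> \<rho>"
        using zw by (auto simp: \<rho>_def add_nonneg_pos le_max_iff_disj max_def)
      from low[OF this] zw(3) have "exp (- (field_const TYPE(complex ^ 'n) \<rho> + 1) * \<tau>) * norm (z - w) \<le> 0" by simp
      then show "z = w" by (simp add: mult_le_0_iff)
    qed
    define k where "k = inv_into unit_ball \<psi>"
    have k: "k (\<psi> z) = z" if "z \<in> unit_ball" for z unfolding k_def by (rule inv_into_f_f[OF inj that])
    \<comment> \<open>By Brouwer: for \<open>x\<close> in \<open>cball 0 R2\<close> the map
      \<open>y \<mapsto> x + (y - \<psi> y)\<close> sends \<open>cball 0 R1\<close> into itself, and
      a fixed point solves \<open>\<psi> y = x\<close>.\<close>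
    have surj: "\<exists>y\<in>cball 0 R1. \<psi> y = x" if x: "x \<in> cball 0 R2" for x
    proof (rule brouwer_surjective_cball[OF _ R(1) x])
      show "continuous_on (cball 0 R1) \<psi>"
        by (rule continuous_on_subset[OF hol_on_continuous_on[OF h\<psi>]]) (use R in auto)
      fix x y :: "complex ^ 'n" assume xy: "x \<in> cball 0 R2" "y \<in> cball 0 R1"
      have y1: "norm y < 1" "norm y \<le> R1" using xy R by auto
      have "norm (\<psi> y - y) \<le> M * \<tau>"
        using solves_speed(1)[OF S ev_solves[OF S y1(1) \<tau>(1)] \<tau>(1) order_refl R(1,2) _ M_def] y1
        by (simp add: \<psi>_def ev_0[OF S y1(1)])
      also have "\<dots> \<le> M * \<eta>" using \<tau> M by (intro mult_left_mono) auto
      also have "\<dots> = R1 - R2" using M by (simp add: \<eta>_def)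
      finally show "x + (y - \<psi> y) \<in> cball 0 R1"
        using norm_triangle_ineq[of x "y - \<psi> y"] xy by (simp add: norm_minus_commute)
    qed
    have k_R1: "k x \<in> cball 0 R1" "\<psi> (k x) = x" if x: "x \<in> cball 0 R2" for x
    proof -
      obtain y where "y \<in> cball 0 R1" "\<psi> y = x" using surj[OF x] by blast
      moreover from this have "k x = y" using k[of y] R by auto
      ultimately show "k x \<in> cball 0 R1" "\<psi> (k x) = x" by auto
    qed
    have "hol_on k (\<psi> ` unit_ball)"
    proof (rule hol_on_inverse[OF open_ball h\<psi> k])
      fix z D v assume z: "z \<in> unit_ball" and D: "(\<psi> has_derivative D) (at z)" and v: "D v = 0"
      define \<rho> where "\<rho> = (norm z + 1) / 2"
      have \<rho>: "0 < \<rho>" "\<rho> < 1" "norm z < \<rho>" using z by (auto simp: \<rho>_def add_nonneg_pos)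
      have "exp (- (field_const TYPE(complex ^ 'n) \<rho> + 1) * \<tau>) * norm v \<le> norm (D v)"
        by (rule has_derivative_lower_bound[OF D open_ball[of 0 \<rho>] _ low[OF \<rho>(1,2)]]) (use \<rho> in auto)
      then show "v = 0" using v by (simp add: mult_le_0_iff)
    qed
    moreover have "ball 0 R2 \<subseteq> \<psi> ` unit_ball"
    proof
      fix x :: "complex ^ 'n" assume "x \<in> ball 0 R2"
      then have "x \<in> cball 0 R2" by simp
      from k_R1[OF this] show "x \<in> \<psi> ` unit_ball" using R by (intro image_eqI[of _ _ "k x"]) auto
    qed
    ultimately have hk: "hol_on k (ball 0 R2)" by (rule hol_on_subset)
    show "vanishes_at s"
      unfolding vanishes_at_def
    proof (intro allI impI)
      fix p :: "complex ^ 'n \<Rightarrow> complex ^ 'n" and C \<rho> :: real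
      assume p: "hol_on p unit_ball" and \<rho>: "\<rho> > 0" and pq: "\<forall>z. norm z < \<rho> \<longrightarrow> norm (p z) \<le> C * (norm z)\<^sup>2"
      have hp: "hol_on (\<lambda>z. p (ev G s z)) unit_ball" by (rule hol_on_compose_ev[OF p s])
      define f where "f z = p (k z)" for z
      have kball: "k ` ball 0 R2 \<subseteq> unit_ball"
      proof (rule image_subsetI)
        fix x :: "complex ^ 'n" assume "x \<in> ball 0 R2"
        then have "x \<in> cball 0 R2" by simp
        from k_R1(1)[OF this] show "k x \<in> unit_ball" using R by simp
      qed
      have hf: "hol_on f (ball 0 R2)"
        unfolding f_def by (rule hol_on_compose[OF hk p]) (rule kball)
      define l where "l = exp (M * \<tau>)"
      have l: "l > 0" by (simp add: l_def)
      have kl: "norm (k x) \<le> l * norm x" if x: "norm x < R2" for x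
      proof -
        have "exp (- M * \<tau>) * norm (k x - 0) \<le> norm (\<psi> (k x) - \<psi> 0)"
          unfolding M_def by (rule low[OF R(1,2)]) (use k_R1[of x] x R in auto)
        then have "exp (- M * \<tau>) * norm (k x) \<le> norm x" using k_R1(2)[of x] x \<psi>0 by simp
        then have "l * (exp (- M * \<tau>) * norm (k x)) \<le> l * norm x" using l by (intro mult_left_mono) auto
        moreover have "l * (exp (- M * \<tau>) * norm (k x)) = norm (k x)"
          by (simp add: l_def exp_minus)
        ultimately show ?thesis by linarith
      qed
      define \<rho>' where "\<rho>' = min R2 (\<rho> / l)"
      have \<rho>': "\<rho>' > 0" using \<rho> R l by (simp add: \<rho>'_def)
      have fq: "norm (f x) \<le> (\<bar>C\<bar> * l\<^sup>2) * (norm x)\<^sup>2" if x: "norm x < \<rho>'" for x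
      proof -
        have kx: "norm (k x) \<le> l * norm x" using x by (intro kl) (simp add: \<rho>'_def)
        also have "\<dots> < \<rho>" using x l by (simp add: \<rho>'_def pos_less_divide_eq mult.commute)
        finally have "norm (f x) \<le> C * (norm (k x))\<^sup>2" using pq by (simp add: f_def)
        also have "\<dots> \<le> \<bar>C\<bar> * (norm (k x))\<^sup>2" by (intro mult_right_mono) auto
        also have "\<dots> \<le> \<bar>C\<bar> * (l * norm x)\<^sup>2" using kx by (intro mult_left_mono power_mono) auto
        finally show ?thesis by (simp add: power_mult_distrib mult.assoc)
      qed
      have "norm (L (\<lambda>z. p (ev G s z))) \<le> CL * e" if e: "e > 0" for e
      proof -
        \<comment> \<open>The function \<open>f = p \<circ> k\<close> undoes the short flow, so
          \<open>q\<close> composed with the flow at time \<open>s + \<tau>\<close> approximates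
          \<open>p\<close> composed with the flow at time \<open>s\<close>; on the former
          \<open>L\<close> vanishes.\<close>
        obtain q C' where q: "hol_on q unit_ball" "\<And>z. z \<in> unit_ball \<Longrightarrow> norm (q z) \<le> C' * (norm z)\<^sup>2"
          "\<And>z. z \<in> cball 0 r \<Longrightarrow> norm (f z - q z) \<le> e"
          by (rule quadratic_approximation[OF hf r(1) R(3) \<rho>' fq e], assumption, rule that, assumption+)
        have t: "0 \<le> s + \<tau>" using s \<tau> by simp
        have Lq: "L (\<lambda>z. q (ev G (s + \<tau>) z)) = 0"
          using van[unfolded vanishes_at_def, rule_format, of q 1 C'] q(1,2) by simp
        have hq: "hol_on (\<lambda>z. q (ev G (s + \<tau>) z)) unit_ball" by (rule hol_on_compose_ev[OF q(1) t])
        have "norm (L (\<lambda>z. p (ev G s z) - q (ev G (s + \<tau>) z))) \<le> CL * e"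
        proof (rule CL(2)[OF hol_on_diff[OF hp hq] e])
          fix z :: "complex ^ 'n" assume z: "norm z \<le> r"
          then have z1: "norm z < 1" using r by simp
          have w: "ev G (s + \<tau>) z = \<psi> (ev G s z)"
            using ev_cocycle[OF G z1 s, of "s + \<tau>"] \<tau> by (simp add: \<psi>_def)
          have "ev G s z \<in> unit_ball" using norm_ev_le[OF G z1 s] z1 by simp
          then have "f (ev G (s + \<tau>) z) = p (ev G s z)" by (simp add: f_def w k)
          moreover have "ev G (s + \<tau>) z \<in> cball 0 r" using norm_ev_le[OF G z1 t] z by simp
          ultimately show "norm (p (ev G s z) - q (ev G (s + \<tau>) z)) \<le> e" using q(3) by metis
        qed
        then show ?thesis using L_diff[OF hp hq] Lq by simp
      qed
      then have "norm (L (\<lambda>z. p (ev G s z))) \<le> 0"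
        by (intro nonpos_if_le_mult_pos[OF CL(1)])
      then show "L (\<lambda>z. p (ev G s z)) = 0" by simp
    qed
  qed
qed

text \<open>The admissible step length is the same at every time, so \<open>n > T / \<eta>\<close>
  equal steps lead from \<open>T\<close> to 0.\<close>

lemma vanishes_at_0: "vanishes_at 0"
proof -
  obtain \<eta> where \<eta>: "\<eta> > 0" "\<And>s \<tau>. \<lbrakk>0 \<le> s; 0 \<le> \<tau>; \<tau> \<le> \<eta>; vanishes_at (s + \<tau>)\<rbrakk> \<Longrightarrow> vanishes_at s"
    using vanishes_at_step by blast
  obtain n :: nat where n: "T / \<eta> < real n" using reals_Archimedean2 by blast
  have n0: "real n > 0" using n T \<eta>(1) divide_pos_pos[of T \<eta>] by linarith
  define \<tau> where "\<tau> = T / real n"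
  have "T < real n * \<eta>" using n \<eta>(1) by (simp add: pos_divide_less_eq)
  then have \<tau>: "0 \<le> \<tau>" "\<tau> \<le> \<eta>" using T n0 by (auto simp: \<tau>_def pos_divide_le_eq mult.commute)
  have "vanishes_at (real (n - j) * \<tau>)" if "j \<le> n" for j
    using that
  proof (induction j)
    case 0
    then show ?case using vanishes_at_T n0 by (simp add: \<tau>_def)
  next
    case (Suc j)
    have "real (n - Suc j) * \<tau> + \<tau> = real (n - j) * \<tau>"
      using Suc.prems by (simp add: of_nat_diff algebra_simps)
    then show ?case using \<eta>(2)[of "real (n - Suc j) * \<tau>" \<tau>] Suc \<tau> by simp
  qed
  from this[of n] show ?thesis by simp
qed

lemma L_eq_0:
  assumes p: "hol_on p unit_ball" and \<rho>: "\<rho> > 0" and pq: "\<And>z. norm z < \<rho> \<Longrightarrow> norm (p z) \<le> C * (norm z)\<^sup>2"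
  shows "L p = 0"
proof -
  have "L (\<lambda>z. p (ev G 0 z)) = 0" using vanishes_at_0 assms unfolding vanishes_at_def by blast
  moreover have "L (\<lambda>z. p (ev G 0 z)) = L p" by (rule L_eqI) (simp add: ev_0[OF G])
  ultimately show ?thesis by simp
qed

end

text \<open>The rate estimate is used at time 0 with the smaller radius equal to
  \<open>norm z\<close>: there \<open>decay_const (norm z)\<close> is at most a multiple of
  \<open>norm z\<close>, and its square gives order two. Hence any two members of
  \<open>class_S0\<close> differ by a map of order two.\<close>

lemma evlim_quadratic:
  fixes G :: "complex ^ 'n \<Rightarrow> real \<Rightarrow> complex ^ 'n"
  assumes G: "nice_field G" and z: "norm z < 1/2"
  shows "norm (evlim G z - z) \<le> field_const TYPE(complex ^ 'n) (1/2) * (exp 3)\<^sup>2 * (norm z)\<^sup>2"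
proof (cases "z = 0")
  case True
  have n: "norm (0 :: complex ^ 'n) < 1" by simp
  have "ev G t 0 = 0" if "t \<ge> 0" for t using norm_ev_le[OF G n that] by simp
  then have "evlim G 0 = 0" by (simp add: evlim_def lim_const)
  then show ?thesis using True by simp
next
  case False
  define a where "a = norm z"
  have a: "0 < a" "a \<le> 1/2" using z False by (auto simp: a_def)
  have r: "0 < (1/2 :: real)" "(1/2 :: real) < 1" by auto
  have C: "field_const TYPE(complex ^ 'n) (1/2) \<ge> 0" by (rule field_const(1)) auto
  have z1: "norm z < 1" using z by simp
  have "norm (exp 0 *\<^sub>R ev G 0 z - evlim G z) \<le> field_const TYPE(complex ^ 'n) (1/2) * (decay_const a)\<^sup>2 * exp (- 0)"
    by (rule ev_tendsto_evlim_rate[OF G r a]) (simp_all add: a_def)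
  then have "norm (evlim G z - z) \<le> field_const TYPE(complex ^ 'n) (1/2) * (decay_const a)\<^sup>2"
    by (simp add: ev_0[OF G z1] norm_minus_commute)
  also have "\<dots> \<le> field_const TYPE(complex ^ 'n) (1/2) * (a * exp 3)\<^sup>2"
  proof (intro mult_left_mono power_mono C)
    \<comment> \<open>Equality holds at \<open>a = 1/2\<close>, the largest value allowed; this is
      the origin of the constant \<open>exp 3\<close>.\<close>
    have "2 * a * (1 + a) \<le> 3 * (1 - a)"
      using mult_mono[of a "1/2" a "1/2"] a by (simp add: algebra_simps)
    then have "2 * a / ((1 - a) / (1 + a)) \<le> 3"
      using a by (simp add: pos_divide_le_eq)
    then show "decay_const a \<le> a * exp 3"
      unfolding decay_const_def using a by (intro mult_left_mono) auto
    show "0 \<le> decay_const a" using decay_const_pos[OF a(1)] by simp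
  qed
  finally show ?thesis by (simp add: a_def power_mult_distrib mult_ac)
qed

section \<open>Members of \<open>class_S0\<close> as limit maps, and the conclusion\<close>

lemma class_S0_eq_evlim:
  fixes F :: "complex ^ 'n \<Rightarrow> complex ^ 'n"
  assumes her: "herglotz_vector_field G" and evo: "evolution G \<phi>" and lim: "evolution_limit \<phi> F"
    and G': "nice_field G'" and N: "negligible N"
    and eq: "\<And>z t. \<lbrakk>z \<in> unit_ball; 0 < t; t \<notin> N\<rbrakk> \<Longrightarrow> G' z t = G z t"
  shows "F = restrict (evlim G') unit_ball"
proof
  fix z :: "complex ^ 'n"
  show "F z = restrict (evlim G') unit_ball z"
  proof (cases "z \<in> unit_ball")
    case True
    have "compact {z}" "{z} \<subseteq> unit_ball" using True by auto
    then have "uniform_limit {z} (scaled_evolution \<phi>) F at_top"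
      using lim unfolding evolution_limit_def loc_uniform_limit_def by blast
    then have 1: "((\<lambda>t. scaled_evolution \<phi> t z) \<longlongrightarrow> F z) at_top" by (rule tendsto_uniform_limitI) simp
    have "((\<lambda>t. exp t *\<^sub>R ev G' t z) \<longlongrightarrow> evlim G' z) at_top"
      using ev_tendsto_evlim[OF G'] True by simp
    moreover have "\<forall>\<^sub>F t in at_top. exp t *\<^sub>R ev G' t z = scaled_evolution \<phi> t z"
      using eventually_ge_at_top[of 0]
      by eventually_elim (use evolution_eq_ev[OF evo G' N eq True] True in \<open>simp add: scaled_evolution_def\<close>)
    ultimately have "((\<lambda>t. scaled_evolution \<phi> t z) \<longlongrightarrow> evlim G' z) at_top" by (rule Lim_transform_eventually)
    with 1 have "F z = evlim G' z" using tendsto_unique[OF trivial_limit_at_top_linorder] by blast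
    then show ?thesis using True by simp
  next
    case False
    then show ?thesis using lim unfolding evolution_limit_def by (auto simp: extensional_def)
  qed
qed

lemma class_S0_evlim:
  fixes F :: "complex ^ 'n \<Rightarrow> complex ^ 'n"
  assumes "F \<in> class_S0"
  obtains G where "nice_field G" "F = restrict (evlim G) unit_ball"
proof -
  obtain G \<phi> where *: "herglotz_vector_field G" "evolution G \<phi>" "evolution_limit \<phi> F"
    using assms unfolding class_S0_def by blast
  obtain G' N where G': "nice_field G'" "negligible N" "\<And>z t. \<lbrakk>z \<in> unit_ball; 0 < t; t \<notin> N\<rbrakk> \<Longrightarrow> G' z t = G z t"
    using herglotz_nice_field[OF *(1)] by blast
  show ?thesis by (rule that[OF G'(1) class_S0_eq_evlim[OF * G']])
qed

lemma not_extremal: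
  fixes G :: "complex ^ 'n \<Rightarrow> real \<Rightarrow> complex ^ 'n"
  assumes G: "nice_field G" and T: "0 < T" and c: "0 < c"
    and avg: "\<And>K. compact K \<Longrightarrow> K \<subseteq> unit_ball \<Longrightarrow>
      uniform_limit K (\<lambda>\<epsilon> z. (1 / \<epsilon>) *\<^sub>R integral {T - \<epsilon>..T} (G z)) g (at_right 0)"
    and strict: "\<And>z. norm z < 1 \<Longrightarrow> Re (hinner (g z) z) \<le> - c * (norm z)\<^sup>2"
  shows "\<not> extremal (restrict (evlim G) unit_ball)"
proof
  define F where "F = restrict (evlim G) unit_ball"
  assume "extremal (restrict (evlim G) unit_ball)"
  then obtain U \<Phi> \<L> where U: "openin Hol_topology U" "class_S0 \<subseteq> U"
    and der: "has_functional_derivative U \<Phi> F \<L>"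
    and max: "\<And>f. f \<in> class_S0 \<Longrightarrow> Re (\<Phi> f) \<le> Re (\<Phi> F)" and nc: "\<not> \<L> constant_on class_S0"
    unfolding extremal_def F_def[symmetric] by blast
  obtain V \<Lambda> where V: "openin Hol_topology V" "F \<in> V"
    and diff: "\<forall>f\<in>V. \<forall>h\<in>Hol. differentiable_along \<Phi> f h (\<Lambda> f h)"
    and cont: "continuous_map (prod_topology (subtopology Hol_topology V) Hol_topology) euclidean (\<lambda>(f, h). \<Lambda> f h)"
    and \<L>: "\<forall>h\<in>Hol. \<L> h = \<Lambda> F h"
    using der unfolding has_functional_derivative_def by blast
  have S0: "(class_S0 :: (complex ^ 'n \<Rightarrow> complex ^ 'n) set) \<subseteq> Hol"
    using U Hol_topology_nbhd(1)[OF U(1)] by blast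
  interpret extremal_regular_time \<Phi> V \<Lambda> F G T c g
    by unfold_locales (use V diff cont S0 G T c avg strict max in \<open>auto simp: F_def\<close>)
  have "\<L> f = \<L> F" if f: "f \<in> class_S0" for f
  proof -
    obtain H where H: "nice_field H" "f = restrict (evlim H) unit_ball" using class_S0_evlim[OF f] .
    have fH: "hol_on f unit_ball" "f \<in> extensional unit_ball" and FH: "hol_on F unit_ball" "F \<in> extensional unit_ball"
      using f S0 F_Hol by (auto simp: Hol_iff)
    define C where "C = field_const TYPE(complex ^ 'n) (1/2) * (exp 3)\<^sup>2"
    have "L (\<lambda>z. f z - F z) = 0"
    proof (rule L_eq_0[OF hol_on_diff[OF fH(1) FH(1)], of "1/2" "2 * C"])
      fix z :: "complex ^ 'n" assume z: "norm z < 1/2"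
      have "f z - F z = (evlim H z - z) - (evlim G z - z)" using z by (simp add: H(2) F_def)
      also have "norm \<dots> \<le> norm (evlim H z - z) + norm (evlim G z - z)" by (rule norm_triangle_ineq4)
      also have "\<dots> \<le> C * (norm z)\<^sup>2 + C * (norm z)\<^sup>2"
        unfolding C_def by (intro add_mono evlim_quadratic H(1) G z)
      finally show "norm (f z - F z) \<le> 2 * C * (norm z)\<^sup>2" by simp
    qed simp
    then have "L f = L F" using L_diff[OF fH(1) FH(1)] by simp
    moreover have "restrict f unit_ball = f" "restrict F unit_ball = F"
      using fH(2) FH(2) by (simp_all add: extensional_restrict)
    ultimately show ?thesis using \<L> f S0 F_Hol by (auto simp: L_def)
  qed
  then show False using nc unfolding constant_on_def by blast
qed

text \<open>Agreement of \<open>G'\<close> with \<open>G\<close> is asked only up to time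
  \<open>T\<close>, so the full evolution and all evolutions stopped after \<open>T\<close> are
  treated at once.\<close>

lemma evolution_limit_not_extremal:
  fixes G :: "complex ^ 'n \<Rightarrow> real \<Rightarrow> complex ^ 'n"
  assumes her: "herglotz_vector_field G"
    and exc: "exceptional_set G E" and T: "T \<in> {0<..} - E"
    and sup: "(SUP z\<in>unit_ball - {0}. ereal (Re (hinner (G z T) ((1 / (norm z)\<^sup>2) *\<^sub>R z)))) < 0"
    and G': "nice_field G'" and N: "negligible N"
    and eq: "\<And>z t. \<lbrakk>z \<in> unit_ball; 0 < t; t \<notin> N; t \<le> T\<rbrakk> \<Longrightarrow> G' z t = G z t"
  shows "\<not> extremal (restrict (evlim G') unit_ball)"
proof -
  have T0: "0 < T" using T by simp
  \<comment> \<open>A real number strictly between the supremum and 0 turns the hypothesis into a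
    uniform gap \<open>c = - x\<close>, also when the supremum is not finite.\<close>
  obtain x where x: "(SUP z\<in>unit_ball - {0}. ereal (Re (hinner (G z T) ((1 / (norm z)\<^sup>2) *\<^sub>R z)))) < ereal x" "ereal x < 0"
    using ereal_dense2[OF sup] by blast
  have x0: "x < 0" using x(2) by simp
  have strict: "Re (hinner (if z = 0 then 0 else G z T) z) \<le> - (- x) * (norm z)\<^sup>2" if z: "norm z < 1" for z
  proof (cases "z = 0")
    case False
    have "ereal (Re (hinner (G z T) ((1 / (norm z)\<^sup>2) *\<^sub>R z))) \<le> (SUP z\<in>unit_ball - {0}. ereal (Re (hinner (G z T) ((1 / (norm z)\<^sup>2) *\<^sub>R z))))"
      by (rule SUP_upper) (use z False in auto)
    then have "Re (hinner (G z T) ((1 / (norm z)\<^sup>2) *\<^sub>R z)) < x" using x(1) le_less_trans by fastforce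
    then have "Re (hinner (G z T) z) / (norm z)\<^sup>2 < x" unfolding hinner_scaleR_right by simp
    then show ?thesis using False by (simp add: pos_divide_less_eq)
  qed simp
  define g where "g z = G z T" for z
  have avg: "uniform_limit K (\<lambda>\<epsilon> z. (1 / \<epsilon>) *\<^sub>R integral {T - \<epsilon>..T} (G' z)) g (at_right 0)"
    if K: "compact K" "K \<subseteq> unit_ball" for K
  proof -
    have u: "uniform_limit K (\<lambda>\<epsilon> z. (1 / \<epsilon>) *\<^sub>R (LINT \<sigma>:{T - \<epsilon>..T}|lebesgue. G z \<sigma>)) g (at_right 0)"
      using exc T K unfolding exceptional_set_def loc_uniform_limit_def g_def by blast
    have LI: "(LINT \<sigma>:{T - \<epsilon>..T}|lebesgue. G z \<sigma>) = integral {T - \<epsilon>..T} (G' z)"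
      if e: "0 < \<epsilon>" "\<epsilon> < T" and z: "z \<in> unit_ball" for \<epsilon> z
    proof -
      have mG: "G z \<in> borel_measurable (lebesgue_on {0<..})" using her z by (simp add: herglotz_vector_field_def)
      have mG': "G' z \<in> borel_measurable lebesgue" using G' z by (simp add: nice_field_def)
      \<comment> \<open>The given field is measurable on positive times only, so it is first
        extended by 0; for \<open>\<epsilon> < T\<close> the interval of integration lies in the
        positive half-line and the extension leaves no trace.\<close>
      have m0: "(\<lambda>\<sigma>. indicator {0<..} \<sigma> *\<^sub>R G z \<sigma>) \<in> borel_measurable lebesgue"
        using mG by (simp add: borel_measurable_restrict_space_iff)
      have "(\<lambda>\<sigma>. indicat_real {T - \<epsilon>..T} \<sigma> *\<^sub>R (indicator {0<..} \<sigma> *\<^sub>R G z \<sigma>)) \<in> borel_measurable lebesgue"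
        by (rule borel_measurable_scaleR[OF borel_measurable_indicator m0]) simp
      also have "(\<lambda>\<sigma>. indicat_real {T - \<epsilon>..T} \<sigma> *\<^sub>R (indicator {0<..} \<sigma> *\<^sub>R G z \<sigma>)) = (\<lambda>\<sigma>. indicator {T - \<epsilon>..T} \<sigma> *\<^sub>R G z \<sigma>)"
        using e by (auto simp: indicator_def fun_eq_iff)
      finally have m1: "(\<lambda>\<sigma>. indicat_real {T - \<epsilon>..T} \<sigma> *\<^sub>R G z \<sigma>) \<in> borel_measurable lebesgue" .
      have m2: "(\<lambda>\<sigma>. indicat_real {T - \<epsilon>..T} \<sigma> *\<^sub>R G' z \<sigma>) \<in> borel_measurable lebesgue"
        using mG' by (intro borel_measurable_scaleR borel_measurable_indicator) auto
      have "(LINT \<sigma>:{T - \<epsilon>..T}|lebesgue. G z \<sigma>) = (LINT \<sigma>:{T - \<epsilon>..T}|lebesgue. G' z \<sigma>)"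
        unfolding set_lebesgue_integral_def
      proof (rule integral_cong_AE[OF m1 m2], rule AE_I'[of N])
        show "N \<in> null_sets lebesgue" using N by (simp add: negligible_iff_null_sets)
        show "{\<sigma> \<in> space lebesgue. indicat_real {T - \<epsilon>..T} \<sigma> *\<^sub>R G z \<sigma> \<noteq> indicator {T - \<epsilon>..T} \<sigma> *\<^sub>R G' z \<sigma>} \<subseteq> N"
        proof (rule subsetI, rule ccontr)
          fix \<sigma> assume \<sigma>: "\<sigma> \<in> {\<sigma> \<in> space lebesgue. indicat_real {T - \<epsilon>..T} \<sigma> *\<^sub>R G z \<sigma> \<noteq> indicator {T - \<epsilon>..T} \<sigma> *\<^sub>R G' z \<sigma>}" "\<sigma> \<notin> N"
          then have "T - \<epsilon> \<le> \<sigma>" "\<sigma> \<le> T" by (auto simp: indicator_def split: if_splits)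
          then show False using \<sigma> eq[OF z, of \<sigma>] e by simp
        qed
      qed
      also have "\<dots> = integral {T - \<epsilon>..T} (G' z)"
      proof (rule set_lebesgue_integral_eq_integral(2))
        have z1: "norm z < 1" using z by simp
        define r where "r = (norm z + 1) / 2"
        have r: "0 < r" "r < 1" "norm z \<le> r" using z1 by (auto simp: r_def add_nonneg_pos)
        show "G' z absolutely_integrable_on {T - \<epsilon>..T}"
        proof (rule measurable_bounded_by_integrable_imp_absolutely_integrable)
          show "G' z \<in> borel_measurable (lebesgue_on {T - \<epsilon>..T})" using mG' by (rule measurable_restrict_space1)
          show "norm (G' z s) \<le> field_const TYPE(complex ^ 'n) r + 1" for s
            by (rule nice_field_bound[OF G' r(1,2) refl r(3)])
        qed auto
      qed
      finally show ?thesis .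
    qed
    have "\<forall>\<^sub>F \<epsilon> in at_right 0. \<forall>z\<in>K. (1 / \<epsilon>) *\<^sub>R (LINT \<sigma>:{T - \<epsilon>..T}|lebesgue. G z \<sigma>) = (1 / \<epsilon>) *\<^sub>R integral {T - \<epsilon>..T} (G' z)"
      using LI K(2) T0 by (intro eventually_at_rightI[of 0 T]) auto
    from uniform_limit_cong[OF this, of g g] u show ?thesis by simp
  qed
  \<comment> \<open>The supremum excludes the origin, and \<open>G' 0 T\<close> may differ from
    \<open>G 0 T\<close>; the value at 0 is recovered from the averages, which vanish identically
    there.\<close>
  have g0: "g 0 = 0"
  proof -
    have z0: "norm (0 :: complex ^ 'n) < 1" by simp
    have "G' 0 t = 0" for t
    proof -
      have "(\<lambda>z\<in>unit_ball. G' z t) \<in> class_M" using G' by (simp add: nice_field_def)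
      from class_M_zero[OF this] show ?thesis by simp
    qed
    then have "G' 0 = (\<lambda>_. 0)" by (rule ext)
    then have "(\<lambda>\<epsilon>. (1 / \<epsilon>) *\<^sub>R integral {T - \<epsilon>..T} (G' 0)) = (\<lambda>_. 0)" by simp
    moreover have "((\<lambda>\<epsilon>. (1 / \<epsilon>) *\<^sub>R integral {T - \<epsilon>..T} (G' 0)) \<longlongrightarrow> g 0) (at_right 0)"
      using tendsto_uniform_limitI[OF avg[of "{0}"], of 0] by simp
    ultimately show ?thesis
      using tendsto_unique[OF trivial_limit_at_right_real _ tendsto_const] by metis
  qed
  have strict_g: "Re (hinner (g z) z) \<le> - (- x) * (norm z)\<^sup>2" if "norm z < 1" for z
    using strict[OF that] g0 by (cases "z = 0") (auto simp: g_def)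
  have "0 < - x" using x0 by simp
  then show ?thesis by (rule not_extremal[OF G' T0 _ avg strict_g])
qed

theorem corollary4p9:
  fixes G :: "complex ^ 'n \<Rightarrow> real \<Rightarrow> complex ^ 'n"
    and \<phi> :: "real \<Rightarrow> complex ^ 'n \<Rightarrow> complex ^ 'n"
    and E :: "real set" and T :: real
  assumes "herglotz_vector_field G"
    and "evolution G \<phi>"
    and "exceptional_set G E"
    and "T \<in> {0<..} - E"
    and "(SUP z\<in>unit_ball - {0}. ereal (Re (hinner (G z T) ((1 / (norm z)\<^sup>2) *\<^sub>R z)))) < 0"
  shows "(\<forall>t>T. scaled_evolution \<phi> t \<in> class_S0 \<and> \<not> extremal (scaled_evolution \<phi> t)) \<and>
    (\<forall>F. evolution_limit \<phi> F \<longrightarrow> F \<in> class_S0 \<and> \<not> extremal F)"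
proof -
  obtain G' N where G': "nice_field G'" "negligible N" "\<And>z t. \<lbrakk>z \<in> unit_ball; 0 < t; t \<notin> N\<rbrakk> \<Longrightarrow> G' z t = G z t"
    using herglotz_nice_field[OF assms(1)] by blast
  show ?thesis
  proof (intro conjI allI impI)
    fix t assume t: "T < t"
    then have t0: "0 \<le> t" using assms(4) by simp
    \<comment> \<open>Stopping at \<open>t > T\<close> leaves the field unchanged up to
      \<open>T\<close> and turns the scaled flow map at time \<open>t\<close> into a limit
      map.\<close>
    have S: "nice_field (stop_field G' t)" by (rule nice_field_stop[OF G'(1)])
    have eq: "scaled_evolution \<phi> t = restrict (evlim (stop_field G' t)) unit_ball"
      unfolding scaled_evolution_def
    proof (rule restrict_ext)
      fix z :: "complex ^ 'n" assume z: "z \<in> unit_ball"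
      then show "exp t *\<^sub>R \<phi> t z = evlim (stop_field G' t) z"
        using evlim_stop_field[OF G'(1) _ t0, of z] evolution_eq_ev[OF assms(2) G' z t0] by simp
    qed
    show "scaled_evolution \<phi> t \<in> class_S0"
      unfolding eq by (rule restrict_evlim_in_class_S0[OF S])
    show "\<not> extremal (scaled_evolution \<phi> t)"
      unfolding eq
      by (rule evolution_limit_not_extremal[OF assms(1,3,4,5) S G'(2)]) (use G'(3) t in \<open>simp add: stop_field_def\<close>)
  next
    fix F assume F: "evolution_limit \<phi> F"
    then show "F \<in> class_S0" using assms(1,2) unfolding class_S0_def by blast
    have "F = restrict (evlim G') unit_ball" by (rule class_S0_eq_evlim[OF assms(1,2) F G'])
    then show "\<not> extremal F"
      using evolution_limit_not_extremal[OF assms(1,3,4,5) G'(1,2)] G'(3) by simp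
  qed
qed

end
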